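(* For each HRL-ringed space of finite rank $(M,K,\mathcal{C},\mathcal{L})$ there exists a well defined sheaf-cohomology class $$a(M)\in H^1\bigl(M,Hom_{\mathcal{C}}(\mathcal{L},Hom_{\mathcal{C}}(\mathcal{L},\mathcal{L}))\bigr)$$ such that the existence of a connection on $\mathcal{L}$ is equivalent to $a(M)=0$.
   Context: **HRL-ringed spaces.** Let $K$ be a commutative ring with unit and $C$ a commutative $K$-algebra with unit. A Herz-Reinhart-Lie (HRL) algebra over $(K,C)$ is a Lie algebra $L$ over $K$ which is also a $C$-module, endowed with a map $\iota:L\to\mathrm{Der}_K(C)$ (the derivations of $C$ over $K$) that is both a $K$-Lie algebra homomorphism and a $C$-module homomorphism, such that $[X,fY]=f[X,Y]+(\iota(X)f)Y$ for $f\in C$, $X,Y\in L$. An HRL-ringed space $(M,K,\mathcal{C},\mathcal{L})$ is a topological space $M$ with a sheaf $\mathcal{C}$ of commutative $K$-algebras with unit and a sheaf $\mathcal{L}$ such that, for every open $U\subseteq M$, $\Gamma_U(\mathcal{L})$ is an HRL-algebra over $(K,\Gamma_U(\mathcal{C}))$, with restrictions being homomorphisms of HRL-algebras. It has finite rank if $\mathcal{L}$ is a locally free $\mathcal{C}$-module of some finite rank. $Hom_{\mathcal{C}}$ denotes the sheaf of germs of $\mathcal{C}$-linear sheaf homomorphisms. **Connections.** A connection on $\mathcal{L}$ is a $K$-linear sheaf homomorphism $\nabla:\mathcal{L}\to Hom_{\mathcal{C}}(\mathcal{L},\mathcal{L})$ with $\nabla(fX)=f\nabla X+(df)X$ for $f\in\mathcal{C}$,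 $X\in\mathcal{L}$, where $(df)X$ is the homomorphism $Y\mapsto(\iota(Y)f)X$. *)

theory Defs
  imports "HOL-Analysis.Abstract_Topology" "HOL-Algebra.Module"
begin

section \<open>Sheaves on a topological space\<close>

text \<open>
  A (pre)sheaf \<open>F\<close> consists of a structure \<open>sect F U\<close> (a record with a carrier) for every open
  set \<open>U\<close> and of maps \<open>res F U V\<close> from the sections over \<open>U\<close> to those over \<open>V\<close>, for \<open>V \<subseteq> U\<close>.
  The sections over all open sets are drawn from one type \<open>'s\<close>; this is no loss of generality,
  since the carriers over different open sets are unrelated. Values of \<open>sect\<close> and \<open>res\<close> at
  arguments other than open sets \<open>V \<subseteq> U\<close> are irrelevant.
\<close>

record ('a, 's, 'm) sheaf_data =
  sect :: "'a set \<Rightarrow> 'm"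
  res :: "'a set \<Rightarrow> 'a set \<Rightarrow> 's \<Rightarrow> 's"

definition opens :: "'a topology \<Rightarrow> 'a set \<Rightarrow> 'a set set" where
  "opens M U = {V. openin M V \<and> V \<subseteq> U}"

locale set_sheaf =
  fixes M :: "'a topology"
    and F :: "('a, 's, ('s, 'z) partial_object_scheme) sheaf_data"
  assumes res_closed:
      "\<lbrakk>openin M U; V \<in> opens M U; s \<in> carrier (sect F U)\<rbrakk> \<Longrightarrow> res F U V s \<in> carrier (sect F V)"
    and res_id: "\<lbrakk>openin M U; s \<in> carrier (sect F U)\<rbrakk> \<Longrightarrow> res F U U s = s"
    and res_comp:
      "\<lbrakk>openin M U; V \<in> opens M U; W \<in> opens M V; s \<in> carrier (sect F U)\<rbrakk>
        \<Longrightarrow> res F V W (res F U V s) = res F U W s"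
    and locality:
      "\<lbrakk>\<And>U. U \<in> \<U> \<Longrightarrow> openin M U; s \<in> carrier (sect F (\<Union>\<U>)); t \<in> carrier (sect F (\<Union>\<U>));
        \<And>U. U \<in> \<U> \<Longrightarrow> res F (\<Union>\<U>) U s = res F (\<Union>\<U>) U t\<rbrakk> \<Longrightarrow> s = t"
    and gluing:
      "\<lbrakk>\<And>U. U \<in> \<U> \<Longrightarrow> openin M U; \<And>U. U \<in> \<U> \<Longrightarrow> \<sigma> U \<in> carrier (sect F U);
        \<And>U V. \<lbrakk>U \<in> \<U>; V \<in> \<U>\<rbrakk> \<Longrightarrow> res F U (U \<inter> V) (\<sigma> U) = res F V (U \<inter> V) (\<sigma> V)\<rbrakk>
        \<Longrightarrow> \<exists>s \<in> carrier (sect F (\<Union>\<U>)). \<forall>U\<in>\<U>. res F (\<Union>\<U>) U s = \<sigma> U"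

text \<open>
  Sheaf homomorphisms from the restriction of \<open>F\<close> to \<open>U\<close> into the restriction of \<open>G\<close> to \<open>U\<close>.
  All functions are extensional, so that equality of sheaf homomorphisms is equality in HOL.
\<close>

definition sheaf_homs ::
  "'a topology \<Rightarrow> 'a set \<Rightarrow> ('a, 's, ('s, 'y) partial_object_scheme) sheaf_data
    \<Rightarrow> ('a, 't, ('t, 'z) partial_object_scheme) sheaf_data \<Rightarrow> ('a set \<Rightarrow> 's \<Rightarrow> 't) set" where
  "sheaf_homs M U F G =
    {\<phi> \<in> (\<Pi>\<^sub>E V\<in>opens M U. carrier (sect F V) \<rightarrow>\<^sub>E carrier (sect G V)).
      \<forall>V\<in>opens M U. \<forall>W\<in>opens M V. \<forall>s\<in>carrier (sect F V).
        res G V W (\<phi> V s) = \<phi> W (res F V W s)}"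

definition additive_map ::
  "('s, 'y) ring_scheme \<Rightarrow> ('t, 'z) ring_scheme \<Rightarrow> ('s \<Rightarrow> 't) \<Rightarrow> bool" where
  "additive_map A B h \<longleftrightarrow>
    (\<forall>x\<in>carrier A. \<forall>y\<in>carrier A. h (x \<oplus>\<^bsub>A\<^esub> y) = h x \<oplus>\<^bsub>B\<^esub> h y)"

definition linear_map ::
  "('r, 'x) ring_scheme \<Rightarrow> ('r, 's, 'y) module_scheme \<Rightarrow> ('r, 't, 'z) module_scheme
    \<Rightarrow> ('s \<Rightarrow> 't) \<Rightarrow> bool" where
  "linear_map R A B h \<longleftrightarrow> additive_map A B h \<and>
    (\<forall>r\<in>carrier R. \<forall>x\<in>carrier A. h (r \<odot>\<^bsub>A\<^esub> x) = r \<odot>\<^bsub>B\<^esub> h x)"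

definition linear_sheaf_homs ::
  "'a topology \<Rightarrow> ('a, 'c, ('c, 'x) ring_scheme) sheaf_data \<Rightarrow> 'a set
    \<Rightarrow> ('a, 's, ('c, 's, 'y) module_scheme) sheaf_data
    \<Rightarrow> ('a, 't, ('c, 't, 'z) module_scheme) sheaf_data \<Rightarrow> ('a set \<Rightarrow> 's \<Rightarrow> 't) set" where
  "linear_sheaf_homs M C U F G =
    {\<phi> \<in> sheaf_homs M U F G. \<forall>V\<in>opens M U. linear_map (sect C V) (sect F V) (sect G V) (\<phi> V)}"

text \<open>
  The sheaf of germs of \<open>C\<close>-linear homomorphisms from \<open>F\<close> to \<open>G\<close>. Its sections over \<open>U\<close> are the
  homomorphisms between the restrictions to \<open>U\<close>. The record type for modules inherits the ring
  fields \<open>mult\<close> and \<open>one\<close>, which play no role for modules.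
\<close>

definition Hom_sheaf ::
  "'a topology \<Rightarrow> ('a, 'c, ('c, 'x) ring_scheme) sheaf_data
    \<Rightarrow> ('a, 's, ('c, 's, 'y) module_scheme) sheaf_data
    \<Rightarrow> ('a, 't, ('c, 't, 'z) module_scheme) sheaf_data
    \<Rightarrow> ('a, 'a set \<Rightarrow> 's \<Rightarrow> 't, ('c, 'a set \<Rightarrow> 's \<Rightarrow> 't) module) sheaf_data" where
  "Hom_sheaf M C F G =
    \<lparr> sect = (\<lambda>U.
        \<lparr> carrier = linear_sheaf_homs M C U F G,
          mult = undefined,
          one = undefined,
          zero = (\<lambda>V\<in>opens M U. \<lambda>s\<in>carrier (sect F V). \<zero>\<^bsub>sect G V\<^esub>),
          add = (\<lambda>\<phi> \<psi>. \<lambda>V\<in>opens M U. \<lambda>s\<in>carrier (sect F V). \<phi> V s \<oplus>\<^bsub>sect G V\<^esub> \<psi> V s),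
          smult = (\<lambda>f \<phi>. \<lambda>V\<in>opens M U. \<lambda>s\<in>carrier (sect F V).
            res C U V f \<odot>\<^bsub>sect G V\<^esub> \<phi> V s) \<rparr>),
      res = (\<lambda>U V \<phi>. restrict \<phi> (opens M V)) \<rparr>"

definition free_sheaf ::
  "nat \<Rightarrow> ('a, 'c, ('c, 'x) ring_scheme) sheaf_data
    \<Rightarrow> ('a, nat \<Rightarrow> 'c, ('c, nat \<Rightarrow> 'c) module) sheaf_data" where
  "free_sheaf n C =
    \<lparr> sect = (\<lambda>U.
        \<lparr> carrier = {..<n} \<rightarrow>\<^sub>E carrier (sect C U),
          mult = undefined,
          one = undefined,
          zero = (\<lambda>i\<in>{..<n}. \<zero>\<^bsub>sect C U\<^esub>),
          add = (\<lambda>x y. \<lambda>i\<in>{..<n}. x i \<oplus>\<^bsub>sect C U\<^esub> y i),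
          smult = (\<lambda>f x. \<lambda>i\<in>{..<n}. f \<otimes>\<^bsub>sect C U\<^esub> x i) \<rparr>),
      res = (\<lambda>U V x. \<lambda>i\<in>{..<n}. res C U V (x i)) \<rparr>"

definition locally_free ::
  "'a topology \<Rightarrow> ('a, 'c, ('c, 'x) ring_scheme) sheaf_data \<Rightarrow> nat
    \<Rightarrow> ('a, 's, ('c, 's, 'y) module_scheme) sheaf_data \<Rightarrow> bool" where
  "locally_free M C n F \<longleftrightarrow>
    (\<forall>x\<in>topspace M. \<exists>U. openin M U \<and> x \<in> U \<and>
      (\<exists>\<phi> \<in> linear_sheaf_homs M C U F (free_sheaf n C).
        \<forall>V\<in>opens M U. bij_betw (\<phi> V) (carrier (sect F V)) (carrier (sect (free_sheaf n C) V))))"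


section \<open>Herz-Reinhart-Lie algebras and HRL-ringed spaces\<close>

locale lie_algebra = Module.module K A
  for K (structure) and A (structure) +
  fixes brk :: "'l \<Rightarrow> 'l \<Rightarrow> 'l"
  assumes brk_closed: "\<lbrakk>X \<in> carrier A; Y \<in> carrier A\<rbrakk> \<Longrightarrow> brk X Y \<in> carrier A"
    and brk_linear_left: "Y \<in> carrier A \<Longrightarrow> linear_map K A A (\<lambda>X. brk X Y)"
    and brk_linear_right: "X \<in> carrier A \<Longrightarrow> linear_map K A A (brk X)"
    and brk_alternating: "X \<in> carrier A \<Longrightarrow> brk X X = \<zero>\<^bsub>A\<^esub>"
    and jacobi:
      "\<lbrakk>X \<in> carrier A; Y \<in> carrier A; Z \<in> carrier A\<rbrakk>
        \<Longrightarrow> brk X (brk Y Z) \<oplus>\<^bsub>A\<^esub> brk Y (brk Z X) \<oplus>\<^bsub>A\<^esub> brk Z (brk X Y) = \<zero>\<^bsub>A\<^esub>"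

definition derivations ::
  "('k, 'y) ring_scheme \<Rightarrow> ('k, 'c, 'z) module_scheme \<Rightarrow> ('c \<Rightarrow> 'c) set" where
  "derivations K C =
    {D \<in> carrier C \<rightarrow> carrier C. linear_map K C C D \<and>
      (\<forall>f\<in>carrier C. \<forall>g\<in>carrier C. D (f \<otimes>\<^bsub>C\<^esub> g) = (D f \<otimes>\<^bsub>C\<^esub> g) \<oplus>\<^bsub>C\<^esub> (f \<otimes>\<^bsub>C\<^esub> D g))}"

text \<open>
  The inherited field \<open>smult\<close> of the following record is multiplication by elements of \<open>C\<close>,
  \<open>kmult\<close> is multiplication by elements of \<open>K\<close>, and \<open>anchor\<close> is the homomorphism \<open>\<iota>\<close> from \<open>L\<close> to \<open>Der\<^sub>K(C)\<close>.
\<close>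

record ('k, 'c, 'l) hrl = "('c, 'l) module" +
  kmult :: "'k \<Rightarrow> 'l \<Rightarrow> 'l"
  bracket :: "'l \<Rightarrow> 'l \<Rightarrow> 'l"
  anchor :: "'l \<Rightarrow> 'c \<Rightarrow> 'c"

definition K_module :: "('k, 'c, 'l, 'z) hrl_scheme \<Rightarrow> ('k, 'l) module" where
  "K_module L = \<lparr> carrier = carrier L, mult = mult L, one = one L, zero = zero L, add = add L,
    smult = kmult L \<rparr>"

text \<open>
  The assumption \<open>kmult_compat\<close> says that the given \<open>K\<close>-module structure of \<open>L\<close> is the one
  induced by its \<open>C\<close>-module structure and the \<open>K\<close>-algebra \<open>C\<close>, as is always understood for
  modules over a \<open>K\<close>-algebra. The operations on \<open>Der\<^sub>K(C)\<close> (pointwise addition and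
  multiplication by elements of \<open>K\<close> and \<open>C\<close>, commutator bracket) are written out pointwise.
\<close>

locale hrl_algebra =
  fixes K :: "('k, 'y) ring_scheme"
    and C :: "('k, 'c, 'z) module_scheme"
    and L :: "('k, 'c, 'l, 'w) hrl_scheme"
  assumes K_cring: "cring K"
    and C_algebra: "algebra K C"
    and L_module: "Module.module C L"
    and L_lie: "lie_algebra K (K_module L) (bracket L)"
    and kmult_compat:
      "\<lbrakk>k \<in> carrier K; f \<in> carrier C; X \<in> carrier L\<rbrakk>
        \<Longrightarrow> (k \<odot>\<^bsub>C\<^esub> f) \<odot>\<^bsub>L\<^esub> X = kmult L k (f \<odot>\<^bsub>L\<^esub> X)"
    and anchor_derivation: "X \<in> carrier L \<Longrightarrow> anchor L X \<in> derivations K C"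
    and anchor_add:
      "\<lbrakk>X \<in> carrier L; Y \<in> carrier L; f \<in> carrier C\<rbrakk>
        \<Longrightarrow> anchor L (X \<oplus>\<^bsub>L\<^esub> Y) f = anchor L X f \<oplus>\<^bsub>C\<^esub> anchor L Y f"
    and anchor_kmult:
      "\<lbrakk>k \<in> carrier K; X \<in> carrier L; f \<in> carrier C\<rbrakk>
        \<Longrightarrow> anchor L (kmult L k X) f = k \<odot>\<^bsub>C\<^esub> anchor L X f"
    and anchor_smult:
      "\<lbrakk>g \<in> carrier C; X \<in> carrier L; f \<in> carrier C\<rbrakk>
        \<Longrightarrow> anchor L (g \<odot>\<^bsub>L\<^esub> X) f = g \<otimes>\<^bsub>C\<^esub> anchor L X f"
    and anchor_bracket:
      "\<lbrakk>X \<in> carrier L; Y \<in> carrier L; f \<in> carrier C\<rbrakk>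
        \<Longrightarrow> anchor L (bracket L X Y) f
          = anchor L X (anchor L Y f) \<ominus>\<^bsub>C\<^esub> anchor L Y (anchor L X f)"
    and bracket_leibniz:
      "\<lbrakk>X \<in> carrier L; Y \<in> carrier L; f \<in> carrier C\<rbrakk>
        \<Longrightarrow> bracket L X (f \<odot>\<^bsub>L\<^esub> Y) = (f \<odot>\<^bsub>L\<^esub> bracket L X Y) \<oplus>\<^bsub>L\<^esub> (anchor L X f \<odot>\<^bsub>L\<^esub> Y)"

locale hrl_ringed_space =
  fixes M :: "'a topology"
    and K :: "('k, 'y) ring_scheme"
    and C :: "('a, 'c, ('k, 'c, 'z) module_scheme) sheaf_data"
    and L :: "('a, 'l, ('k, 'c, 'l, 'w) hrl_scheme) sheaf_data"
  assumes C_sheaf: "set_sheaf M C"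
    and L_sheaf: "set_sheaf M L"
    and sections_hrl: "openin M U \<Longrightarrow> hrl_algebra K (sect C U) (sect L U)"
    and C_res_ring_hom:
      "\<lbrakk>openin M U; V \<in> opens M U\<rbrakk> \<Longrightarrow> res C U V \<in> ring_hom (sect C U) (sect C V)"
    and C_res_linear:
      "\<lbrakk>openin M U; V \<in> opens M U\<rbrakk> \<Longrightarrow> linear_map K (sect C U) (sect C V) (res C U V)"
    and L_res_linear:
      "\<lbrakk>openin M U; V \<in> opens M U\<rbrakk>
        \<Longrightarrow> linear_map K (K_module (sect L U)) (K_module (sect L V)) (res L U V)"
    and L_res_smult:
      "\<lbrakk>openin M U; V \<in> opens M U; f \<in> carrier (sect C U); X \<in> carrier (sect L U)\<rbrakk>
        \<Longrightarrow> res L U V (f \<odot>\<^bsub>sect L U\<^esub> X) = res C U V f \<odot>\<^bsub>sect L V\<^esub> res L U V X"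
    and L_res_bracket:
      "\<lbrakk>openin M U; V \<in> opens M U; X \<in> carrier (sect L U); Y \<in> carrier (sect L U)\<rbrakk>
        \<Longrightarrow> res L U V (bracket (sect L U) X Y) = bracket (sect L V) (res L U V X) (res L U V Y)"
    and res_anchor:
      "\<lbrakk>openin M U; V \<in> opens M U; X \<in> carrier (sect L U); f \<in> carrier (sect C U)\<rbrakk>
        \<Longrightarrow> res C U V (anchor (sect L U) X f) = anchor (sect L V) (res L U V X) (res C U V f)"

locale hrl_ringed_space_of_finite_rank = hrl_ringed_space +
  assumes finite_rank: "\<exists>n. locally_free M C n L"


section \<open>Connections\<close>

text \<open>The section \<open>(df)X\<close> of the sheaf of endomorphisms of \<open>L\<close> over \<open>U\<close>.\<close>

definition d_tensor ::
  "'a topology \<Rightarrow> ('a, 'c, ('k, 'c, 'z) module_scheme) sheaf_data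
    \<Rightarrow> ('a, 'l, ('k, 'c, 'l, 'w) hrl_scheme) sheaf_data \<Rightarrow> 'a set \<Rightarrow> 'c \<Rightarrow> 'l \<Rightarrow> ('a set \<Rightarrow> 'l \<Rightarrow> 'l)" where
  "d_tensor M C L U f X =
    (\<lambda>V\<in>opens M U. \<lambda>Y\<in>carrier (sect L V).
      anchor (sect L V) Y (res C U V f) \<odot>\<^bsub>sect L V\<^esub> res L U V X)"

text \<open>
  The connections on the restriction of \<open>L\<close> to \<open>U\<close>; the connections on \<open>L\<close> are obtained for
  \<open>U = topspace M\<close>. The sheaf of endomorphisms carries the pointwise \<open>K\<close>-multiplication.
\<close>

definition connections ::
  "'a topology \<Rightarrow> ('k, 'y) ring_scheme \<Rightarrow> ('a, 'c, ('k, 'c, 'z) module_scheme) sheaf_data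
    \<Rightarrow> ('a, 'l, ('k, 'c, 'l, 'w) hrl_scheme) sheaf_data \<Rightarrow> 'a set
    \<Rightarrow> ('a set \<Rightarrow> 'l \<Rightarrow> ('a set \<Rightarrow> 'l \<Rightarrow> 'l)) set" where
  "connections M K C L U =
    {D \<in> sheaf_homs M U L (Hom_sheaf M C L L). \<forall>V\<in>opens M U.
      additive_map (sect L V) (sect (Hom_sheaf M C L L) V) (D V) \<and>
      (\<forall>k\<in>carrier K. \<forall>X\<in>carrier (sect L V).
        D V (kmult (sect L V) k X)
          = (\<lambda>W\<in>opens M V. \<lambda>Y\<in>carrier (sect L W). kmult (sect L W) k (D V X W Y))) \<and>
      (\<forall>f\<in>carrier (sect C V). \<forall>X\<in>carrier (sect L V).
        D V (f \<odot>\<^bsub>sect L V\<^esub> X)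
          = (f \<odot>\<^bsub>sect (Hom_sheaf M C L L) V\<^esub> D V X)
            \<oplus>\<^bsub>sect (Hom_sheaf M C L L) V\<^esub> d_tensor M C L V f X)}"


section \<open>First sheaf cohomology\<close>

text \<open>
  Cohomology is Cech cohomology, i.e. the direct limit over all open covers, ordered by
  refinement, of the Cech cohomology of the covers; in degree one this is sheaf cohomology
  on every topological space. Covers are sets of open sets, indexed by themselves; these are
  cofinal among all covers. Values of cochains off the cover are irrelevant.
\<close>

definition open_covers :: "'a topology \<Rightarrow> 'a set set set" where
  "open_covers M = {\<U>. (\<forall>U\<in>\<U>. openin M U) \<and> \<Union>\<U> = topspace M}"

definition cech_cocycles ::
  "('a, 's, ('s, 'z) ring_scheme) sheaf_data \<Rightarrow> 'a set set \<Rightarrow> ('a set \<Rightarrow> 'a set \<Rightarrow> 's) set" where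
  "cech_cocycles F \<U> =
    {c. (\<forall>U\<in>\<U>. \<forall>V\<in>\<U>. c U V \<in> carrier (sect F (U \<inter> V))) \<and>
      (\<forall>U\<in>\<U>. \<forall>V\<in>\<U>. \<forall>W\<in>\<U>.
        (res F (V \<inter> W) (U \<inter> V \<inter> W) (c V W)
          \<ominus>\<^bsub>sect F (U \<inter> V \<inter> W)\<^esub> res F (U \<inter> W) (U \<inter> V \<inter> W) (c U W))
          \<oplus>\<^bsub>sect F (U \<inter> V \<inter> W)\<^esub> res F (U \<inter> V) (U \<inter> V \<inter> W) (c U V)
        = \<zero>\<^bsub>sect F (U \<inter> V \<inter> W)\<^esub>)}"

definition cohomologous ::
  "('a, 's, ('s, 'z) ring_scheme) sheaf_data \<Rightarrow> 'a set set
    \<Rightarrow> ('a set \<Rightarrow> 'a set \<Rightarrow> 's) \<Rightarrow> ('a set \<Rightarrow> 'a set \<Rightarrow> 's) \<Rightarrow> bool" where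
  "cohomologous F \<U> c d \<longleftrightarrow>
    (\<exists>b. (\<forall>U\<in>\<U>. b U \<in> carrier (sect F U)) \<and>
      (\<forall>U\<in>\<U>. \<forall>V\<in>\<U>. c U V \<ominus>\<^bsub>sect F (U \<inter> V)\<^esub> d U V
        = res F V (U \<inter> V) (b V) \<ominus>\<^bsub>sect F (U \<inter> V)\<^esub> res F U (U \<inter> V) (b U)))"

definition refinement_maps :: "'a set set \<Rightarrow> 'a set set \<Rightarrow> ('a set \<Rightarrow> 'a set) set" where
  "refinement_maps \<W> \<U> = {\<tau> \<in> \<W> \<rightarrow> \<U>. \<forall>W\<in>\<W>. W \<subseteq> \<tau> W}"

definition pull_back ::
  "('a, 's, 'm) sheaf_data \<Rightarrow> ('a set \<Rightarrow> 'a set)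
    \<Rightarrow> ('a set \<Rightarrow> 'a set \<Rightarrow> 's) \<Rightarrow> ('a set \<Rightarrow> 'a set \<Rightarrow> 's)" where
  "pull_back F \<tau> c = (\<lambda>V W. res F (\<tau> V \<inter> \<tau> W) (V \<inter> W) (c (\<tau> V) (\<tau> W)))"

definition cech_pairs ::
  "'a topology \<Rightarrow> ('a, 's, ('s, 'z) ring_scheme) sheaf_data
    \<Rightarrow> ('a set set \<times> ('a set \<Rightarrow> 'a set \<Rightarrow> 's)) set" where
  "cech_pairs M F = (SIGMA \<U>:open_covers M. cech_cocycles F \<U>)"

definition cech_rel ::
  "'a topology \<Rightarrow> ('a, 's, ('s, 'z) ring_scheme) sheaf_data
    \<Rightarrow> (('a set set \<times> ('a set \<Rightarrow> 'a set \<Rightarrow> 's)) \<times> ('a set set \<times> ('a set \<Rightarrow> 'a set \<Rightarrow> 's))) set" where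
  "cech_rel M F =
    {((\<U>, c), (\<V>, d)). (\<U>, c) \<in> cech_pairs M F \<and> (\<V>, d) \<in> cech_pairs M F \<and>
      (\<exists>\<W>\<in>open_covers M. \<exists>\<sigma>\<in>refinement_maps \<W> \<U>. \<exists>\<tau>\<in>refinement_maps \<W> \<V>.
        cohomologous F \<W> (pull_back F \<sigma> c) (pull_back F \<tau> d))}"

definition cohomology_class ::
  "'a topology \<Rightarrow> ('a, 's, ('s, 'z) ring_scheme) sheaf_data
    \<Rightarrow> 'a set set \<Rightarrow> ('a set \<Rightarrow> 'a set \<Rightarrow> 's) \<Rightarrow> ('a set set \<times> ('a set \<Rightarrow> 'a set \<Rightarrow> 's)) set" where
  "cohomology_class M F \<U> c = cech_rel M F `` {(\<U>, c)}"

text \<open>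
  The additive group \<open>H\<^sup>1(M, F)\<close>, as a record with \<open>zero\<close> and \<open>add\<close>. Two classes are added
  by adding representatives on a common cover.
\<close>

definition H1 ::
  "'a topology \<Rightarrow> ('a, 's, ('s, 'z) ring_scheme) sheaf_data
    \<Rightarrow> ('a set set \<times> ('a set \<Rightarrow> 'a set \<Rightarrow> 's)) set ring" where
  "H1 M F =
    \<lparr> carrier = cech_pairs M F // cech_rel M F,
      mult = undefined,
      one = undefined,
      zero = cohomology_class M F {topspace M} (\<lambda>U V. \<zero>\<^bsub>sect F (U \<inter> V)\<^esub>),
      add = (\<lambda>A B. cech_rel M F ``
        {(\<U>, \<lambda>U V. c U V \<oplus>\<^bsub>sect F (U \<inter> V)\<^esub> d U V) | \<U> c d. (\<U>, c) \<in> A \<and> (\<U>, d) \<in> B}) \<rparr>"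


section \<open>The obstruction class\<close>

text \<open>
  A system of local connections is an open cover \<open>\<U>\<close> together with a connection \<open>D U\<close> on the
  restriction of \<open>L\<close> to each \<open>U\<close> in \<open>\<U>\<close>. On \<open>U \<inter> V\<close> the difference \<open>D V - D U\<close> is
  \<open>C\<close>-linear; these differences are the cocycle representing the obstruction class.
\<close>

definition local_connections ::
  "'a topology \<Rightarrow> ('k, 'y) ring_scheme \<Rightarrow> ('a, 'c, ('k, 'c, 'z) module_scheme) sheaf_data
    \<Rightarrow> ('a, 'l, ('k, 'c, 'l, 'w) hrl_scheme) sheaf_data \<Rightarrow> 'a set set
    \<Rightarrow> ('a set \<Rightarrow> 'a set \<Rightarrow> 'l \<Rightarrow> ('a set \<Rightarrow> 'l \<Rightarrow> 'l)) set" where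
  "local_connections M K C L \<U> = {D. \<forall>U\<in>\<U>. D U \<in> connections M K C L U}"

definition connection_differences ::
  "'a topology \<Rightarrow> ('a, 'c, ('k, 'c, 'z) module_scheme) sheaf_data
    \<Rightarrow> ('a, 'l, ('k, 'c, 'l, 'w) hrl_scheme) sheaf_data
    \<Rightarrow> ('a set \<Rightarrow> 'a set \<Rightarrow> 'l \<Rightarrow> ('a set \<Rightarrow> 'l \<Rightarrow> 'l))
    \<Rightarrow> 'a set \<Rightarrow> 'a set \<Rightarrow> ('a set \<Rightarrow> 'l \<Rightarrow> ('a set \<Rightarrow> 'l \<Rightarrow> 'l))" where
  "connection_differences M C L D =
    (\<lambda>U V. \<lambda>W\<in>opens M (U \<inter> V). \<lambda>X\<in>carrier (sect L W).
      D V W X \<ominus>\<^bsub>sect (Hom_sheaf M C L L) W\<^esub> D U W X)"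

definition is_obstruction_class ::
  "'a topology \<Rightarrow> ('k, 'y) ring_scheme \<Rightarrow> ('a, 'c, ('k, 'c, 'z) module_scheme) sheaf_data
    \<Rightarrow> ('a, 'l, ('k, 'c, 'l, 'w) hrl_scheme) sheaf_data
    \<Rightarrow> ('a set set \<times> ('a set \<Rightarrow> 'a set \<Rightarrow> ('a set \<Rightarrow> 'l \<Rightarrow> ('a set \<Rightarrow> 'l \<Rightarrow> 'l)))) set \<Rightarrow> bool" where
  "is_obstruction_class M K C L a \<longleftrightarrow>
    (\<exists>\<U>\<in>open_covers M. \<exists>D\<in>local_connections M K C L \<U>.
      a = cohomology_class M (Hom_sheaf M C L (Hom_sheaf M C L L)) \<U>
        (connection_differences M C L D))"

end

theory Submission
  imports Defs
begin

text \<open>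
  In a local frame there is a connection, namely the one that annihilates the frame. Two connections
  differ by a \<open>C\<close>-linear homomorphism, so the differences of local connections form a Cech 1-cocycle,
  and another choice of local connections changes it by the coboundary of the differences of the
  two choices. If the cocycle is, on a refinement, the coboundary of \<open>b\<close>, then the local
  connections \<open>D - b\<close> agree on overlaps and glue to a global one.
\<close>

section \<open>First Cech cohomology\<close>

text \<open>The rule for a connection is affine rather than linear: the term \<open>d_tensor\<close>
  is the same for all connections. So the connections over an open \<open>U\<close> are either
  absent or a torsor under \<open>linear_sheaf_homs M C U L EndL\<close>, and the class measures
  whether a torsor with local sections has a global one. Finite rank provides the local sections.
  Two obstacles shape the proof. Classes live in a limit over covers, and a chain of two comparisons
  reaches the middle cover through two different refinement maps; the relation is transitive because
  these give cohomologous pull backs of a cocycle. Secondly, a section of a Hom sheaf over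
  \<open>U\<close> is a family of maps, one for every open subset of \<open>U\<close>, so gluing has
  to produce values on open sets that lie in no member of the cover. This is done once for maps
  without algebraic structure; linearity or the Leibniz rule is then checked locally. The Hom
  construction is set up for arbitrary sheaves of modules since it is applied twice, to
  \<open>L\<close> and \<open>L\<close> and then to \<open>L\<close> and
  \<open>EndL\<close>.\<close>

lemma mem_opens [simp]: "V \<in> opens M U \<longleftrightarrow> openin M V \<and> V \<subseteq> U"
  by (simp add: opens_def)

section \<open>Identities for differences in an abelian group\<close>

context abelian_group
begin

lemma minus_diff:
  assumes "a \<in> carrier G" "b \<in> carrier G"
  shows "\<ominus> (a \<ominus> b) = b \<ominus> a"
  using assms by (simp add: minus_eq minus_add a_comm)

lemma diff_add_diff:
  assumes "a \<in> carrier G" "b \<in> carrier G" "c \<in> carrier G"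
  shows "(a \<ominus> b) \<oplus> (b \<ominus> c) = a \<ominus> c"
  using assms by (simp add: minus_eq a_assoc r_neg1)

text \<open>With \<open>a\<close>, \<open>b\<close>, \<open>c\<close> the values of connections over
  \<open>U\<close>, \<open>V\<close>, \<open>W\<close>, this is the cocycle condition for their
  differences, in the order of terms used by \<open>cech_cocycles\<close>.\<close>

lemma diff_cocycle:
  assumes "a \<in> carrier G" "b \<in> carrier G" "c \<in> carrier G"
  shows "((c \<ominus> b) \<ominus> (c \<ominus> a)) \<oplus> (b \<ominus> a) = \<zero>"
proof -
  have "((c \<ominus> b) \<ominus> (c \<ominus> a)) \<oplus> (b \<ominus> a) = (c \<ominus> b) \<oplus> ((b \<ominus> a) \<oplus> (a \<ominus> c))"
    using assms by (simp add: minus_eq[of _ "c \<ominus> a"] minus_diff a_ac)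
  also have "\<dots> = c \<ominus> c" using assms by (simp add: diff_add_diff)
  finally show ?thesis using assms by (simp add: minus_eq r_neg)
qed

text \<open>Rewrites the difference of two cochains, each consisting of differences of connections,
  as the coboundary of the difference of the two systems of connections.\<close>

lemma diff_diff_swap:
  assumes "a \<in> carrier G" "b \<in> carrier G" "c \<in> carrier G" "d \<in> carrier G"
  shows "(a \<ominus> b) \<ominus> (c \<ominus> d) = (a \<ominus> c) \<ominus> (b \<ominus> d)"
  using assms by (simp add: minus_eq minus_add a_ac)

text \<open>Passes from "the differences of \<open>D\<close> are the coboundary of \<open>b\<close>"
  to "\<open>D - b\<close> agrees on overlaps".\<close>

lemma diff_eq_diff_swap:
  assumes "a \<in> carrier G" "b \<in> carrier G" "c \<in> carrier G" "d \<in> carrier G"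
    and "a \<ominus> b = c \<ominus> d"
  shows "a \<ominus> c = b \<ominus> d"
proof -
  have "a \<ominus> c = (a \<ominus> b) \<oplus> (b \<ominus> c)"
    using assms(1-4) by (simp add: diff_add_diff)
  also have "\<dots> = (b \<ominus> c) \<oplus> (c \<ominus> d)"
    unfolding assms(5) using assms(1-4) by (simp add: a_comm)
  finally show ?thesis using assms(1-4) by (simp add: diff_add_diff)
qed

lemma diff_eq_of_add_eq:
  assumes "a \<in> carrier G" "b \<in> carrier G" "c \<in> carrier G" "d \<in> carrier G"
    and "a \<oplus> b = c \<oplus> d"
  shows "b \<ominus> c = d \<ominus> a"
proof -
  have "b \<ominus> (\<ominus> a) = c \<ominus> (\<ominus> d)"
    using assms by (simp add: minus_eq a_comm)
  then have "b \<ominus> c = \<ominus> a \<ominus> \<ominus> d"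
    using assms(1-4) by (rule_tac diff_eq_diff_swap) auto
  then show ?thesis using assms(1-4) by (simp add: minus_eq a_comm)
qed

text \<open>Solves the cocycle condition for its middle term: \<open>a\<close>, \<open>b\<close>,
  \<open>c\<close> stand for the restrictions of \<open>c U V\<close>, \<open>c V W\<close> and
  \<open>c U W\<close>.\<close>

lemma eq_add_of_cocycle:
  assumes "a \<in> carrier G" "b \<in> carrier G" "c \<in> carrier G"
    and "(b \<ominus> c) \<oplus> a = \<zero>"
  shows "c = a \<oplus> b"
proof -
  have "a \<oplus> b = a \<oplus> ((b \<ominus> c) \<oplus> c)"
    using assms(1-3) by (simp add: minus_eq a_assoc l_neg)
  also have "\<dots> = ((b \<ominus> c) \<oplus> a) \<oplus> c"
    using assms(1-3) by (simp add: a_ac)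
  finally show ?thesis using assms by simp
qed

lemma diff_zero: "a \<in> carrier G \<Longrightarrow> a \<ominus> \<zero> = a"
  using minus_equality[of \<zero> \<zero>] by (simp add: minus_eq)

lemma add_diff_cancel_right:
  assumes "a \<in> carrier G" "b \<in> carrier G" "c \<in> carrier G"
  shows "(a \<oplus> c) \<ominus> (b \<oplus> c) = a \<ominus> b"
proof -
  have "(a \<oplus> c) \<ominus> (b \<oplus> c) = a \<oplus> (c \<oplus> (\<ominus> c \<oplus> \<ominus> b))"
    using assms by (simp add: minus_eq minus_add a_ac)
  also have "\<dots> = a \<ominus> b" using assms by (simp add: minus_eq r_neg2)
  finally show ?thesis .
qed

lemma add_diff_add:
  assumes "a \<in> carrier G" "b \<in> carrier G" "c \<in> carrier G" "d \<in> carrier G"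
  shows "(a \<oplus> b) \<ominus> (c \<oplus> d) = (a \<ominus> c) \<oplus> (b \<ominus> d)"
  using assms by (simp add: minus_eq minus_add a_ac)

end

section \<open>Open covers and their refinements\<close>

lemma common_refinement:
  assumes "\<U> \<in> open_covers M" "\<V> \<in> open_covers M"
  obtains \<W> \<sigma> \<tau> where "\<W> \<in> open_covers M" "\<sigma> \<in> refinement_maps \<W> \<U>" "\<tau> \<in> refinement_maps \<W> \<V>"
proof -
  define \<W> where "\<W> = {U \<inter> V | U V. U \<in> \<U> \<and> V \<in> \<V>}"
  have "\<forall>W\<in>\<W>. \<exists>U\<in>\<U>. W \<subseteq> U" "\<forall>W\<in>\<W>. \<exists>V\<in>\<V>. W \<subseteq> V"
    by (auto simp: \<W>_def)
  \<comment> \<open>A cover is indexed by its own members, and one set may be an intersection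
    \<open>U \<inter> V\<close> in several ways; so the refinement maps have to be chosen.\<close>
  then obtain \<sigma> \<tau> where "\<forall>W\<in>\<W>. \<sigma> W \<in> \<U> \<and> W \<subseteq> \<sigma> W" "\<forall>W\<in>\<W>. \<tau> W \<in> \<V> \<and> W \<subseteq> \<tau> W"
    by metis
  then have "\<sigma> \<in> refinement_maps \<W> \<U>" "\<tau> \<in> refinement_maps \<W> \<V>"
    by (auto simp: refinement_maps_def)
  moreover have "\<Union>\<W> = \<Union>\<U> \<inter> \<Union>\<V>" unfolding \<W>_def by blast
  then have "\<W> \<in> open_covers M"
    using assms by (auto simp: open_covers_def \<W>_def)
  ultimately show thesis using that by blast
qed

lemma refinement_maps_comp:
  "\<lbrakk>\<tau> \<in> refinement_maps \<V> \<U>; \<rho> \<in> refinement_maps \<W> \<V>\<rbrakk> \<Longrightarrow> \<tau> \<circ> \<rho> \<in> refinement_maps \<W> \<U>"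
  by (fastforce simp: refinement_maps_def)

section \<open>Cech cochains with values in a sheaf of abelian groups\<close>

locale abelian_sheaf = set_sheaf M F
  for M :: "'a topology" and F :: "('a, 's, ('s, 'z) ring_scheme) sheaf_data" +
  assumes sect_abelian_group: "openin M U \<Longrightarrow> abelian_group (sect F U)"
    and res_add: "\<lbrakk>openin M U; V \<in> opens M U\<rbrakk> \<Longrightarrow> additive_map (sect F U) (sect F V) (res F U V)"
begin

text \<open>An additive map between abelian groups preserves zero and negatives; casting restriction
  as a \<open>group_hom\<close> imports these facts.\<close>

lemma res_hom:
  assumes "openin M U" "openin M V" "V \<subseteq> U"
  shows "group_hom (add_monoid (sect F U)) (add_monoid (sect F V)) (res F U V)"
  using assms res_closed res_add sect_abelian_group
  by (auto intro!: group_hom.intro group_hom_axioms.intro abelian_group.a_group homI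
      simp: additive_map_def)

lemma res_zero:
  assumes "openin M U" "openin M V" "V \<subseteq> U"
  shows "res F U V \<zero>\<^bsub>sect F U\<^esub> = \<zero>\<^bsub>sect F V\<^esub>"
  using group_hom.hom_one[OF res_hom[OF assms]] by simp

lemma res_a_inv:
  assumes "openin M U" "openin M V" "V \<subseteq> U" "s \<in> carrier (sect F U)"
  shows "res F U V (\<ominus>\<^bsub>sect F U\<^esub> s) = \<ominus>\<^bsub>sect F V\<^esub> res F U V s"
  using group_hom.hom_inv[OF res_hom[OF assms(1-3)]] assms(4) by (simp add: a_inv_def)

lemma res_minus:
  assumes "openin M U" "openin M V" "V \<subseteq> U" "s \<in> carrier (sect F U)" "t \<in> carrier (sect F U)"
  shows "res F U V (s \<ominus>\<^bsub>sect F U\<^esub> t) = res F U V s \<ominus>\<^bsub>sect F V\<^esub> res F U V t"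
  using assms res_add[of U V] abelian_group.a_inv_closed[OF sect_abelian_group]
  by (simp add: a_minus_def additive_map_def res_a_inv)

lemma cocycle_closed:
  "\<lbrakk>c \<in> cech_cocycles F \<U>; U \<in> \<U>; V \<in> \<U>\<rbrakk> \<Longrightarrow> c U V \<in> carrier (sect F (U \<inter> V))"
  by (simp add: cech_cocycles_def)

text \<open>The cocycle condition holds on the triple intersection and is restricted further to
  \<open>N\<close>. The homotopy between two refinement maps needs this, because it compares members
  of the coarse cover on a smaller intersection of members of the fine one.\<close>

lemma cocycle_add:
  assumes "\<U> \<in> open_covers M" "c \<in> cech_cocycles F \<U>" "U \<in> \<U>" "V \<in> \<U>" "W \<in> \<U>"
    and "openin M N" "N \<subseteq> U \<inter> V \<inter> W"
  shows "res F (U \<inter> W) N (c U W)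
    = res F (U \<inter> V) N (c U V) \<oplus>\<^bsub>sect F N\<^esub> res F (V \<inter> W) N (c V W)"
proof -
  have op: "openin M U" "openin M V" "openin M W"
    using assms by (auto simp: open_covers_def)
  then have op': "openin M (U \<inter> W)" "openin M (U \<inter> V)" "openin M (V \<inter> W)"
    "openin M (U \<inter> V \<inter> W)" by auto
  interpret A: abelian_group "sect F (U \<inter> V \<inter> W)" using op' by (rule_tac sect_abelian_group)
  let ?r = "\<lambda>P. res F P (U \<inter> V \<inter> W)"
  have cl: "c U V \<in> carrier (sect F (U \<inter> V))" "c U W \<in> carrier (sect F (U \<inter> W))"
    "c V W \<in> carrier (sect F (V \<inter> W))"
    using assms by (auto intro: cocycle_closed)
  then have cl': "?r (U \<inter> V) (c U V) \<in> carrier (sect F (U \<inter> V \<inter> W))"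
    "?r (U \<inter> W) (c U W) \<in> carrier (sect F (U \<inter> V \<inter> W))"
    "?r (V \<inter> W) (c V W) \<in> carrier (sect F (U \<inter> V \<inter> W))"
    using op' by (auto intro!: res_closed)
  have "?r (U \<inter> W) (c U W) = ?r (U \<inter> V) (c U V) \<oplus>\<^bsub>sect F (U \<inter> V \<inter> W)\<^esub> ?r (V \<inter> W) (c V W)"
    using assms cl' by (intro A.eq_add_of_cocycle) (auto simp: cech_cocycles_def)
  then have "res F (U \<inter> V \<inter> W) N (?r (U \<inter> W) (c U W))
    = res F (U \<inter> V \<inter> W) N (?r (U \<inter> V) (c U V)) \<oplus>\<^bsub>sect F N\<^esub>
      res F (U \<inter> V \<inter> W) N (?r (V \<inter> W) (c V W))"
    using res_add[of "U \<inter> V \<inter> W" N] op' assms cl' by (simp add: additive_map_def)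
  moreover have "res F (U \<inter> V \<inter> W) N (?r P x) = res F P N x"
    if "openin M P" "U \<inter> V \<inter> W \<subseteq> P" "x \<in> carrier (sect F P)" for P x
    using res_comp[of P "U \<inter> V \<inter> W" N x] that op' assms by simp
  ultimately show ?thesis using cl op'
    by (simp add: le_infI1 le_infI2)
qed

text \<open>The equivalence laws are stated for cochains with values in the sheaf. Hence
  \<open>pull_back_closed\<close> is all that is required to apply them to pulled back
  cocycles.\<close>

lemma cohomologous_refl:
  assumes "\<U> \<in> open_covers M" "\<And>U V. \<lbrakk>U \<in> \<U>; V \<in> \<U>\<rbrakk> \<Longrightarrow> c U V \<in> carrier (sect F (U \<inter> V))"
  shows "cohomologous F \<U> c c"
  unfolding cohomologous_def
proof (rule exI[of _ "\<lambda>U. \<zero>\<^bsub>sect F U\<^esub>"], intro conjI ballI)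
  fix U V assume UV: "U \<in> \<U>" "V \<in> \<U>"
  then have op: "openin M U" "openin M V" "openin M (U \<inter> V)"
    using assms by (auto simp: open_covers_def)
  interpret A: abelian_group "sect F (U \<inter> V)" using op by (rule_tac sect_abelian_group)
  show "c U V \<ominus>\<^bsub>sect F (U \<inter> V)\<^esub> c U V = res F V (U \<inter> V) \<zero>\<^bsub>sect F V\<^esub> \<ominus>\<^bsub>sect F (U \<inter> V)\<^esub>
    res F U (U \<inter> V) \<zero>\<^bsub>sect F U\<^esub>"
    using assms(2)[OF UV] op by (simp add: res_zero A.minus_eq A.r_neg)
qed (use assms sect_abelian_group in \<open>auto simp: open_covers_def intro: abelian_groupE\<close>)

lemma cohomologous_sym:
  assumes "\<U> \<in> open_covers M" "\<And>U V. \<lbrakk>U \<in> \<U>; V \<in> \<U>\<rbrakk> \<Longrightarrow> c U V \<in> carrier (sect F (U \<inter> V))"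
    and "\<And>U V. \<lbrakk>U \<in> \<U>; V \<in> \<U>\<rbrakk> \<Longrightarrow> d U V \<in> carrier (sect F (U \<inter> V))"
    and "cohomologous F \<U> c d"
  shows "cohomologous F \<U> d c"
proof -
  obtain b where b: "\<And>U. U \<in> \<U> \<Longrightarrow> b U \<in> carrier (sect F U)"
    and eq: "\<And>U V. \<lbrakk>U \<in> \<U>; V \<in> \<U>\<rbrakk> \<Longrightarrow> c U V \<ominus>\<^bsub>sect F (U \<inter> V)\<^esub> d U V
      = res F V (U \<inter> V) (b V) \<ominus>\<^bsub>sect F (U \<inter> V)\<^esub> res F U (U \<inter> V) (b U)"
    using assms(4) unfolding cohomologous_def by blast
  show ?thesis
    unfolding cohomologous_def
  proof (rule exI[of _ "\<lambda>U. \<ominus>\<^bsub>sect F U\<^esub> b U"], intro conjI ballI)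
    fix U V assume UV: "U \<in> \<U>" "V \<in> \<U>"
    then have op: "openin M U" "openin M V" "openin M (U \<inter> V)"
      using assms by (auto simp: open_covers_def)
    interpret A: abelian_group "sect F (U \<inter> V)" using op by (rule_tac sect_abelian_group)
    have cl: "res F U (U \<inter> V) (b U) \<in> carrier (sect F (U \<inter> V))"
      "res F V (U \<inter> V) (b V) \<in> carrier (sect F (U \<inter> V))"
      using b UV op by (auto intro!: res_closed)
    have "d U V \<ominus>\<^bsub>sect F (U \<inter> V)\<^esub> c U V
      = \<ominus>\<^bsub>sect F (U \<inter> V)\<^esub> (c U V \<ominus>\<^bsub>sect F (U \<inter> V)\<^esub> d U V)"
      using assms(2,3)[OF UV] by (simp add: A.minus_diff)
    then show "d U V \<ominus>\<^bsub>sect F (U \<inter> V)\<^esub> c U V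
      = res F V (U \<inter> V) (\<ominus>\<^bsub>sect F V\<^esub> b V) \<ominus>\<^bsub>sect F (U \<inter> V)\<^esub>
        res F U (U \<inter> V) (\<ominus>\<^bsub>sect F U\<^esub> b U)"
      using cl op b UV by (simp add: eq res_a_inv A.minus_diff) (simp add: A.minus_eq A.a_comm)
  qed (use assms b sect_abelian_group in \<open>auto simp: open_covers_def intro: abelian_group.a_inv_closed\<close>)
qed

lemma cohomologous_trans:
  assumes "\<U> \<in> open_covers M" "\<And>U V. \<lbrakk>U \<in> \<U>; V \<in> \<U>\<rbrakk> \<Longrightarrow> c U V \<in> carrier (sect F (U \<inter> V))"
    and "\<And>U V. \<lbrakk>U \<in> \<U>; V \<in> \<U>\<rbrakk> \<Longrightarrow> d U V \<in> carrier (sect F (U \<inter> V))"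
    and "\<And>U V. \<lbrakk>U \<in> \<U>; V \<in> \<U>\<rbrakk> \<Longrightarrow> e U V \<in> carrier (sect F (U \<inter> V))"
    and "cohomologous F \<U> c d" "cohomologous F \<U> d e"
  shows "cohomologous F \<U> c e"
proof -
  obtain b where b: "\<And>U. U \<in> \<U> \<Longrightarrow> b U \<in> carrier (sect F U)"
    and eq: "\<And>U V. \<lbrakk>U \<in> \<U>; V \<in> \<U>\<rbrakk> \<Longrightarrow> c U V \<ominus>\<^bsub>sect F (U \<inter> V)\<^esub> d U V
      = res F V (U \<inter> V) (b V) \<ominus>\<^bsub>sect F (U \<inter> V)\<^esub> res F U (U \<inter> V) (b U)"
    using assms(5) unfolding cohomologous_def by blast
  obtain b' where b': "\<And>U. U \<in> \<U> \<Longrightarrow> b' U \<in> carrier (sect F U)"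
    and eq': "\<And>U V. \<lbrakk>U \<in> \<U>; V \<in> \<U>\<rbrakk> \<Longrightarrow> d U V \<ominus>\<^bsub>sect F (U \<inter> V)\<^esub> e U V
      = res F V (U \<inter> V) (b' V) \<ominus>\<^bsub>sect F (U \<inter> V)\<^esub> res F U (U \<inter> V) (b' U)"
    using assms(6) unfolding cohomologous_def by blast
  show ?thesis
    unfolding cohomologous_def
  proof (rule exI[of _ "\<lambda>U. b U \<oplus>\<^bsub>sect F U\<^esub> b' U"], intro conjI ballI)
    fix U V assume UV: "U \<in> \<U>" "V \<in> \<U>"
    then have op: "openin M U" "openin M V" "openin M (U \<inter> V)"
      using assms by (auto simp: open_covers_def)
    interpret A: abelian_group "sect F (U \<inter> V)" using op by (rule_tac sect_abelian_group)
    have cl: "res F U (U \<inter> V) (b U) \<in> carrier (sect F (U \<inter> V))"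
      "res F V (U \<inter> V) (b V) \<in> carrier (sect F (U \<inter> V))"
      "res F U (U \<inter> V) (b' U) \<in> carrier (sect F (U \<inter> V))"
      "res F V (U \<inter> V) (b' V) \<in> carrier (sect F (U \<inter> V))"
      using b b' UV op by (auto intro!: res_closed)
    have "c U V \<ominus>\<^bsub>sect F (U \<inter> V)\<^esub> e U V
      = (c U V \<ominus>\<^bsub>sect F (U \<inter> V)\<^esub> d U V) \<oplus>\<^bsub>sect F (U \<inter> V)\<^esub> (d U V \<ominus>\<^bsub>sect F (U \<inter> V)\<^esub> e U V)"
      using assms(2-4)[OF UV] by (simp add: A.diff_add_diff)
    then show "c U V \<ominus>\<^bsub>sect F (U \<inter> V)\<^esub> e U V
      = res F V (U \<inter> V) (b V \<oplus>\<^bsub>sect F V\<^esub> b' V) \<ominus>\<^bsub>sect F (U \<inter> V)\<^esub>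
        res F U (U \<inter> V) (b U \<oplus>\<^bsub>sect F U\<^esub> b' U)"
      using cl op b b' UV res_add[of U "U \<inter> V"] res_add[of V "U \<inter> V"]
      by (simp add: eq eq' additive_map_def) (simp add: A.minus_eq A.minus_add A.a_ac)
  qed (use assms b b' sect_abelian_group in \<open>auto simp: open_covers_def intro: abelian_groupE\<close>)
qed

lemma pull_back_closed:
  assumes "\<U> \<in> open_covers M" "\<W> \<in> open_covers M" "\<tau> \<in> refinement_maps \<W> \<U>"
    and "\<And>U V. \<lbrakk>U \<in> \<U>; V \<in> \<U>\<rbrakk> \<Longrightarrow> c U V \<in> carrier (sect F (U \<inter> V))"
    and "U \<in> \<W>" "V \<in> \<W>"
  shows "pull_back F \<tau> c U V \<in> carrier (sect F (U \<inter> V))"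
proof -
  have "\<tau> U \<in> \<U>" "\<tau> V \<in> \<U>" "U \<subseteq> \<tau> U" "V \<subseteq> \<tau> V"
    using assms by (auto simp: refinement_maps_def)
  moreover from this have "openin M (\<tau> U \<inter> \<tau> V)" "openin M (U \<inter> V)"
    using assms by (auto simp: open_covers_def)
  ultimately show ?thesis
    using assms(4) unfolding pull_back_def by (intro res_closed) auto
qed

lemma pull_back_comp:
  assumes "\<U> \<in> open_covers M" "\<V> \<in> open_covers M" "\<W> \<in> open_covers M"
    and "\<tau> \<in> refinement_maps \<V> \<U>" "\<rho> \<in> refinement_maps \<W> \<V>"
    and "\<And>U V. \<lbrakk>U \<in> \<U>; V \<in> \<U>\<rbrakk> \<Longrightarrow> c U V \<in> carrier (sect F (U \<inter> V))"
    and "U \<in> \<W>" "V \<in> \<W>"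
  shows "pull_back F \<rho> (pull_back F \<tau> c) U V = pull_back F (\<tau> \<circ> \<rho>) c U V"
proof -
  have r: "\<rho> U \<in> \<V>" "\<rho> V \<in> \<V>" "U \<subseteq> \<rho> U" "V \<subseteq> \<rho> V"
    using assms by (auto simp: refinement_maps_def)
  then have t: "\<tau> (\<rho> U) \<in> \<U>" "\<tau> (\<rho> V) \<in> \<U>" "\<rho> U \<subseteq> \<tau> (\<rho> U)" "\<rho> V \<subseteq> \<tau> (\<rho> V)"
    using assms by (auto simp: refinement_maps_def)
  have "openin M (\<tau> (\<rho> U) \<inter> \<tau> (\<rho> V))" "openin M (\<rho> U \<inter> \<rho> V)" "openin M (U \<inter> V)"
    using assms r t by (auto simp: open_covers_def)
  then show ?thesis
    using r t assms(6) unfolding pull_back_def by (subst res_comp) auto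
qed

text \<open>Restriction is additive, so the cochain \<open>b\<close> whose coboundary is the
  difference can be pulled back along the same map.\<close>

lemma cohomologous_pull_back:
  assumes "\<U> \<in> open_covers M" "\<W> \<in> open_covers M" "\<tau> \<in> refinement_maps \<W> \<U>"
    and c: "\<And>U V. \<lbrakk>U \<in> \<U>; V \<in> \<U>\<rbrakk> \<Longrightarrow> c U V \<in> carrier (sect F (U \<inter> V))"
    and d: "\<And>U V. \<lbrakk>U \<in> \<U>; V \<in> \<U>\<rbrakk> \<Longrightarrow> d U V \<in> carrier (sect F (U \<inter> V))"
    and "cohomologous F \<U> c d"
  shows "cohomologous F \<W> (pull_back F \<tau> c) (pull_back F \<tau> d)"
proof -
  obtain b where b: "\<And>U. U \<in> \<U> \<Longrightarrow> b U \<in> carrier (sect F U)"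
    and eq: "\<And>U V. \<lbrakk>U \<in> \<U>; V \<in> \<U>\<rbrakk> \<Longrightarrow> c U V \<ominus>\<^bsub>sect F (U \<inter> V)\<^esub> d U V
      = res F V (U \<inter> V) (b V) \<ominus>\<^bsub>sect F (U \<inter> V)\<^esub> res F U (U \<inter> V) (b U)"
    using assms(6) unfolding cohomologous_def by blast
  have tau: "\<tau> U \<in> \<U>" "U \<subseteq> \<tau> U" "openin M U" "openin M (\<tau> U)" if "U \<in> \<W>" for U
    using assms that by (auto simp: open_covers_def refinement_maps_def)
  show ?thesis
    unfolding cohomologous_def
  proof (rule exI[of _ "\<lambda>U. res F (\<tau> U) U (b (\<tau> U))"], intro conjI ballI)
    fix U V assume UV: "U \<in> \<W>" "V \<in> \<W>"
    note tU = tau[OF UV(1)] and tV = tau[OF UV(2)]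
    have op: "openin M (U \<inter> V)" "openin M (\<tau> U \<inter> \<tau> V)" "U \<inter> V \<subseteq> \<tau> U \<inter> \<tau> V"
      using tU tV by auto
    have cl: "res F (\<tau> U) (\<tau> U \<inter> \<tau> V) (b (\<tau> U)) \<in> carrier (sect F (\<tau> U \<inter> \<tau> V))"
      "res F (\<tau> V) (\<tau> U \<inter> \<tau> V) (b (\<tau> V)) \<in> carrier (sect F (\<tau> U \<inter> \<tau> V))"
      using b tU tV op by (auto intro!: res_closed)
    have "pull_back F \<tau> c U V \<ominus>\<^bsub>sect F (U \<inter> V)\<^esub> pull_back F \<tau> d U V
      = res F (\<tau> U \<inter> \<tau> V) (U \<inter> V) (c (\<tau> U) (\<tau> V) \<ominus>\<^bsub>sect F (\<tau> U \<inter> \<tau> V)\<^esub> d (\<tau> U) (\<tau> V))"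
      using op c d tU tV by (simp add: pull_back_def res_minus)
    also have "\<dots> = res F V (U \<inter> V) (res F (\<tau> V) V (b (\<tau> V))) \<ominus>\<^bsub>sect F (U \<inter> V)\<^esub>
      res F U (U \<inter> V) (res F (\<tau> U) U (b (\<tau> U)))"
      using op tU tV b cl by (simp add: eq res_minus res_comp)
    finally show "pull_back F \<tau> c U V \<ominus>\<^bsub>sect F (U \<inter> V)\<^esub> pull_back F \<tau> d U V = \<dots>" .
  qed (use tau b in \<open>auto intro!: res_closed\<close>)
qed

text \<open>The homotopy between two refinement maps is \<open>b W = c (\<tau> W) (\<sigma> W)\<close>, restricted to \<open>W\<close>.\<close>

lemma pull_back_homotopy:
  assumes "\<U> \<in> open_covers M" "\<W> \<in> open_covers M"
    and "\<sigma> \<in> refinement_maps \<W> \<U>" "\<tau> \<in> refinement_maps \<W> \<U>" "c \<in> cech_cocycles F \<U>"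
  shows "cohomologous F \<W> (pull_back F \<sigma> c) (pull_back F \<tau> c)"
proof -
  have tau: "\<tau> U \<in> \<U>" "U \<subseteq> \<tau> U" "openin M (\<tau> U)" "\<sigma> U \<in> \<U>" "U \<subseteq> \<sigma> U" "openin M (\<sigma> U)"
    "openin M U" if "U \<in> \<W>" for U
    using assms that by (auto simp: open_covers_def refinement_maps_def)
  show ?thesis
    unfolding cohomologous_def
  proof (rule exI[of _ "\<lambda>W. res F (\<tau> W \<inter> \<sigma> W) W (c (\<tau> W) (\<sigma> W))"], intro conjI ballI)
    fix V W assume VW: "V \<in> \<W>" "W \<in> \<W>"
    note tV = tau[OF VW(1)] and tW = tau[OF VW(2)]
    let ?N = "V \<inter> W"
    have op: "openin M ?N" using tV tW by auto
    interpret A: abelian_group "sect F ?N" using op by (rule sect_abelian_group)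
    define r where "r X Y = res F (X \<inter> Y) ?N (c X Y)" for X Y
    have cl: "r X Y \<in> carrier (sect F ?N)" if "X \<in> \<U>" "Y \<in> \<U>" "?N \<subseteq> X \<inter> Y" for X Y
    proof -
      have "openin M (X \<inter> Y)" using assms that by (auto simp: open_covers_def)
      then show ?thesis unfolding r_def
        using that op assms(5) by (intro res_closed) (auto intro: cocycle_closed)
    qed
    have add: "r X Z = r X Y \<oplus>\<^bsub>sect F ?N\<^esub> r Y Z"
      if "X \<in> \<U>" "Y \<in> \<U>" "Z \<in> \<U>" "?N \<subseteq> X \<inter> Y \<inter> Z" for X Y Z
      unfolding r_def using that assms op by (intro cocycle_add) auto
    have "?N \<subseteq> \<tau> V" "?N \<subseteq> \<tau> W" "?N \<subseteq> \<sigma> V" "?N \<subseteq> \<sigma> W" using tV tW by auto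
    note sub = this tV tW
    \<comment> \<open>Both sides equal \<open>r (\<tau> V) (\<sigma> W)\<close>: the left one by
      inserting \<open>\<sigma> V\<close> as middle index, the right one by inserting
      \<open>\<tau> W\<close>.\<close>
    have "r (\<tau> V) (\<sigma> V) \<oplus>\<^bsub>sect F ?N\<^esub> r (\<sigma> V) (\<sigma> W)
      = r (\<tau> V) (\<tau> W) \<oplus>\<^bsub>sect F ?N\<^esub> r (\<tau> W) (\<sigma> W)"
      using sub by (simp flip: add)
    then have "r (\<sigma> V) (\<sigma> W) \<ominus>\<^bsub>sect F ?N\<^esub> r (\<tau> V) (\<tau> W)
      = r (\<tau> W) (\<sigma> W) \<ominus>\<^bsub>sect F ?N\<^esub> r (\<tau> V) (\<sigma> V)"
      by (intro A.diff_eq_of_add_eq) (use sub cl in auto)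
    moreover have "res F V ?N (res F (\<tau> V \<inter> \<sigma> V) V (c (\<tau> V) (\<sigma> V))) = r (\<tau> V) (\<sigma> V)"
      "res F W ?N (res F (\<tau> W \<inter> \<sigma> W) W (c (\<tau> W) (\<sigma> W))) = r (\<tau> W) (\<sigma> W)"
      unfolding r_def using tV tW op assms(5)
      by (auto intro!: res_comp cocycle_closed)
    ultimately show "pull_back F \<sigma> c V W \<ominus>\<^bsub>sect F ?N\<^esub> pull_back F \<tau> c V W
      = res F W ?N (res F (\<tau> W \<inter> \<sigma> W) W (c (\<tau> W) (\<sigma> W))) \<ominus>\<^bsub>sect F ?N\<^esub>
        res F V ?N (res F (\<tau> V \<inter> \<sigma> V) V (c (\<tau> V) (\<sigma> V)))"
      by (simp add: pull_back_def r_def)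
  next
    fix W assume "W \<in> \<W>"
    note t = tau[OF this]
    show "res F (\<tau> W \<inter> \<sigma> W) W (c (\<tau> W) (\<sigma> W)) \<in> carrier (sect F W)"
      using t assms(5) by (intro res_closed) (auto intro: cocycle_closed)
  qed
qed

text \<open>Iterated pull backs and pull backs along a composite are compared at members of the
  cover, where values matter; so cochains are exchanged by agreement there instead of equality of
  functions.\<close>

lemma cohomologous_cong:
  assumes "cohomologous F \<U> c d" "\<And>U V. \<lbrakk>U \<in> \<U>; V \<in> \<U>\<rbrakk> \<Longrightarrow> c U V = c' U V"
    "\<And>U V. \<lbrakk>U \<in> \<U>; V \<in> \<U>\<rbrakk> \<Longrightarrow> d U V = d' U V"
  shows "cohomologous F \<U> c' d'"
  using assms by (fastforce simp: cohomologous_def)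

text \<open>The two comparisons pull \<open>d\<close> back along \<open>\<tau>1\<close> and along
  \<open>\<sigma>2\<close>. On a common refinement of \<open>\<W>1\<close> and \<open>\<W>2\<close>
  these become two refinement maps into the same cover \<open>\<V>\<close>, and
  \<open>pull_back_homotopy\<close> bridges them; this is where \<open>d\<close> has to be a
  cocycle.\<close>

lemma cech_rel_trans:
  assumes "((\<U>, c), (\<V>, d)) \<in> cech_rel M F" "((\<V>, d), (\<X>, e)) \<in> cech_rel M F"
  shows "((\<U>, c), (\<X>, e)) \<in> cech_rel M F"
proof -
  obtain \<W>1 \<sigma>1 \<tau>1 where 1: "\<W>1 \<in> open_covers M" "\<sigma>1 \<in> refinement_maps \<W>1 \<U>"
    "\<tau>1 \<in> refinement_maps \<W>1 \<V>" "cohomologous F \<W>1 (pull_back F \<sigma>1 c) (pull_back F \<tau>1 d)"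
    using assms(1) by (auto simp: cech_rel_def)
  obtain \<W>2 \<sigma>2 \<tau>2 where 2: "\<W>2 \<in> open_covers M" "\<sigma>2 \<in> refinement_maps \<W>2 \<V>"
    "\<tau>2 \<in> refinement_maps \<W>2 \<X>" "cohomologous F \<W>2 (pull_back F \<sigma>2 d) (pull_back F \<tau>2 e)"
    using assms(2) by (auto simp: cech_rel_def)
  have cov: "\<U> \<in> open_covers M" "\<V> \<in> open_covers M" "\<X> \<in> open_covers M"
    and coc: "c \<in> cech_cocycles F \<U>" "d \<in> cech_cocycles F \<V>" "e \<in> cech_cocycles F \<X>"
    using assms by (auto simp: cech_rel_def cech_pairs_def)
  obtain \<W> \<rho>1 \<rho>2 where W: "\<W> \<in> open_covers M" "\<rho>1 \<in> refinement_maps \<W> \<W>1"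
    "\<rho>2 \<in> refinement_maps \<W> \<W>2"
    using common_refinement[OF 1(1) 2(1)] by blast
  note cl = cocycle_closed[OF coc(1)] cocycle_closed[OF coc(2)] cocycle_closed[OF coc(3)]
  note r = refinement_maps_comp[OF 1(2) W(2)] refinement_maps_comp[OF 1(3) W(2)]
    refinement_maps_comp[OF 2(2) W(3)] refinement_maps_comp[OF 2(3) W(3)]
  note p = pull_back_closed[OF cov(1) W(1) r(1) cl(1)] pull_back_closed[OF cov(2) W(1) r(2) cl(2)]
    pull_back_closed[OF cov(2) W(1) r(3) cl(2)] pull_back_closed[OF cov(3) W(1) r(4) cl(3)]
  have a: "cohomologous F \<W> (pull_back F (\<sigma>1 \<circ> \<rho>1) c) (pull_back F (\<tau>1 \<circ> \<rho>1) d)"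
    by (rule cohomologous_cong[OF cohomologous_pull_back[OF 1(1) W(1,2)
            pull_back_closed[OF cov(1) 1(1,2) cl(1)] pull_back_closed[OF cov(2) 1(1,3) cl(2)] 1(4)]
          pull_back_comp[OF cov(1) 1(1) W(1) 1(2) W(2) cl(1)]
          pull_back_comp[OF cov(2) 1(1) W(1) 1(3) W(2) cl(2)]])
  have b: "cohomologous F \<W> (pull_back F (\<tau>1 \<circ> \<rho>1) d) (pull_back F (\<sigma>2 \<circ> \<rho>2) d)"
    by (rule pull_back_homotopy[OF cov(2) W(1) r(2,3) coc(2)])
  have c: "cohomologous F \<W> (pull_back F (\<sigma>2 \<circ> \<rho>2) d) (pull_back F (\<tau>2 \<circ> \<rho>2) e)"
    by (rule cohomologous_cong[OF cohomologous_pull_back[OF 2(1) W(1,3)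
            pull_back_closed[OF cov(2) 2(1,2) cl(2)] pull_back_closed[OF cov(3) 2(1,3) cl(3)] 2(4)]
          pull_back_comp[OF cov(2) 2(1) W(1) 2(2) W(3) cl(2)]
          pull_back_comp[OF cov(3) 2(1) W(1) 2(3) W(3) cl(3)]])
  have "cohomologous F \<W> (pull_back F (\<sigma>1 \<circ> \<rho>1) c) (pull_back F (\<tau>2 \<circ> \<rho>2) e)"
    by (rule cohomologous_trans[OF W(1) p(1,2,4) a
          cohomologous_trans[OF W(1) p(2,3,4) b c]])
  then show ?thesis
    using assms W(1) r(1,4) unfolding cech_rel_def by blast
qed

lemma equiv_cech_rel: "equiv (cech_pairs M F) (cech_rel M F)"
proof (rule equivI)
  show "cech_rel M F \<subseteq> cech_pairs M F \<times> cech_pairs M F"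
    by (auto simp: cech_rel_def)
  show "refl_on (cech_pairs M F) (cech_rel M F)"
  proof (rule refl_onI)
    fix x assume x: "x \<in> cech_pairs M F"
    obtain \<U> c where xe: "x = (\<U>, c)" by force
    have u: "\<U> \<in> open_covers M" "c \<in> cech_cocycles F \<U>"
      using x xe by (auto simp: cech_pairs_def)
    have i: "id \<in> refinement_maps \<U> \<U>" by (auto simp: refinement_maps_def)
    have "cohomologous F \<U> (pull_back F id c) (pull_back F id c)"
      using u i by (intro cohomologous_refl pull_back_closed) (auto intro: cocycle_closed)
    then show "(x, x) \<in> cech_rel M F"
      unfolding cech_rel_def xe using x xe u(1) i by blast
  qed
  show "sym (cech_rel M F)"
  proof (rule symI)
    fix x y assume "(x, y) \<in> cech_rel M F"
    moreover obtain \<U> c \<V> d where xy: "x = (\<U>, c)" "y = (\<V>, d)" by force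
    ultimately obtain \<W> \<sigma> \<tau> where *: "(\<U>, c) \<in> cech_pairs M F" "(\<V>, d) \<in> cech_pairs M F"
      "\<W> \<in> open_covers M" "\<sigma> \<in> refinement_maps \<W> \<U>" "\<tau> \<in> refinement_maps \<W> \<V>"
      "cohomologous F \<W> (pull_back F \<sigma> c) (pull_back F \<tau> d)"
      by (auto simp: cech_rel_def)
    then have cov: "\<U> \<in> open_covers M" "\<V> \<in> open_covers M"
      and coc: "c \<in> cech_cocycles F \<U>" "d \<in> cech_cocycles F \<V>"
      by (auto simp: cech_pairs_def)
    have "cohomologous F \<W> (pull_back F \<tau> d) (pull_back F \<sigma> c)"
      by (rule cohomologous_sym[OF *(3) pull_back_closed[OF cov(1) *(3,4) cocycle_closed[OF coc(1)]]
            pull_back_closed[OF cov(2) *(3,5) cocycle_closed[OF coc(2)]] *(6)])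
    with * show "(y, x) \<in> cech_rel M F"
      unfolding cech_rel_def xy by blast
  qed
  show "trans (cech_rel M F)"
    by (rule transI) (metis cech_rel_trans surj_pair)
qed

lemma cohomology_class_eq_iff:
  assumes "(\<U>, c) \<in> cech_pairs M F" "(\<V>, d) \<in> cech_pairs M F"
  shows "cohomology_class M F \<U> c = cohomology_class M F \<V> d
    \<longleftrightarrow> ((\<U>, c), (\<V>, d)) \<in> cech_rel M F"
  unfolding cohomology_class_def using equiv_cech_rel assms by (rule eq_equiv_class_iff)

lemma zero_cochain: "({topspace M}, \<lambda>U V. \<zero>\<^bsub>sect F (U \<inter> V)\<^esub>) \<in> cech_pairs M F"
proof -
  interpret A: abelian_group "sect F (topspace M)" by (rule sect_abelian_group) simp
  show ?thesis
    by (simp add: cech_pairs_def open_covers_def cech_cocycles_def res_id A.minus_eq)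
qed

end

section \<open>Sheaves of homomorphisms\<close>

text \<open>The locality axiom wants a cover whose union is exactly \<open>V\<close>; intersecting
  the members with \<open>V\<close> yields one. The test sets are all open \<open>W\<close> inside
  \<open>V\<close> and a member, since data given member by member yield the equality in this
  form.\<close>

lemma (in set_sheaf) eq_if_locally_eq:
  assumes "\<And>U. U \<in> \<U> \<Longrightarrow> openin M U" "openin M V" "V \<subseteq> \<Union>\<U>"
    and "s \<in> carrier (sect F V)" "t \<in> carrier (sect F V)"
    and eq: "\<And>U W. \<lbrakk>U \<in> \<U>; openin M W; W \<subseteq> U; W \<subseteq> V\<rbrakk> \<Longrightarrow> res F V W s = res F V W t"
  shows "s = t"
proof -
  define \<W> where "\<W> = (\<lambda>U. V \<inter> U) ` \<U>"
  have V: "\<Union>\<W> = V" using assms(3) by (auto simp: \<W>_def)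
  have W: "openin M W \<and> res F V W s = res F V W t" if "W \<in> \<W>" for W
    using that assms(1,2) by (auto simp: \<W>_def intro!: eq)
  show ?thesis
    by (rule locality[of \<W>]) (use V W assms(4,5) in auto)
qed

lemma sheaf_homs_closed:
  "\<lbrakk>\<phi> \<in> sheaf_homs M U F G; openin M V; V \<subseteq> U; s \<in> carrier (sect F V)\<rbrakk>
    \<Longrightarrow> \<phi> V s \<in> carrier (sect G V)"
  unfolding sheaf_homs_def by (auto dest!: PiE_mem)

lemma sheaf_homs_res:
  "\<lbrakk>\<phi> \<in> sheaf_homs M U F G; openin M V; V \<subseteq> U; openin M W; W \<subseteq> V; s \<in> carrier (sect F V)\<rbrakk>
    \<Longrightarrow> res G V W (\<phi> V s) = \<phi> W (res F V W s)"
  unfolding sheaf_homs_def by simp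

lemma sheaf_homs_extensional: "\<phi> \<in> sheaf_homs M U F G \<Longrightarrow> \<phi> \<in> extensional (opens M U)"
  unfolding sheaf_homs_def by (auto simp: PiE_def)

text \<open>Extensionality in both arguments is built into \<open>sheaf_homs\<close>, so agreement
  on sections over open subsets of \<open>U\<close> is equality. Identities between sections of the
  Hom sheaves are reduced in this way to identities in the target sheaf.\<close>

lemma sheaf_homs_eqI:
  assumes "\<phi> \<in> sheaf_homs M U F G" "\<psi> \<in> sheaf_homs M U F G"
    and "\<And>V s. \<lbrakk>openin M V; V \<subseteq> U; s \<in> carrier (sect F V)\<rbrakk> \<Longrightarrow> \<phi> V s = \<psi> V s"
  shows "\<phi> = \<psi>"
proof -
  have "\<phi> V = \<psi> V" if "V \<in> opens M U" for V
  proof (rule PiE_ext)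
    show "\<phi> V \<in> carrier (sect F V) \<rightarrow>\<^sub>E carrier (sect G V)"
      "\<psi> V \<in> carrier (sect F V) \<rightarrow>\<^sub>E carrier (sect G V)"
      using assms(1,2) that by (auto simp: sheaf_homs_def dest: PiE_mem)
  qed (use assms(3) that in auto)
  then show ?thesis
    by (intro extensionalityI[OF sheaf_homs_extensional[OF assms(1)]
          sheaf_homs_extensional[OF assms(2)]])
qed

lemma sheaf_homs_restrict:
  assumes "\<phi> \<in> sheaf_homs M U F G" "V \<subseteq> U"
  shows "restrict \<phi> (opens M V) \<in> sheaf_homs M V F G"
proof -
  have sub: "W \<in> opens M U" if "W \<in> opens M V" for W using that assms(2) by auto
  have "\<phi> \<in> (\<Pi>\<^sub>E W\<in>opens M U. carrier (sect F W) \<rightarrow>\<^sub>E carrier (sect G W))"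
    using assms(1) by (simp add: sheaf_homs_def)
  then have "\<phi> W \<in> carrier (sect F W) \<rightarrow>\<^sub>E carrier (sect G W)" if "W \<in> opens M V" for W
    using sub[OF that] by (rule PiE_mem)
  then have 1: "restrict \<phi> (opens M V) \<in> (\<Pi>\<^sub>E W\<in>opens M V. carrier (sect F W) \<rightarrow>\<^sub>E carrier (sect G W))"
    by (simp add: restrict_PiE_iff)
  have "res G W N (restrict \<phi> (opens M V) W s) = restrict \<phi> (opens M V) N (res F W N s)"
    if "W \<in> opens M V" "N \<in> opens M W" "s \<in> carrier (sect F W)" for W N s
  proof -
    have "N \<in> opens M V" using that by auto
    then show ?thesis
      using that sheaf_homs_res[OF assms(1), of W N s] sub[OF that(1)] by simp
  qed
  with 1 show ?thesis by (simp add: sheaf_homs_def del: mem_opens)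
qed

lemma sheaf_homsI:
  assumes "\<And>V s. \<lbrakk>openin M V; V \<subseteq> U; s \<in> carrier (sect F V)\<rbrakk> \<Longrightarrow> f V s \<in> carrier (sect G V)"
    and "\<And>V W s. \<lbrakk>openin M V; V \<subseteq> U; openin M W; W \<subseteq> V; s \<in> carrier (sect F V)\<rbrakk>
      \<Longrightarrow> res G V W (f V s) = f W (res F V W s)"
    and "set_sheaf M F"
  shows "(\<lambda>V\<in>opens M U. \<lambda>s\<in>carrier (sect F V). f V s) \<in> sheaf_homs M U F G"
proof -
  let ?\<phi> = "\<lambda>V\<in>opens M U. \<lambda>s\<in>carrier (sect F V). f V s"
  have "res G V W (?\<phi> V s) = ?\<phi> W (res F V W s)"
    if "V \<in> opens M U" "W \<in> opens M V" "s \<in> carrier (sect F V)" for V W s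
  proof -
    have "W \<in> opens M U" using that by auto
    moreover have "res F V W s \<in> carrier (sect F W)"
      using that set_sheaf.res_closed[OF assms(3)] by simp
    ultimately show ?thesis using that assms(2)[of V W s] by simp
  qed
  then show ?thesis
    using assms(1) by (auto simp: sheaf_homs_def simp del: restrict_apply)
qed

text \<open>A section over a large \<open>V\<close> is restricted to open sets lying in members of
  the cover, mapped there, and the images are glued in \<open>G\<close>. Since \<open>F\<close> and
  \<open>G\<close> are mere sheaves of sets here, the construction serves for linear homomorphisms
  as well as for connections; their laws are verified afterwards.\<close>

lemma glue_sheaf_homs:
  assumes F: "set_sheaf M F" and G: "set_sheaf M G"
    and op: "\<And>U. U \<in> \<U> \<Longrightarrow> openin M U"
    and \<sigma>: "\<And>U. U \<in> \<U> \<Longrightarrow> \<sigma> U \<in> sheaf_homs M U F G"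
    and compat: "\<And>U V W s. \<lbrakk>U \<in> \<U>; V \<in> \<U>; openin M W; W \<subseteq> U; W \<subseteq> V; s \<in> carrier (sect F W)\<rbrakk>
      \<Longrightarrow> \<sigma> U W s = \<sigma> V W s"
  obtains \<phi> where "\<phi> \<in> sheaf_homs M (\<Union>\<U>) F G"
    "\<And>U W s. \<lbrakk>U \<in> \<U>; openin M W; W \<subseteq> U; s \<in> carrier (sect F W)\<rbrakk> \<Longrightarrow> \<phi> W s = \<sigma> U W s"
proof -
  interpret F: set_sheaf M F by fact
  interpret G: set_sheaf M G by fact
  \<comment> \<open>The common value of all \<open>\<sigma> U\<close> on a small \<open>W\<close>,
    that is, one contained in a member of the cover; by \<open>compat\<close> the chosen member does
    not matter.\<close>
  define \<psi> where "\<psi> W = \<sigma> (SOME U. U \<in> \<U> \<and> W \<subseteq> U) W" for W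
  have \<psi>: "\<psi> W s = \<sigma> U W s" if "U \<in> \<U>" "openin M W" "W \<subseteq> U" "s \<in> carrier (sect F W)" for U W s
  proof -
    have "\<exists>U. U \<in> \<U> \<and> W \<subseteq> U" using that by blast
    from someI_ex[OF this] show ?thesis
      unfolding \<psi>_def using that by (intro compat) auto
  qed
  \<comment> \<open>Describes the value \<open>t\<close> of the glued map at \<open>s\<close> by its
    restrictions to all small open subsets of \<open>V\<close>.\<close>
  define P where "P V s t \<longleftrightarrow> t \<in> carrier (sect G V) \<and>
    (\<forall>U\<in>\<U>. \<forall>W. openin M W \<and> W \<subseteq> U \<and> W \<subseteq> V \<longrightarrow> res G V W t = \<psi> W (res F V W s))" for V s t
  have ex: "\<exists>t. P V s t" if V: "openin M V" "V \<subseteq> \<Union>\<U>" and s: "s \<in> carrier (sect F V)" for V s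
  proof -
    \<comment> \<open>Taking all small subsets of \<open>V\<close>, and not just the sets
      \<open>V \<inter> U\<close>, makes the result of gluing literally the condition in
      \<open>P\<close>.\<close>
    define \<W> where "\<W> = {W. openin M W \<and> W \<subseteq> V \<and> (\<exists>U\<in>\<U>. W \<subseteq> U)}"
    have un: "\<Union>\<W> = V"
    proof
      show "V \<subseteq> \<Union>\<W>"
      proof
        fix x assume "x \<in> V"
        then obtain U where "U \<in> \<U>" "x \<in> U" using V by blast
        then have "V \<inter> U \<in> \<W>" "x \<in> V \<inter> U"
          using V op \<open>x \<in> V\<close> by (auto simp: \<W>_def)
        then show "x \<in> \<Union>\<W>" by blast
      qed
    qed (auto simp: \<W>_def)
    have "\<exists>t\<in>carrier (sect G (\<Union>\<W>)). \<forall>W\<in>\<W>. res G (\<Union>\<W>) W t = \<psi> W (res F V W s)"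
    proof (rule G.gluing)
      fix W assume "W \<in> \<W>"
      then obtain U where W: "openin M W" "W \<subseteq> V" "U \<in> \<U>" "W \<subseteq> U" by (auto simp: \<W>_def)
      then have r: "res F V W s \<in> carrier (sect F W)" using V s by (intro F.res_closed) auto
      then show "\<psi> W (res F V W s) \<in> carrier (sect G W)"
        using W by (simp add: \<psi>[of U] sheaf_homs_closed[OF \<sigma>])
      show "openin M W" by fact
    next
      fix W W' assume "W \<in> \<W>" "W' \<in> \<W>"
      \<comment> \<open>The value on the right does not mention \<open>X\<close>, so the cases
        \<open>X = W\<close> and \<open>X = W'\<close> together give the compatibility required for
        gluing.\<close>
      have *: "res G X (W \<inter> W') (\<psi> X (res F V X s)) = \<psi> (W \<inter> W') (res F V (W \<inter> W') s)"
        if "X = W \<or> X = W'" for X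
      proof -
        have WW: "openin M (W \<inter> W')" using \<open>W \<in> \<W>\<close> \<open>W' \<in> \<W>\<close> by (auto simp: \<W>_def)
        from that obtain U where X: "openin M X" "X \<subseteq> V" "U \<in> \<U>" "X \<subseteq> U" "W \<inter> W' \<subseteq> X"
          using \<open>W \<in> \<W>\<close> \<open>W' \<in> \<W>\<close> by (auto simp: \<W>_def)
        have r: "res F V X s \<in> carrier (sect F X)"
          using V s X by (intro F.res_closed) auto
        have r': "res F V (W \<inter> W') s \<in> carrier (sect F (W \<inter> W'))"
          using WW X V s by (intro F.res_closed) auto
        have "res G X (W \<inter> W') (\<psi> X (res F V X s)) = \<sigma> U (W \<inter> W') (res F X (W \<inter> W') (res F V X s))"
          unfolding \<psi>[OF X(3,1,4) r] by (rule sheaf_homs_res[OF \<sigma>[OF X(3)] X(1,4) WW X(5) r])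
        also have "res F X (W \<inter> W') (res F V X s) = res F V (W \<inter> W') s"
          using V s X WW by (intro F.res_comp) auto
        also have "\<sigma> U (W \<inter> W') (res F V (W \<inter> W') s) = \<psi> (W \<inter> W') (res F V (W \<inter> W') s)"
          using \<psi>[OF X(3) WW _ r'] X by auto
        finally show ?thesis .
      qed
      show "res G W (W \<inter> W') (\<psi> W (res F V W s)) = res G W' (W \<inter> W') (\<psi> W' (res F V W' s))"
        by (simp add: *)
    qed
    then obtain t where "t \<in> carrier (sect G V)" "\<forall>W\<in>\<W>. res G V W t = \<psi> W (res F V W s)"
      unfolding un by blast
    then have "P V s t" unfolding P_def by (auto simp: \<W>_def)
    then show ?thesis by blast
  qed
  \<comment> \<open>By locality in \<open>G\<close>, the property \<open>P V s t\<close> determines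
    \<open>t\<close>. The same argument shows below that \<open>f\<close> commutes with restriction:
    both sides have the same restrictions to small sets.\<close>
  define f where "f V s = (SOME t. P V s t)" for V s
  have P: "P V s (f V s)" if "openin M V" "V \<subseteq> \<Union>\<U>" "s \<in> carrier (sect F V)" for V s
    unfolding f_def using ex[OF that] by (rule someI_ex)
  have f_cl: "f V s \<in> carrier (sect G V)"
    if "openin M V" "V \<subseteq> \<Union>\<U>" "s \<in> carrier (sect F V)" for V s
    using P[OF that] by (simp add: P_def)
  have f_res: "res G V W (f V s) = \<psi> W (res F V W s)"
    if "openin M V" "V \<subseteq> \<Union>\<U>" "s \<in> carrier (sect F V)" "U \<in> \<U>" "openin M W" "W \<subseteq> U" "W \<subseteq> V"
    for V W U s
    using P[OF that(1-3)] that by (auto simp: P_def)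
  show thesis
  proof (rule that)
    show "(\<lambda>V\<in>opens M (\<Union>\<U>). \<lambda>s\<in>carrier (sect F V). f V s) \<in> sheaf_homs M (\<Union>\<U>) F G"
    proof (rule sheaf_homsI[OF f_cl _ F])
      fix V W s assume VW: "openin M V" "V \<subseteq> \<Union>\<U>" "openin M W" "W \<subseteq> V"
        and s: "s \<in> carrier (sect F V)"
      have r: "res F V W s \<in> carrier (sect F W)" using VW s by (intro F.res_closed) auto
      show "res G V W (f V s) = f W (res F V W s)"
      proof (rule G.eq_if_locally_eq[OF op])
        fix U N assume N: "U \<in> \<U>" "openin M N" "N \<subseteq> U" "N \<subseteq> W"
        then have "res G V N (f V s) = \<psi> N (res F V N s)"
          using VW s by (intro f_res) auto
        moreover have "res G W N (f W (res F V W s)) = \<psi> N (res F W N (res F V W s))"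
          using VW N r by (intro f_res) auto
        ultimately show "res G W N (res G V W (f V s)) = res G W N (f W (res F V W s))"
          using G.res_comp[of V W N "f V s"] F.res_comp[of V W N s] VW N s f_cl[OF VW(1,2) s] by simp
      next
        show "res G V W (f V s) \<in> carrier (sect G W)"
          using G.res_closed[of V W "f V s"] VW f_cl[OF VW(1,2) s] by simp
        show "f W (res F V W s) \<in> carrier (sect G W)" "W \<subseteq> \<Union>\<U>" "openin M W"
          using VW r by (auto intro!: f_cl)
      qed
    qed
    fix U W s assume W: "U \<in> \<U>" "openin M W" "W \<subseteq> U" and s: "s \<in> carrier (sect F W)"
    have sub: "W \<subseteq> \<Union>\<U>" using W by blast
    \<comment> \<open>A subset of a member is itself small, so the description of
      \<open>f W s\<close> may be read at \<open>W\<close>, where restriction is the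
      identity.\<close>
    have "f W s = \<psi> W s"
      using f_res[OF W(2) sub s W order_refl] F.res_id[OF W(2) s] G.res_id[OF W(2) f_cl[OF W(2) sub s]]
      by simp
    then have "f W s = \<sigma> U W s" using \<psi>[OF W s] by simp
    then show "(\<lambda>V\<in>opens M (\<Union>\<U>). \<lambda>s\<in>carrier (sect F V). f V s) W s = \<sigma> U W s"
      using W(2) sub s by simp
  qed
qed

section \<open>Sheaves of modules and linear homomorphisms\<close>

locale ring_sheaf = set_sheaf M C
  for M :: "'a topology" and C :: "('a, 'c, ('c, 'x) ring_scheme) sheaf_data" +
  assumes sect_cring: "openin M U \<Longrightarrow> cring (sect C U)"
    and res_ring_hom: "\<lbrakk>openin M U; V \<in> opens M U\<rbrakk> \<Longrightarrow> res C U V \<in> ring_hom (sect C U) (sect C V)"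

locale module_sheaf = C: ring_sheaf M C + F?: abelian_sheaf M F
  for M :: "'a topology" and C :: "('a, 'c, ('c, 'x) ring_scheme) sheaf_data"
    and F :: "('a, 's, ('c, 's, 'y) module_scheme) sheaf_data" +
  assumes sect_module: "openin M U \<Longrightarrow> Module.module (sect C U) (sect F U)"
    and res_smult:
      "\<lbrakk>openin M U; V \<in> opens M U; f \<in> carrier (sect C U); s \<in> carrier (sect F U)\<rbrakk>
        \<Longrightarrow> res F U V (f \<odot>\<^bsub>sect F U\<^esub> s) = res C U V f \<odot>\<^bsub>sect F V\<^esub> res F U V s"

lemma linear_sheaf_homsI:
  assumes "\<phi> \<in> sheaf_homs M U F G"
    and "\<And>V s t. \<lbrakk>openin M V; V \<subseteq> U; s \<in> carrier (sect F V); t \<in> carrier (sect F V)\<rbrakk>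
      \<Longrightarrow> \<phi> V (s \<oplus>\<^bsub>sect F V\<^esub> t) = \<phi> V s \<oplus>\<^bsub>sect G V\<^esub> \<phi> V t"
    and "\<And>V f s. \<lbrakk>openin M V; V \<subseteq> U; f \<in> carrier (sect C V); s \<in> carrier (sect F V)\<rbrakk>
      \<Longrightarrow> \<phi> V (f \<odot>\<^bsub>sect F V\<^esub> s) = f \<odot>\<^bsub>sect G V\<^esub> \<phi> V s"
  shows "\<phi> \<in> linear_sheaf_homs M C U F G"
  using assms by (simp add: linear_sheaf_homs_def linear_map_def additive_map_def)

lemma linear_sheaf_homs_sheaf_homs: "\<phi> \<in> linear_sheaf_homs M C U F G \<Longrightarrow> \<phi> \<in> sheaf_homs M U F G"
  by (simp add: linear_sheaf_homs_def)

lemmas linear_sheaf_homs_closed = sheaf_homs_closed[OF linear_sheaf_homs_sheaf_homs]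
lemmas linear_sheaf_homs_res = sheaf_homs_res[OF linear_sheaf_homs_sheaf_homs]
lemmas linear_sheaf_homs_eqI =
  sheaf_homs_eqI[OF linear_sheaf_homs_sheaf_homs linear_sheaf_homs_sheaf_homs]

lemma linear_sheaf_homs_add:
  "\<lbrakk>\<phi> \<in> linear_sheaf_homs M C U F G; openin M V; V \<subseteq> U; s \<in> carrier (sect F V);
    t \<in> carrier (sect F V)\<rbrakk> \<Longrightarrow> \<phi> V (s \<oplus>\<^bsub>sect F V\<^esub> t) = \<phi> V s \<oplus>\<^bsub>sect G V\<^esub> \<phi> V t"
  by (simp add: linear_sheaf_homs_def linear_map_def additive_map_def)

lemma linear_sheaf_homs_smult:
  "\<lbrakk>\<phi> \<in> linear_sheaf_homs M C U F G; openin M V; V \<subseteq> U; f \<in> carrier (sect C V);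
    s \<in> carrier (sect F V)\<rbrakk> \<Longrightarrow> \<phi> V (f \<odot>\<^bsub>sect F V\<^esub> s) = f \<odot>\<^bsub>sect G V\<^esub> \<phi> V s"
  by (simp add: linear_sheaf_homs_def linear_map_def)

lemma linear_sheaf_homs_restrict:
  assumes "\<phi> \<in> linear_sheaf_homs M C U F G" "V \<subseteq> U"
  shows "restrict \<phi> (opens M V) \<in> linear_sheaf_homs M C V F G"
  using assms sheaf_homs_restrict[of \<phi> M U F G V]
  by (auto simp: linear_sheaf_homs_def)

lemma Hom_sheaf_carrier [simp]:
  "carrier (sect (Hom_sheaf M C F G) U) = linear_sheaf_homs M C U F G"
  by (simp add: Hom_sheaf_def)

lemma Hom_sheaf_res: "res (Hom_sheaf M C F G) U V \<phi> = restrict \<phi> (opens M V)"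
  by (simp add: Hom_sheaf_def)

lemma Hom_sheaf_res_apply [simp]:
  "\<lbrakk>openin M W; W \<subseteq> V\<rbrakk> \<Longrightarrow> res (Hom_sheaf M C F G) U V \<phi> W = \<phi> W"
  by (simp add: Hom_sheaf_def)

lemma Hom_sheaf_zero_apply [simp]:
  "\<lbrakk>openin M V; V \<subseteq> U; s \<in> carrier (sect F V)\<rbrakk>
    \<Longrightarrow> \<zero>\<^bsub>sect (Hom_sheaf M C F G) U\<^esub> V s = \<zero>\<^bsub>sect G V\<^esub>"
  by (simp add: Hom_sheaf_def)

lemma Hom_sheaf_add_apply [simp]:
  "\<lbrakk>openin M V; V \<subseteq> U; s \<in> carrier (sect F V)\<rbrakk>
    \<Longrightarrow> (\<phi> \<oplus>\<^bsub>sect (Hom_sheaf M C F G) U\<^esub> \<psi>) V s = \<phi> V s \<oplus>\<^bsub>sect G V\<^esub> \<psi> V s"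
  by (simp add: Hom_sheaf_def)

lemma Hom_sheaf_smult_apply [simp]:
  "\<lbrakk>openin M V; V \<subseteq> U; s \<in> carrier (sect F V)\<rbrakk>
    \<Longrightarrow> (f \<odot>\<^bsub>sect (Hom_sheaf M C F G) U\<^esub> \<phi>) V s = res C U V f \<odot>\<^bsub>sect G V\<^esub> \<phi> V s"
  by (simp add: Hom_sheaf_def)

section \<open>The Hom sheaf as a sheaf of modules\<close>

locale module_sheaf_pair = F: module_sheaf M C F + G: module_sheaf M C G
  for M :: "'a topology" and C :: "('a, 'c, ('c, 'x) ring_scheme) sheaf_data"
    and F :: "('a, 's, ('c, 's, 'y) module_scheme) sheaf_data"
    and G :: "('a, 't, ('c, 't, 'z) module_scheme) sheaf_data"
begin

lemma Hom_sheaf_zero_closed: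
  assumes "openin M U"
  shows "\<zero>\<^bsub>sect (Hom_sheaf M C F G) U\<^esub> \<in> linear_sheaf_homs M C U F G"
proof (rule linear_sheaf_homsI)
  show "\<zero>\<^bsub>sect (Hom_sheaf M C F G) U\<^esub> \<in> sheaf_homs M U F G"
    unfolding Hom_sheaf_def
    by (simp, intro sheaf_homsI F.set_sheaf_axioms)
      (auto simp: G.res_zero intro: abelian_groupE G.sect_abelian_group)
next
  fix V s t assume V: "openin M V" "V \<subseteq> U"
  interpret V: Module.module "sect C V" "sect F V" using V by (rule_tac F.sect_module)
  interpret W: Module.module "sect C V" "sect G V" using V by (rule_tac G.sect_module)
  assume s: "s \<in> carrier (sect F V)"
  show "\<zero>\<^bsub>sect (Hom_sheaf M C F G) U\<^esub> V (f \<odot>\<^bsub>sect F V\<^esub> s)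
    = f \<odot>\<^bsub>sect G V\<^esub> \<zero>\<^bsub>sect (Hom_sheaf M C F G) U\<^esub> V s" if "f \<in> carrier (sect C V)" for f
    using V s that by simp
  assume t: "t \<in> carrier (sect F V)"
  show "\<zero>\<^bsub>sect (Hom_sheaf M C F G) U\<^esub> V (s \<oplus>\<^bsub>sect F V\<^esub> t)
    = \<zero>\<^bsub>sect (Hom_sheaf M C F G) U\<^esub> V s \<oplus>\<^bsub>sect G V\<^esub> \<zero>\<^bsub>sect (Hom_sheaf M C F G) U\<^esub> V t"
    using V s t by simp
qed

lemma Hom_sheaf_add_closed:
  assumes "\<phi> \<in> linear_sheaf_homs M C U F G" "\<psi> \<in> linear_sheaf_homs M C U F G"
  shows "\<phi> \<oplus>\<^bsub>sect (Hom_sheaf M C F G) U\<^esub> \<psi> \<in> linear_sheaf_homs M C U F G"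
proof (rule linear_sheaf_homsI)
  note cl = linear_sheaf_homs_closed[OF assms(1)] linear_sheaf_homs_closed[OF assms(2)]
  show "\<phi> \<oplus>\<^bsub>sect (Hom_sheaf M C F G) U\<^esub> \<psi> \<in> sheaf_homs M U F G"
    unfolding Hom_sheaf_def
  proof (simp, rule sheaf_homsI[OF _ _ F.set_sheaf_axioms])
    fix V s assume V: "openin M V" "V \<subseteq> U" and s: "s \<in> carrier (sect F V)"
    interpret V: abelian_group "sect G V" using V by (rule_tac G.sect_abelian_group)
    show "\<phi> V s \<oplus>\<^bsub>sect G V\<^esub> \<psi> V s \<in> carrier (sect G V)"
      using V s cl by simp
    show "res G V W (\<phi> V s \<oplus>\<^bsub>sect G V\<^esub> \<psi> V s)
      = \<phi> W (res F V W s) \<oplus>\<^bsub>sect G W\<^esub> \<psi> W (res F V W s)" if "openin M W" "W \<subseteq> V" for W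
      using V s cl that G.res_add[of V W] assms
      by (simp add: additive_map_def linear_sheaf_homs_res[of _ M C U F G])
  qed
next
  note cl = linear_sheaf_homs_closed[OF assms(1)] linear_sheaf_homs_closed[OF assms(2)]
  fix V s t assume V: "openin M V" "V \<subseteq> U"
  interpret V: Module.module "sect C V" "sect F V" using V by (rule_tac F.sect_module)
  interpret W: Module.module "sect C V" "sect G V" using V by (rule_tac G.sect_module)
  assume s: "s \<in> carrier (sect F V)"
  show "(\<phi> \<oplus>\<^bsub>sect (Hom_sheaf M C F G) U\<^esub> \<psi>) V (f \<odot>\<^bsub>sect F V\<^esub> s)
    = f \<odot>\<^bsub>sect G V\<^esub> (\<phi> \<oplus>\<^bsub>sect (Hom_sheaf M C F G) U\<^esub> \<psi>) V s" if "f \<in> carrier (sect C V)" for f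
    using V s that cl assms
    by (simp add: linear_sheaf_homs_smult[of _ M C U F G] W.smult_r_distr)
  assume t: "t \<in> carrier (sect F V)"
  show "(\<phi> \<oplus>\<^bsub>sect (Hom_sheaf M C F G) U\<^esub> \<psi>) V (s \<oplus>\<^bsub>sect F V\<^esub> t)
    = (\<phi> \<oplus>\<^bsub>sect (Hom_sheaf M C F G) U\<^esub> \<psi>) V s \<oplus>\<^bsub>sect G V\<^esub>
      (\<phi> \<oplus>\<^bsub>sect (Hom_sheaf M C F G) U\<^esub> \<psi>) V t"
    using V s t cl assms
    by (simp add: linear_sheaf_homs_add[of _ M C U F G] W.M.a_ac)
qed

text \<open>Linearity of the multiple over \<open>C\<close> rests on commutativity, which lets the
  scalar \<open>g\<close> pass the restriction of \<open>f\<close>; naturality rests on restriction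
  of \<open>f\<close> being functorial.\<close>

lemma Hom_sheaf_smult_closed:
  assumes U: "openin M U" and f: "f \<in> carrier (sect C U)"
    and \<phi>: "\<phi> \<in> linear_sheaf_homs M C U F G"
  shows "f \<odot>\<^bsub>sect (Hom_sheaf M C F G) U\<^esub> \<phi> \<in> linear_sheaf_homs M C U F G"
proof (rule linear_sheaf_homsI)
  note cl = linear_sheaf_homs_closed[OF \<phi>]
  have f_cl: "res C U V f \<in> carrier (sect C V)" if "openin M V" "V \<subseteq> U" for V
    using that f U by (intro F.C.res_closed) auto
  show "f \<odot>\<^bsub>sect (Hom_sheaf M C F G) U\<^esub> \<phi> \<in> sheaf_homs M U F G"
    unfolding Hom_sheaf_def
  proof (simp, rule sheaf_homsI[OF _ _ F.set_sheaf_axioms])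
    fix V s assume V: "openin M V" "V \<subseteq> U" and s: "s \<in> carrier (sect F V)"
    interpret V: Module.module "sect C V" "sect G V" using V by (rule_tac G.sect_module)
    show "res C U V f \<odot>\<^bsub>sect G V\<^esub> \<phi> V s \<in> carrier (sect G V)"
      using V s cl f_cl by simp
    show "res G V W (res C U V f \<odot>\<^bsub>sect G V\<^esub> \<phi> V s)
      = res C U W f \<odot>\<^bsub>sect G W\<^esub> \<phi> W (res F V W s)" if "openin M W" "W \<subseteq> V" for W
      using U V s cl f that f_cl
      by (simp add: G.res_smult F.C.res_comp linear_sheaf_homs_res[OF \<phi>])
  qed
  fix V s t assume V: "openin M V" "V \<subseteq> U"
  interpret V: Module.module "sect C V" "sect F V" using V by (rule_tac F.sect_module)
  interpret W: Module.module "sect C V" "sect G V" using V by (rule_tac G.sect_module)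
  assume s: "s \<in> carrier (sect F V)"
  show "(f \<odot>\<^bsub>sect (Hom_sheaf M C F G) U\<^esub> \<phi>) V (g \<odot>\<^bsub>sect F V\<^esub> s)
    = g \<odot>\<^bsub>sect G V\<^esub> (f \<odot>\<^bsub>sect (Hom_sheaf M C F G) U\<^esub> \<phi>) V s" if "g \<in> carrier (sect C V)" for g
    using V s that cl f_cl
    by (simp add: linear_sheaf_homs_smult[OF \<phi>] V.R.m_comm flip: W.smult_assoc1)
  assume t: "t \<in> carrier (sect F V)"
  show "(f \<odot>\<^bsub>sect (Hom_sheaf M C F G) U\<^esub> \<phi>) V (s \<oplus>\<^bsub>sect F V\<^esub> t)
    = (f \<odot>\<^bsub>sect (Hom_sheaf M C F G) U\<^esub> \<phi>) V s \<oplus>\<^bsub>sect G V\<^esub>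
      (f \<odot>\<^bsub>sect (Hom_sheaf M C F G) U\<^esub> \<phi>) V t"
    using V s t cl f_cl by (simp add: linear_sheaf_homs_add[OF \<phi>] W.smult_r_distr)
qed

text \<open>The inverse is the multiple of \<open>\<phi>\<close> by minus one, so its linearity and
  naturality come from \<open>Hom_sheaf_smult_closed\<close>.\<close>

lemma Hom_sheaf_inverse:
  assumes U: "openin M U" and \<phi>: "\<phi> \<in> linear_sheaf_homs M C U F G"
  shows "\<exists>\<psi>\<in>linear_sheaf_homs M C U F G.
    \<psi> \<oplus>\<^bsub>sect (Hom_sheaf M C F G) U\<^esub> \<phi> = \<zero>\<^bsub>sect (Hom_sheaf M C F G) U\<^esub>"
proof
  interpret U: cring "sect C U" using U by (rule F.C.sect_cring)
  let ?\<psi> = "(\<ominus>\<^bsub>sect C U\<^esub> \<one>\<^bsub>sect C U\<^esub>) \<odot>\<^bsub>sect (Hom_sheaf M C F G) U\<^esub> \<phi>"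
  show \<psi>: "?\<psi> \<in> linear_sheaf_homs M C U F G"
    using U \<phi> by (intro Hom_sheaf_smult_closed) auto
  show "?\<psi> \<oplus>\<^bsub>sect (Hom_sheaf M C F G) U\<^esub> \<phi> = \<zero>\<^bsub>sect (Hom_sheaf M C F G) U\<^esub>"
  proof (rule linear_sheaf_homs_eqI[OF Hom_sheaf_add_closed[OF \<psi> \<phi>] Hom_sheaf_zero_closed[OF U]])
    fix V s assume V: "openin M V" "V \<subseteq> U" and s: "s \<in> carrier (sect F V)"
    interpret V: Module.module "sect C V" "sect G V" using V by (rule_tac G.sect_module)
    have h: "ring_hom_cring (sect C U) (sect C V) (res C U V)"
      using V U F.C.res_ring_hom[of U V]
      by (intro ring_hom_cring.intro ring_hom_cring_axioms.intro F.C.sect_cring) auto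
    \<comment> \<open>A scalar over \<open>U\<close> acts on sections over \<open>V\<close> through
      its restriction, so minus one must restrict to minus one.\<close>
    have "res C U V (\<ominus>\<^bsub>sect C U\<^esub> \<one>\<^bsub>sect C U\<^esub>) = \<ominus>\<^bsub>sect C V\<^esub> \<one>\<^bsub>sect C V\<^esub>"
      using ring_hom_cring.hom_a_inv[OF h, of "\<one>\<^bsub>sect C U\<^esub>"] V U
        ring_hom_one[OF F.C.res_ring_hom[of U V]] by simp
    then show "(?\<psi> \<oplus>\<^bsub>sect (Hom_sheaf M C F G) U\<^esub> \<phi>) V s = \<zero>\<^bsub>sect (Hom_sheaf M C F G) U\<^esub> V s"
      using V s linear_sheaf_homs_closed[OF \<phi> V s] by (simp add: V.smult_l_minus V.M.l_neg)
  qed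
qed

lemma Hom_sheaf_abelian_group:
  assumes U: "openin M U"
  shows "abelian_group (sect (Hom_sheaf M C F G) U)"
proof (rule abelian_groupI; simp)
  note cl = linear_sheaf_homs_closed
  fix \<phi> \<psi> \<chi> assume \<phi>: "\<phi> \<in> linear_sheaf_homs M C U F G"
  show "\<exists>\<psi>\<in>linear_sheaf_homs M C U F G.
    \<psi> \<oplus>\<^bsub>sect (Hom_sheaf M C F G) U\<^esub> \<phi> = \<zero>\<^bsub>sect (Hom_sheaf M C F G) U\<^esub>"
    by (rule Hom_sheaf_inverse[OF U \<phi>])
  show "\<zero>\<^bsub>sect (Hom_sheaf M C F G) U\<^esub> \<oplus>\<^bsub>sect (Hom_sheaf M C F G) U\<^esub> \<phi> = \<phi>"
    by (rule linear_sheaf_homs_eqI[OF Hom_sheaf_add_closed[OF Hom_sheaf_zero_closed[OF U] \<phi>] \<phi>])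
      (simp add: abelian_groupE(5)[OF G.sect_abelian_group] cl[OF \<phi>])
  assume \<psi>: "\<psi> \<in> linear_sheaf_homs M C U F G"
  show "\<phi> \<oplus>\<^bsub>sect (Hom_sheaf M C F G) U\<^esub> \<psi> \<in> linear_sheaf_homs M C U F G"
    by (rule Hom_sheaf_add_closed[OF \<phi> \<psi>])
  show "\<phi> \<oplus>\<^bsub>sect (Hom_sheaf M C F G) U\<^esub> \<psi> = \<psi> \<oplus>\<^bsub>sect (Hom_sheaf M C F G) U\<^esub> \<phi>"
    by (rule linear_sheaf_homs_eqI[OF Hom_sheaf_add_closed[OF \<phi> \<psi>] Hom_sheaf_add_closed[OF \<psi> \<phi>]])
      (simp add: abelian_groupE(4)[OF G.sect_abelian_group] cl[OF \<phi>] cl[OF \<psi>])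
  assume \<chi>: "\<chi> \<in> linear_sheaf_homs M C U F G"
  show "\<phi> \<oplus>\<^bsub>sect (Hom_sheaf M C F G) U\<^esub> \<psi> \<oplus>\<^bsub>sect (Hom_sheaf M C F G) U\<^esub> \<chi>
    = \<phi> \<oplus>\<^bsub>sect (Hom_sheaf M C F G) U\<^esub> (\<psi> \<oplus>\<^bsub>sect (Hom_sheaf M C F G) U\<^esub> \<chi>)"
    by (rule linear_sheaf_homs_eqI[OF Hom_sheaf_add_closed[OF Hom_sheaf_add_closed[OF \<phi> \<psi>] \<chi>]
          Hom_sheaf_add_closed[OF \<phi> Hom_sheaf_add_closed[OF \<psi> \<chi>]]])
      (simp add: abelian_groupE(3)[OF G.sect_abelian_group] cl[OF \<phi>] cl[OF \<psi>] cl[OF \<chi>])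
qed (rule Hom_sheaf_zero_closed[OF U])

text \<open>Subtraction is not a field of the record but comes from the abstract inverse in the
  group of sections. Evaluating the equation that defines this inverse, and using uniqueness of
  inverses in \<open>sect G V\<close>, shows that it is pointwise.\<close>

lemma Hom_sheaf_minus_apply:
  assumes U: "openin M U" and V: "openin M V" "V \<subseteq> U" and s: "s \<in> carrier (sect F V)"
    and \<phi>: "\<phi> \<in> linear_sheaf_homs M C U F G" and \<psi>: "\<psi> \<in> linear_sheaf_homs M C U F G"
  shows "(\<phi> \<ominus>\<^bsub>sect (Hom_sheaf M C F G) U\<^esub> \<psi>) V s = \<phi> V s \<ominus>\<^bsub>sect G V\<^esub> \<psi> V s"
proof -
  interpret U: abelian_group "sect (Hom_sheaf M C F G) U" using U by (rule Hom_sheaf_abelian_group)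
  interpret V: abelian_group "sect G V" using V by (rule_tac G.sect_abelian_group)
  let ?m = "\<ominus>\<^bsub>sect (Hom_sheaf M C F G) U\<^esub> \<psi>"
  have m: "?m \<in> linear_sheaf_homs M C U F G" using U.a_inv_closed \<psi> by simp
  have "?m V s \<oplus>\<^bsub>sect G V\<^esub> \<psi> V s = (?m \<oplus>\<^bsub>sect (Hom_sheaf M C F G) U\<^esub> \<psi>) V s"
    using V s by simp
  also have "\<dots> = \<zero>\<^bsub>sect G V\<^esub>" using V s \<psi> U.l_neg by simp
  finally have "?m V s = \<ominus>\<^bsub>sect G V\<^esub> \<psi> V s"
    using V.minus_equality linear_sheaf_homs_closed[OF m V s] linear_sheaf_homs_closed[OF \<psi> V s]
    by metis
  then show ?thesis using V s by (simp add: U.minus_eq V.minus_eq)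
qed

text \<open>Each law is the corresponding law in the modules \<open>sect G V\<close>, carried over
  by the ring homomorphism \<open>res C U V\<close> through which the scalars act.\<close>

lemma Hom_sheaf_module:
  assumes U: "openin M U"
  shows "Module.module (sect C U) (sect (Hom_sheaf M C F G) U)"
proof (rule Module.moduleI[OF F.C.sect_cring[OF U] Hom_sheaf_abelian_group[OF U]]; simp)
  interpret U: cring "sect C U" using U by (rule F.C.sect_cring)
  note cl = linear_sheaf_homs_closed and sm = Hom_sheaf_smult_closed[OF U]
  have r: "res C U V \<in> ring_hom (sect C U) (sect C V)" if "openin M V" "V \<subseteq> U" for V
    using F.C.res_ring_hom that U by simp
  fix f g \<phi> \<psi> assume \<phi>: "\<phi> \<in> linear_sheaf_homs M C U F G"
  show "\<one>\<^bsub>sect C U\<^esub> \<odot>\<^bsub>sect (Hom_sheaf M C F G) U\<^esub> \<phi> = \<phi>"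
    by (rule linear_sheaf_homs_eqI[OF sm[OF U.one_closed \<phi>] \<phi>])
      (simp add: ring_hom_one[OF r] Module.module.smult_one[OF G.sect_module] cl[OF \<phi>])
  assume f: "f \<in> carrier (sect C U)"
  show "f \<odot>\<^bsub>sect (Hom_sheaf M C F G) U\<^esub> \<phi> \<in> linear_sheaf_homs M C U F G"
    by (rule sm[OF f \<phi>])
  show "f \<odot>\<^bsub>sect (Hom_sheaf M C F G) U\<^esub> (\<phi> \<oplus>\<^bsub>sect (Hom_sheaf M C F G) U\<^esub> \<psi>)
    = f \<odot>\<^bsub>sect (Hom_sheaf M C F G) U\<^esub> \<phi> \<oplus>\<^bsub>sect (Hom_sheaf M C F G) U\<^esub>
      f \<odot>\<^bsub>sect (Hom_sheaf M C F G) U\<^esub> \<psi>" if \<psi>: "\<psi> \<in> linear_sheaf_homs M C U F G"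
    by (rule linear_sheaf_homs_eqI[OF sm[OF f Hom_sheaf_add_closed[OF \<phi> \<psi>]]
          Hom_sheaf_add_closed[OF sm[OF f \<phi>] sm[OF f \<psi>]]])
      (simp add: Module.module.smult_r_distr[OF G.sect_module] cl[OF \<phi>] cl[OF \<psi>]
        ring_hom_closed[OF r f])
  assume g: "g \<in> carrier (sect C U)"
  show "(f \<oplus>\<^bsub>sect C U\<^esub> g) \<odot>\<^bsub>sect (Hom_sheaf M C F G) U\<^esub> \<phi>
    = f \<odot>\<^bsub>sect (Hom_sheaf M C F G) U\<^esub> \<phi> \<oplus>\<^bsub>sect (Hom_sheaf M C F G) U\<^esub>
      g \<odot>\<^bsub>sect (Hom_sheaf M C F G) U\<^esub> \<phi>"
    by (rule linear_sheaf_homs_eqI[OF sm[OF U.a_closed[OF f g] \<phi>]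
          Hom_sheaf_add_closed[OF sm[OF f \<phi>] sm[OF g \<phi>]]])
      (simp add: Module.module.smult_l_distr[OF G.sect_module] cl[OF \<phi>]
        ring_hom_closed[OF r f] ring_hom_closed[OF r g] ring_hom_add[OF r f g])
  show "(f \<otimes>\<^bsub>sect C U\<^esub> g) \<odot>\<^bsub>sect (Hom_sheaf M C F G) U\<^esub> \<phi>
    = f \<odot>\<^bsub>sect (Hom_sheaf M C F G) U\<^esub> (g \<odot>\<^bsub>sect (Hom_sheaf M C F G) U\<^esub> \<phi>)"
    by (rule linear_sheaf_homs_eqI[OF sm[OF U.m_closed[OF f g] \<phi>] sm[OF f sm[OF g \<phi>]]])
      (simp add: Module.module.smult_assoc1[OF G.sect_module] cl[OF \<phi>]
        ring_hom_closed[OF r f] ring_hom_closed[OF r g] ring_hom_mult[OF r f g])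
qed

lemma Hom_sheaf_locality:
  assumes op: "\<And>U. U \<in> \<U> \<Longrightarrow> openin M U"
    and \<phi>: "\<phi> \<in> linear_sheaf_homs M C (\<Union>\<U>) F G" and \<psi>: "\<psi> \<in> linear_sheaf_homs M C (\<Union>\<U>) F G"
    and eq: "\<And>U. U \<in> \<U> \<Longrightarrow>
      res (Hom_sheaf M C F G) (\<Union>\<U>) U \<phi> = res (Hom_sheaf M C F G) (\<Union>\<U>) U \<psi>"
  shows "\<phi> = \<psi>"
proof (rule linear_sheaf_homs_eqI[OF \<phi> \<psi>])
  fix V s assume V: "openin M V" "V \<subseteq> \<Union>\<U>" and s: "s \<in> carrier (sect F V)"
  note cl = linear_sheaf_homs_closed[OF \<phi> V s] linear_sheaf_homs_closed[OF \<psi> V s]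
  show "\<phi> V s = \<psi> V s"
  proof (rule G.eq_if_locally_eq[OF op V cl])
    fix U W assume W: "U \<in> \<U>" "openin M W" "W \<subseteq> U" "W \<subseteq> V"
    have "\<phi> W = \<psi> W" using fun_cong[OF eq[OF W(1)], of W] W by simp
    then show "res G V W (\<phi> V s) = res G V W (\<psi> V s)"
      using W V s by (simp add: linear_sheaf_homs_res[OF \<phi>] linear_sheaf_homs_res[OF \<psi>])
  qed
qed

text \<open>After \<open>glue_sheaf_homs\<close> only linearity is left. It is an equation between
  sections of \<open>G\<close>, so it can be tested on open sets inside one member \<open>U\<close>,
  where the glued map is the linear map \<open>\<sigma> U\<close>.\<close>

lemma Hom_sheaf_gluing:
  assumes op: "\<And>U. U \<in> \<U> \<Longrightarrow> openin M U"
    and \<sigma>: "\<And>U. U \<in> \<U> \<Longrightarrow> \<sigma> U \<in> linear_sheaf_homs M C U F G"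
    and compat: "\<And>U V. \<lbrakk>U \<in> \<U>; V \<in> \<U>\<rbrakk> \<Longrightarrow>
      res (Hom_sheaf M C F G) U (U \<inter> V) (\<sigma> U) = res (Hom_sheaf M C F G) V (U \<inter> V) (\<sigma> V)"
  shows "\<exists>\<phi>\<in>linear_sheaf_homs M C (\<Union>\<U>) F G. \<forall>U\<in>\<U>. res (Hom_sheaf M C F G) (\<Union>\<U>) U \<phi> = \<sigma> U"
proof -
  have compat': "\<sigma> U W = \<sigma> V W" if "U \<in> \<U>" "V \<in> \<U>" "openin M W" "W \<subseteq> U" "W \<subseteq> V" for U V W
    using fun_cong[OF compat[OF that(1,2)], of W] that by simp
  obtain \<phi> where \<phi>: "\<phi> \<in> sheaf_homs M (\<Union>\<U>) F G"
    and \<phi>_eq: "\<And>U W s. \<lbrakk>U \<in> \<U>; openin M W; W \<subseteq> U; s \<in> carrier (sect F W)\<rbrakk> \<Longrightarrow> \<phi> W s = \<sigma> U W s"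
  proof (rule glue_sheaf_homs[OF F.set_sheaf_axioms G.set_sheaf_axioms op
        linear_sheaf_homs_sheaf_homs[OF \<sigma>]])
    show "\<sigma> U W s = \<sigma> V W s"
      if "U \<in> \<U>" "V \<in> \<U>" "openin M W" "W \<subseteq> U" "W \<subseteq> V" for U V W s
      using compat'[OF that] by simp
  qed (assumption, assumption, rule that, assumption, blast)
  have lin: "\<phi> \<in> linear_sheaf_homs M C (\<Union>\<U>) F G"
  proof (rule linear_sheaf_homsI[OF \<phi>])
    fix V s t assume V: "openin M V" "V \<subseteq> \<Union>\<U>" and s: "s \<in> carrier (sect F V)"
    interpret V: Module.module "sect C V" "sect F V" using V by (rule_tac F.sect_module)
    interpret W: Module.module "sect C V" "sect G V" using V by (rule_tac G.sect_module)
    note cl = sheaf_homs_closed[OF \<phi> V]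
    have F_cl: "res F V W t \<in> carrier (sect F W)"
      if "openin M W" "W \<subseteq> V" "t \<in> carrier (sect F V)" for W t
      using that V by (intro F.res_closed) auto
    have C_cl: "res C V W f \<in> carrier (sect C W)"
      if "openin M W" "W \<subseteq> V" "f \<in> carrier (sect C V)" for W f
      using that V by (intro F.C.res_closed) auto
    show "\<phi> V (f \<odot>\<^bsub>sect F V\<^esub> s) = f \<odot>\<^bsub>sect G V\<^esub> \<phi> V s" if f: "f \<in> carrier (sect C V)" for f
    proof (rule G.eq_if_locally_eq[OF op V])
      fix U W assume W: "U \<in> \<U>" "openin M W" "W \<subseteq> U" "W \<subseteq> V"
      interpret N: Module.module "sect C W" "sect F W" using W by (rule_tac F.sect_module)
      show "res G V W (\<phi> V (f \<odot>\<^bsub>sect F V\<^esub> s)) = res G V W (f \<odot>\<^bsub>sect G V\<^esub> \<phi> V s)"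
        using W V s f cl F_cl C_cl
        by (simp add: sheaf_homs_res[OF \<phi>] F.res_smult G.res_smult \<phi>_eq[of U]
            linear_sheaf_homs_smult[OF \<sigma>])
    qed (use s f cl in auto)
    assume t: "t \<in> carrier (sect F V)"
    show "\<phi> V (s \<oplus>\<^bsub>sect F V\<^esub> t) = \<phi> V s \<oplus>\<^bsub>sect G V\<^esub> \<phi> V t"
    proof (rule G.eq_if_locally_eq[OF op V])
      fix U W assume W: "U \<in> \<U>" "openin M W" "W \<subseteq> U" "W \<subseteq> V"
      interpret N: Module.module "sect C W" "sect F W" using W by (rule_tac F.sect_module)
      have add: "additive_map (sect F V) (sect F W) (res F V W)"
        "additive_map (sect G V) (sect G W) (res G V W)"
        using V W F.res_add G.res_add by auto
      show "res G V W (\<phi> V (s \<oplus>\<^bsub>sect F V\<^esub> t)) = res G V W (\<phi> V s \<oplus>\<^bsub>sect G V\<^esub> \<phi> V t)"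
        using W V s t cl F_cl add[unfolded additive_map_def]
        by (simp add: sheaf_homs_res[OF \<phi>] \<phi>_eq[of U] linear_sheaf_homs_add[OF \<sigma>])
    qed (use s t cl in auto)
  qed
  have "res (Hom_sheaf M C F G) (\<Union>\<U>) U \<phi> = \<sigma> U" if U: "U \<in> \<U>" for U
    by (rule linear_sheaf_homs_eqI[OF _ \<sigma>[OF U]])
      (use U lin \<phi>_eq in \<open>auto simp: Hom_sheaf_res intro!: linear_sheaf_homs_restrict\<close>)
  then show "\<exists>\<phi>\<in>linear_sheaf_homs M C (\<Union>\<U>) F G. \<forall>U\<in>\<U>. res (Hom_sheaf M C F G) (\<Union>\<U>) U \<phi> = \<sigma> U"
    using lin by blast
qed

lemma Hom_sheaf_set_sheaf: "set_sheaf M (Hom_sheaf M C F G)"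
proof (rule set_sheaf.intro, unfold Hom_sheaf_carrier)
  fix U V \<phi> assume V: "V \<in> opens M U" and \<phi>: "\<phi> \<in> linear_sheaf_homs M C U F G"
  show "res (Hom_sheaf M C F G) U V \<phi> \<in> linear_sheaf_homs M C V F G"
    using V \<phi> by (simp add: Hom_sheaf_res linear_sheaf_homs_restrict)
  show "res (Hom_sheaf M C F G) V W (res (Hom_sheaf M C F G) U V \<phi>) = res (Hom_sheaf M C F G) U W \<phi>"
    if "W \<in> opens M V" for W
  proof -
    have "opens M V \<inter> opens M W = opens M W" using that by (simp add: opens_def) blast
    then show ?thesis by (simp add: Hom_sheaf_res)
  qed
next
  fix U \<phi> assume \<phi>: "\<phi> \<in> linear_sheaf_homs M C U F G"
  show "res (Hom_sheaf M C F G) U U \<phi> = \<phi>"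
    using sheaf_homs_extensional[OF linear_sheaf_homs_sheaf_homs[OF \<phi>]]
    by (simp add: Hom_sheaf_res extensional_restrict)
next
  fix \<U> s t
  assume "\<And>U. U \<in> \<U> \<Longrightarrow> openin M U"
    and "s \<in> linear_sheaf_homs M C (\<Union>\<U>) F G" "t \<in> linear_sheaf_homs M C (\<Union>\<U>) F G"
    and "\<And>U. U \<in> \<U> \<Longrightarrow> res (Hom_sheaf M C F G) (\<Union>\<U>) U s = res (Hom_sheaf M C F G) (\<Union>\<U>) U t"
  then show "s = t" by (rule Hom_sheaf_locality)
next
  fix \<U> \<sigma>
  assume "\<And>U. U \<in> \<U> \<Longrightarrow> openin M U"
    and "\<And>U. U \<in> \<U> \<Longrightarrow> \<sigma> U \<in> linear_sheaf_homs M C U F G"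
    and "\<And>U V. \<lbrakk>U \<in> \<U>; V \<in> \<U>\<rbrakk> \<Longrightarrow>
      res (Hom_sheaf M C F G) U (U \<inter> V) (\<sigma> U) = res (Hom_sheaf M C F G) V (U \<inter> V) (\<sigma> V)"
  then show "\<exists>s\<in>linear_sheaf_homs M C (\<Union>\<U>) F G. \<forall>U\<in>\<U>. res (Hom_sheaf M C F G) (\<Union>\<U>) U s = \<sigma> U"
    by (rule Hom_sheaf_gluing)
qed

text \<open>This closes the construction under iteration: a Hom sheaf can again be the target of a
  Hom sheaf, as the coefficients of the obstruction class demand.\<close>

lemma Hom_sheaf_module_sheaf: "module_sheaf M C (Hom_sheaf M C F G)"
proof -
  have res_add: "additive_map (sect (Hom_sheaf M C F G) U) (sect (Hom_sheaf M C F G) V)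
    (res (Hom_sheaf M C F G) U V)" if U: "openin M U" and V: "openin M V" "V \<subseteq> U" for U V
    unfolding additive_map_def
  proof (intro ballI; simp)
    fix \<phi> \<psi> assume \<phi>: "\<phi> \<in> linear_sheaf_homs M C U F G" and \<psi>: "\<psi> \<in> linear_sheaf_homs M C U F G"
    show "res (Hom_sheaf M C F G) U V (\<phi> \<oplus>\<^bsub>sect (Hom_sheaf M C F G) U\<^esub> \<psi>)
      = res (Hom_sheaf M C F G) U V \<phi> \<oplus>\<^bsub>sect (Hom_sheaf M C F G) V\<^esub> res (Hom_sheaf M C F G) U V \<psi>"
      unfolding Hom_sheaf_res
      by (rule linear_sheaf_homs_eqI[OF linear_sheaf_homs_restrict[OF Hom_sheaf_add_closed[OF \<phi> \<psi>] V(2)]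
            Hom_sheaf_add_closed[OF linear_sheaf_homs_restrict[OF \<phi> V(2)] linear_sheaf_homs_restrict[OF \<psi> V(2)]]])
        (use V in auto)
  qed
  have res_smult: "res (Hom_sheaf M C F G) U V (f \<odot>\<^bsub>sect (Hom_sheaf M C F G) U\<^esub> \<phi>)
      = res C U V f \<odot>\<^bsub>sect (Hom_sheaf M C F G) V\<^esub> res (Hom_sheaf M C F G) U V \<phi>"
    if U: "openin M U" and V: "openin M V" "V \<subseteq> U" and f: "f \<in> carrier (sect C U)"
      and \<phi>: "\<phi> \<in> linear_sheaf_homs M C U F G" for U V f \<phi>
    unfolding Hom_sheaf_res
    by (rule linear_sheaf_homs_eqI[OF linear_sheaf_homs_restrict[OF Hom_sheaf_smult_closed[OF U f \<phi>] V(2)]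
          Hom_sheaf_smult_closed[OF V(1) F.C.res_closed linear_sheaf_homs_restrict[OF \<phi> V(2)]]])
      (use U V f in \<open>auto simp: F.C.res_comp\<close>)
  show ?thesis
    by (intro module_sheaf.intro abelian_sheaf.intro abelian_sheaf_axioms.intro module_sheaf_axioms.intro
        F.C.ring_sheaf_axioms Hom_sheaf_set_sheaf Hom_sheaf_abelian_group Hom_sheaf_module)
      (simp_all add: res_add res_smult)
qed

end

section \<open>Spaces of connections\<close>

context hrl_algebra
begin

lemma anchor_closed: "\<lbrakk>X \<in> carrier L; f \<in> carrier C\<rbrakk> \<Longrightarrow> anchor L X f \<in> carrier C"
  using anchor_derivation[of X] by (auto simp: derivations_def)

lemma anchor_add_right:
  "\<lbrakk>X \<in> carrier L; f \<in> carrier C; g \<in> carrier C\<rbrakk>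
    \<Longrightarrow> anchor L X (f \<oplus>\<^bsub>C\<^esub> g) = anchor L X f \<oplus>\<^bsub>C\<^esub> anchor L X g"
  using anchor_derivation[of X] by (auto simp: derivations_def linear_map_def additive_map_def)

lemma anchor_mult:
  "\<lbrakk>X \<in> carrier L; f \<in> carrier C; g \<in> carrier C\<rbrakk>
    \<Longrightarrow> anchor L X (f \<otimes>\<^bsub>C\<^esub> g) = (anchor L X f \<otimes>\<^bsub>C\<^esub> g) \<oplus>\<^bsub>C\<^esub> (f \<otimes>\<^bsub>C\<^esub> anchor L X g)"
  using anchor_derivation[of X] by (auto simp: derivations_def)

lemma scalar_closed: "k \<in> carrier K \<Longrightarrow> k \<odot>\<^bsub>C\<^esub> \<one>\<^bsub>C\<^esub> \<in> carrier C"
proof -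
  interpret algebra K C by (rule C_algebra)
  show "k \<in> carrier K \<Longrightarrow> k \<odot>\<^bsub>C\<^esub> \<one>\<^bsub>C\<^esub> \<in> carrier C" by simp
qed

text \<open>A derivation kills the unit, because applying it to 1 = 1 * 1 gives the same value twice
  in a sum; linearity over \<open>K\<close> does the rest.\<close>

lemma anchor_scalar:
  assumes "X \<in> carrier L" "k \<in> carrier K"
  shows "anchor L X (k \<odot>\<^bsub>C\<^esub> \<one>\<^bsub>C\<^esub>) = \<zero>\<^bsub>C\<^esub>"
proof -
  interpret algebra K C by (rule C_algebra)
  have cl: "anchor L X \<one>\<^bsub>C\<^esub> \<in> carrier C" using assms(1) by (simp add: anchor_closed)
  have "anchor L X \<one>\<^bsub>C\<^esub> = anchor L X \<one>\<^bsub>C\<^esub> \<oplus>\<^bsub>C\<^esub> anchor L X \<one>\<^bsub>C\<^esub>"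
    using anchor_mult[OF assms(1), of "\<one>\<^bsub>C\<^esub>" "\<one>\<^bsub>C\<^esub>"] cl by simp
  then have "anchor L X \<one>\<^bsub>C\<^esub> = \<zero>\<^bsub>C\<^esub>"
    using cl by (metis M.add.r_cancel_one')
  then show ?thesis
    using anchor_derivation[OF assms(1)] assms(2) by (auto simp: derivations_def linear_map_def)
qed

text \<open>This is \<open>kmult_compat\<close> at the unit of \<open>C\<close>. It turns
  multiplication by elements of \<open>K\<close> into a case of the Leibniz rule.\<close>

lemma kmult_eq_smult:
  assumes "k \<in> carrier K" "X \<in> carrier L"
  shows "kmult L k X = (k \<odot>\<^bsub>C\<^esub> \<one>\<^bsub>C\<^esub>) \<odot>\<^bsub>L\<^esub> X"
proof -
  interpret algebra K C by (rule C_algebra)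
  show ?thesis
    using kmult_compat[OF assms(1) _ assms(2), of "\<one>\<^bsub>C\<^esub>"] assms(2)
      Module.module.smult_one[OF L_module] by simp
qed

end

section \<open>The coefficient sheaf and the derivative term\<close>

context hrl_ringed_space
begin

lemma C_ring_sheaf: "ring_sheaf M C"
proof (intro ring_sheaf.intro ring_sheaf_axioms.intro C_sheaf C_res_ring_hom)
  fix U assume "openin M U"
  then interpret hrl_algebra K "sect C U" "sect L U" by (rule sections_hrl)
  show "cring (sect C U)" using C_algebra by (rule algebra.M_cring)
qed auto

lemma L_module_sheaf: "module_sheaf M C L"
proof (intro module_sheaf.intro abelian_sheaf.intro abelian_sheaf_axioms.intro
    module_sheaf_axioms.intro C_ring_sheaf L_sheaf L_res_smult)
  fix U assume U: "openin M U"
  then interpret hrl_algebra K "sect C U" "sect L U" by (rule sections_hrl)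
  show "Module.module (sect C U) (sect L U)" by (rule L_module)
  then show "abelian_group (sect L U)" by (simp add: Module.module_def)
  show "additive_map (sect L U) (sect L V) (res L U V)" if "V \<in> opens M U" for V
    using L_res_linear[OF U that] by (simp add: linear_map_def additive_map_def K_module_def)
qed auto

text \<open>The Hom construction is applied twice: \<open>LL\<close> yields \<open>EndL\<close>, the
  target of connections, and \<open>LE\<close> yields \<open>HomLE\<close>, where their differences
  live. \<open>H\<close> makes the results on Cech cochains available for
  \<open>HomLE\<close>.\<close>

sublocale LL: module_sheaf_pair M C L L
  by (intro module_sheaf_pair.intro L_module_sheaf)

abbreviation "EndL \<equiv> Hom_sheaf M C L L"

sublocale LE: module_sheaf_pair M C L EndL
  by (intro module_sheaf_pair.intro L_module_sheaf LL.Hom_sheaf_module_sheaf)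

abbreviation "HomLE \<equiv> Hom_sheaf M C L EndL"

sublocale H: module_sheaf M C HomLE
  by (rule LE.Hom_sheaf_module_sheaf)

text \<open>Linearity over \<open>C\<close> in the argument \<open>Y\<close> is that of the anchor,
  and compatibility with restriction is \<open>res_anchor\<close>.\<close>

lemma d_tensor_closed:
  assumes U: "openin M U" and f: "f \<in> carrier (sect C U)" and X: "X \<in> carrier (sect L U)"
  shows "d_tensor M C L U f X \<in> linear_sheaf_homs M C U L L"
proof -
  have f_cl: "res C U V f \<in> carrier (sect C V)" and X_cl: "res L U V X \<in> carrier (sect L V)"
    if "openin M V" "V \<subseteq> U" for V
    using that U f X LL.F.C.res_closed[of U V f] LL.F.res_closed[of U V X] by auto
  have a_cl: "anchor (sect L V) Y (res C U V f) \<in> carrier (sect C V)"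
    if "openin M V" "V \<subseteq> U" "Y \<in> carrier (sect L V)" for V Y
    using hrl_algebra.anchor_closed[OF sections_hrl] f_cl that by simp
  show ?thesis
    unfolding d_tensor_def
  proof (rule linear_sheaf_homsI)
    show "(\<lambda>V\<in>opens M U. \<lambda>Y\<in>carrier (sect L V).
      anchor (sect L V) Y (res C U V f) \<odot>\<^bsub>sect L V\<^esub> res L U V X) \<in> sheaf_homs M U L L"
    proof (rule sheaf_homsI[OF _ _ L_sheaf])
      fix V Y assume V: "openin M V" "V \<subseteq> U" and Y: "Y \<in> carrier (sect L V)"
      show "anchor (sect L V) Y (res C U V f) \<odot>\<^bsub>sect L V\<^esub> res L U V X \<in> carrier (sect L V)"
        using Module.module.smult_closed[OF LL.F.sect_module[OF V(1)] a_cl[OF V Y] X_cl[OF V]] .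
      show "res L V W (anchor (sect L V) Y (res C U V f) \<odot>\<^bsub>sect L V\<^esub> res L U V X)
        = anchor (sect L W) (res L V W Y) (res C U W f) \<odot>\<^bsub>sect L W\<^esub> res L U W X"
        if "openin M W" "W \<subseteq> V" for W
        using that V Y f X U a_cl[OF V Y] X_cl[OF V] f_cl[OF V] LL.F.C.res_comp[of U V W f]
          LL.F.res_comp[of U V W X]
        by (simp add: L_res_smult res_anchor)
    qed
  next
    fix V Y Z assume V: "openin M V" "V \<subseteq> U" and Y: "Y \<in> carrier (sect L V)"
    interpret V: Module.module "sect C V" "sect L V" using V by (rule_tac LL.F.sect_module)
    show "(\<lambda>V\<in>opens M U. \<lambda>Y\<in>carrier (sect L V).
        anchor (sect L V) Y (res C U V f) \<odot>\<^bsub>sect L V\<^esub> res L U V X) V (g \<odot>\<^bsub>sect L V\<^esub> Y)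
      = g \<odot>\<^bsub>sect L V\<^esub> (\<lambda>V\<in>opens M U. \<lambda>Y\<in>carrier (sect L V).
        anchor (sect L V) Y (res C U V f) \<odot>\<^bsub>sect L V\<^esub> res L U V X) V Y"
      if "g \<in> carrier (sect C V)" for g
      using that V Y a_cl[OF V Y] X_cl[OF V] f_cl[OF V]
      by (simp add: hrl_algebra.anchor_smult[OF sections_hrl] V.smult_assoc1)
    assume Z: "Z \<in> carrier (sect L V)"
    show "(\<lambda>V\<in>opens M U. \<lambda>Y\<in>carrier (sect L V).
        anchor (sect L V) Y (res C U V f) \<odot>\<^bsub>sect L V\<^esub> res L U V X) V (Y \<oplus>\<^bsub>sect L V\<^esub> Z)
      = (\<lambda>V\<in>opens M U. \<lambda>Y\<in>carrier (sect L V).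
        anchor (sect L V) Y (res C U V f) \<odot>\<^bsub>sect L V\<^esub> res L U V X) V Y \<oplus>\<^bsub>sect L V\<^esub>
        (\<lambda>V\<in>opens M U. \<lambda>Y\<in>carrier (sect L V).
        anchor (sect L V) Y (res C U V f) \<odot>\<^bsub>sect L V\<^esub> res L U V X) V Z"
      using V Y Z a_cl[OF V Y] a_cl[OF V Z] X_cl[OF V] f_cl[OF V]
      by (simp add: hrl_algebra.anchor_add[OF sections_hrl] V.smult_l_distr)
  qed
qed

text \<open>Needed to test the Leibniz rule of a glued connection locally, where the derivative term
  of the restricted data appears.\<close>

lemma d_tensor_res:
  assumes U: "openin M U" and V: "openin M V" "V \<subseteq> U"
    and f: "f \<in> carrier (sect C U)" and X: "X \<in> carrier (sect L U)"
  shows "res EndL U V (d_tensor M C L U f X) = d_tensor M C L V (res C U V f) (res L U V X)"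
  unfolding Hom_sheaf_res
proof (rule linear_sheaf_homs_eqI[OF linear_sheaf_homs_restrict[OF d_tensor_closed[OF U f X] V(2)]
      d_tensor_closed[OF V(1)]])
  show "res C U V f \<in> carrier (sect C V)" "res L U V X \<in> carrier (sect L V)"
    using U V f X LL.F.C.res_closed[of U V f] LL.F.res_closed[of U V X] by auto
  show "restrict (d_tensor M C L U f X) (opens M V) W Y
    = d_tensor M C L V (res C U V f) (res L U V X) W Y"
    if "openin M W" "W \<subseteq> V" "Y \<in> carrier (sect L W)" for W Y
  proof -
    have "W \<subseteq> U" using that V by auto
    then show ?thesis
      using that U V f X LL.F.C.res_comp[of U V W f] LL.F.res_comp[of U V W X]
      by (simp add: d_tensor_def)
  qed
qed

section \<open>Differences, translates and gluing of connections\<close>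

lemma connections_sheaf_homs: "D \<in> connections M K C L U \<Longrightarrow> D \<in> sheaf_homs M U L EndL"
  by (simp add: connections_def)

lemma connections_closed:
  "\<lbrakk>D \<in> connections M K C L U; openin M V; V \<subseteq> U; X \<in> carrier (sect L V)\<rbrakk>
    \<Longrightarrow> D V X \<in> linear_sheaf_homs M C V L L"
  using sheaf_homs_closed[OF connections_sheaf_homs] by fastforce

lemma connections_add:
  "\<lbrakk>D \<in> connections M K C L U; openin M V; V \<subseteq> U; X \<in> carrier (sect L V); Y \<in> carrier (sect L V)\<rbrakk>
    \<Longrightarrow> D V (X \<oplus>\<^bsub>sect L V\<^esub> Y) = D V X \<oplus>\<^bsub>sect EndL V\<^esub> D V Y"
  by (simp add: connections_def additive_map_def)

lemma connections_leibniz: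
  "\<lbrakk>D \<in> connections M K C L U; openin M V; V \<subseteq> U; f \<in> carrier (sect C V); X \<in> carrier (sect L V)\<rbrakk>
    \<Longrightarrow> D V (f \<odot>\<^bsub>sect L V\<^esub> X) = (f \<odot>\<^bsub>sect EndL V\<^esub> D V X) \<oplus>\<^bsub>sect EndL V\<^esub> d_tensor M C L V f X"
  by (simp add: connections_def)

text \<open>Linearity over \<open>K\<close> follows from the Leibniz rule, since \<open>d(k\<cdot>1) = 0\<close>.\<close>

lemma connectionsI:
  assumes D: "D \<in> sheaf_homs M U L EndL"
    and add: "\<And>V X Y. \<lbrakk>openin M V; V \<subseteq> U; X \<in> carrier (sect L V); Y \<in> carrier (sect L V)\<rbrakk>
      \<Longrightarrow> D V (X \<oplus>\<^bsub>sect L V\<^esub> Y) = D V X \<oplus>\<^bsub>sect EndL V\<^esub> D V Y"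
    and leibniz: "\<And>V f X. \<lbrakk>openin M V; V \<subseteq> U; f \<in> carrier (sect C V); X \<in> carrier (sect L V)\<rbrakk>
      \<Longrightarrow> D V (f \<odot>\<^bsub>sect L V\<^esub> X) = (f \<odot>\<^bsub>sect EndL V\<^esub> D V X) \<oplus>\<^bsub>sect EndL V\<^esub> d_tensor M C L V f X"
  shows "D \<in> connections M K C L U"
proof -
  have "D V (kmult (sect L V) k X)
      = (\<lambda>W\<in>opens M V. \<lambda>Y\<in>carrier (sect L W). kmult (sect L W) k (D V X W Y))"
    if V: "openin M V" "V \<subseteq> U" and k: "k \<in> carrier K" and X: "X \<in> carrier (sect L V)" for V k X
  proof -
    interpret V: hrl_algebra K "sect C V" "sect L V" using V by (rule_tac sections_hrl)
    interpret E: abelian_group "sect EndL V" using V by (rule_tac LE.G.sect_abelian_group)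
    let ?f = "k \<odot>\<^bsub>sect C V\<^esub> \<one>\<^bsub>sect C V\<^esub>"
    have DX: "D V X \<in> linear_sheaf_homs M C V L L"
      using sheaf_homs_closed[OF D V X] by simp
    have f: "?f \<in> carrier (sect C V)" using k by (rule V.scalar_closed)
    \<comment> \<open>The derivative term over \<open>W\<close> involves the restriction of
      \<open>?f\<close>; as this is again a multiple of the unit by \<open>k\<close>,
      \<open>anchor_scalar\<close> applies on every \<open>W\<close>.\<close>
    have res_f: "res C V W ?f = k \<odot>\<^bsub>sect C W\<^esub> \<one>\<^bsub>sect C W\<^esub>" if W: "W \<in> opens M V" for W
      using C_res_linear[OF V(1) W] ring_hom_one[OF C_res_ring_hom[OF V(1) W]] k
        cring.cring_simprules(6)[OF LL.F.C.sect_cring[OF V(1)]]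
      by (simp add: linear_map_def)
    have "d_tensor M C L V ?f X = \<zero>\<^bsub>sect EndL V\<^esub>"
    proof (rule linear_sheaf_homs_eqI[OF d_tensor_closed[OF V(1) f X] LL.Hom_sheaf_zero_closed[OF V(1)]])
      fix W Y assume W: "openin M W" "W \<subseteq> V" and Y: "Y \<in> carrier (sect L W)"
      have "res L V W X \<in> carrier (sect L W)" using W V X LL.F.res_closed[of V W X] by simp
      then show "d_tensor M C L V ?f X W Y = \<zero>\<^bsub>sect EndL V\<^esub> W Y"
        using W Y k by (simp add: d_tensor_def res_f hrl_algebra.anchor_scalar[OF sections_hrl]
            Module.module.smult_l_null[OF LL.F.sect_module])
    qed
    then have "D V (?f \<odot>\<^bsub>sect L V\<^esub> X) = ?f \<odot>\<^bsub>sect EndL V\<^esub> D V X"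
      using leibniz[OF V f X] E.r_zero
        Module.module.smult_closed[OF LE.G.sect_module[OF V(1)] f] DX by simp
    also have "\<dots> = (\<lambda>W\<in>opens M V. \<lambda>Y\<in>carrier (sect L W). kmult (sect L W) k (D V X W Y))"
    proof -
      have "res C V W ?f \<odot>\<^bsub>sect L W\<^esub> D V X W Y = kmult (sect L W) k (D V X W Y)"
        if "W \<in> opens M V" "Y \<in> carrier (sect L W)" for W Y
        using that linear_sheaf_homs_closed[OF DX, of W Y] k
        by (simp add: res_f hrl_algebra.kmult_eq_smult[OF sections_hrl])
      then show ?thesis by (simp add: Hom_sheaf_def cong: restrict_cong)
    qed
    finally show ?thesis using k X by (simp add: V.kmult_eq_smult)
  qed
  then show ?thesis
    using D add leibniz by (simp add: connections_def additive_map_def)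
qed

text \<open>A connection is no section of \<open>HomLE\<close>, so the subtraction of that sheaf
  does not apply to it. Here values in \<open>EndL\<close> are subtracted instead, over a
  \<open>U\<close> on which both arguments make sense although their own domains may differ.\<close>

definition hom_diff where
  "hom_diff U D D' = (\<lambda>V\<in>opens M U. \<lambda>X\<in>carrier (sect L V). D V X \<ominus>\<^bsub>sect EndL V\<^esub> D' V X)"

lemma hom_diff_apply [simp]:
  "\<lbrakk>openin M V; V \<subseteq> U; X \<in> carrier (sect L V)\<rbrakk>
    \<Longrightarrow> hom_diff U D D' V X = D V X \<ominus>\<^bsub>sect EndL V\<^esub> D' V X"
  by (simp add: hom_diff_def)

lemma hom_diff_sheaf_homs:
  assumes D: "D \<in> sheaf_homs M N L EndL" and D': "D' \<in> sheaf_homs M N' L EndL"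
    and sub: "U \<subseteq> N" "U \<subseteq> N'"
  shows "hom_diff U D D' \<in> sheaf_homs M U L EndL"
  unfolding hom_diff_def
proof (rule sheaf_homsI[OF _ _ L_sheaf])
  fix V X assume V: "openin M V" "V \<subseteq> U" and X: "X \<in> carrier (sect L V)"
  have V': "V \<subseteq> N" "V \<subseteq> N'" using V sub by auto
  interpret E: abelian_group "sect EndL V" using V by (rule_tac LE.G.sect_abelian_group)
  note cl = sheaf_homs_closed[OF D V(1) V'(1) X] sheaf_homs_closed[OF D' V(1) V'(2) X]
  show "D V X \<ominus>\<^bsub>sect EndL V\<^esub> D' V X \<in> carrier (sect EndL V)"
    by (rule E.minus_closed[OF cl])
  show "res EndL V W (D V X \<ominus>\<^bsub>sect EndL V\<^esub> D' V X)
    = D W (res L V W X) \<ominus>\<^bsub>sect EndL W\<^esub> D' W (res L V W X)" if W: "openin M W" "W \<subseteq> V" for W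
    using LE.G.res_minus[OF V(1) W cl] sheaf_homs_res[OF D V(1) V'(1) W X]
      sheaf_homs_res[OF D' V(1) V'(2) W X] by simp
qed

text \<open>Both connections contribute the same derivative term
  \<open>d_tensor M C L V f X\<close>, which cancels. The domains \<open>N\<close> and
  \<open>N'\<close> differ because the connections come from different members of a cover.\<close>

lemma hom_diff_connections:
  assumes D: "D \<in> connections M K C L N" and D': "D' \<in> connections M K C L N'"
    and sub: "U \<subseteq> N" "U \<subseteq> N'"
  shows "hom_diff U D D' \<in> linear_sheaf_homs M C U L EndL"
proof (rule linear_sheaf_homsI)
  show "hom_diff U D D' \<in> sheaf_homs M U L EndL"
    by (rule hom_diff_sheaf_homs[OF connections_sheaf_homs[OF D] connections_sheaf_homs[OF D'] sub])
  fix V X Y assume V: "openin M V" "V \<subseteq> U" and X: "X \<in> carrier (sect L V)"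
  have V': "V \<subseteq> N" "V \<subseteq> N'" using V sub by auto
  interpret E: Module.module "sect C V" "sect EndL V" using V by (rule_tac LE.G.sect_module)
  interpret L: Module.module "sect C V" "sect L V" using V by (rule_tac LL.F.sect_module)
  have cl: "D V X \<in> carrier (sect EndL V)" "D' V X \<in> carrier (sect EndL V)"
    if "X \<in> carrier (sect L V)" for X
    using connections_closed[OF D V(1) V'(1) that] connections_closed[OF D' V(1) V'(2) that] by auto
  show "hom_diff U D D' V (f \<odot>\<^bsub>sect L V\<^esub> X) = f \<odot>\<^bsub>sect EndL V\<^esub> hom_diff U D D' V X"
    if f: "f \<in> carrier (sect C V)" for f
  proof -
    have d: "d_tensor M C L V f X \<in> carrier (sect EndL V)"
      using d_tensor_closed[OF V(1) f X] by simp
    have "hom_diff U D D' V (f \<odot>\<^bsub>sect L V\<^esub> X)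
      = (f \<odot>\<^bsub>sect EndL V\<^esub> D V X \<oplus>\<^bsub>sect EndL V\<^esub> d_tensor M C L V f X) \<ominus>\<^bsub>sect EndL V\<^esub>
        (f \<odot>\<^bsub>sect EndL V\<^esub> D' V X \<oplus>\<^bsub>sect EndL V\<^esub> d_tensor M C L V f X)"
      using V f X by (simp add: connections_leibniz[OF D V(1) V'(1)] connections_leibniz[OF D' V(1) V'(2)])
    also have "\<dots> = f \<odot>\<^bsub>sect EndL V\<^esub> D V X \<ominus>\<^bsub>sect EndL V\<^esub> f \<odot>\<^bsub>sect EndL V\<^esub> D' V X"
      by (rule E.M.add_diff_cancel_right) (use E.smult_closed cl[OF X] f d in auto)
    also have "\<dots> = f \<odot>\<^bsub>sect EndL V\<^esub> (D V X \<ominus>\<^bsub>sect EndL V\<^esub> D' V X)"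
      using f cl[OF X] E.M.a_inv_closed by (simp add: E.M.minus_eq E.smult_r_distr E.smult_r_minus del: Hom_sheaf_carrier)
    finally show ?thesis using V X by simp
  qed
  assume Y: "Y \<in> carrier (sect L V)"
  show "hom_diff U D D' V (X \<oplus>\<^bsub>sect L V\<^esub> Y)
    = hom_diff U D D' V X \<oplus>\<^bsub>sect EndL V\<^esub> hom_diff U D D' V Y"
    using V X Y cl[OF X] cl[OF Y]
    by (simp add: connections_add[OF D V(1) V'(1)] connections_add[OF D' V(1) V'(2)]
        E.M.add_diff_add del: Hom_sheaf_carrier)
qed

text \<open>The other half of the torsor property: a linear \<open>b\<close> contributes no
  derivative term, so that of \<open>D\<close> survives the subtraction.\<close>

lemma connection_minus_linear:
  assumes D: "D \<in> connections M K C L N" and b: "b \<in> linear_sheaf_homs M C U L EndL"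
    and sub: "U \<subseteq> N"
  shows "hom_diff U D b \<in> connections M K C L U"
proof (rule connectionsI)
  show "hom_diff U D b \<in> sheaf_homs M U L EndL"
    by (rule hom_diff_sheaf_homs[OF connections_sheaf_homs[OF D] linear_sheaf_homs_sheaf_homs[OF b]])
      (use sub in auto)
  fix V X Y assume V: "openin M V" "V \<subseteq> U" and X: "X \<in> carrier (sect L V)"
  have V': "V \<subseteq> N" using V sub by auto
  interpret E: Module.module "sect C V" "sect EndL V" using V by (rule_tac LE.G.sect_module)
  interpret L: Module.module "sect C V" "sect L V" using V by (rule_tac LL.F.sect_module)
  have cl: "D V X \<in> carrier (sect EndL V)" "b V X \<in> carrier (sect EndL V)"
    if "X \<in> carrier (sect L V)" for X
    using connections_closed[OF D V(1) V' that] linear_sheaf_homs_closed[OF b V that] by auto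
  show "hom_diff U D b V (f \<odot>\<^bsub>sect L V\<^esub> X)
    = f \<odot>\<^bsub>sect EndL V\<^esub> hom_diff U D b V X \<oplus>\<^bsub>sect EndL V\<^esub> d_tensor M C L V f X"
    if f: "f \<in> carrier (sect C V)" for f
  proof -
    have d: "d_tensor M C L V f X \<in> carrier (sect EndL V)"
      using d_tensor_closed[OF V(1) f X] by simp
    have "hom_diff U D b V (f \<odot>\<^bsub>sect L V\<^esub> X)
      = (f \<odot>\<^bsub>sect EndL V\<^esub> D V X \<oplus>\<^bsub>sect EndL V\<^esub> d_tensor M C L V f X) \<ominus>\<^bsub>sect EndL V\<^esub>
        f \<odot>\<^bsub>sect EndL V\<^esub> b V X"
      using V f X by (simp add: connections_leibniz[OF D V(1) V'] linear_sheaf_homs_smult[OF b])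
    also have "\<dots> = f \<odot>\<^bsub>sect EndL V\<^esub> (D V X \<ominus>\<^bsub>sect EndL V\<^esub> b V X) \<oplus>\<^bsub>sect EndL V\<^esub> d_tensor M C L V f X"
      using f cl[OF X] d E.M.a_inv_closed E.smult_closed
      by (simp add: E.M.minus_eq E.smult_r_distr E.smult_r_minus E.M.a_ac del: Hom_sheaf_carrier)
    finally show ?thesis using V X by simp
  qed
  assume Y: "Y \<in> carrier (sect L V)"
  show "hom_diff U D b V (X \<oplus>\<^bsub>sect L V\<^esub> Y)
    = hom_diff U D b V X \<oplus>\<^bsub>sect EndL V\<^esub> hom_diff U D b V Y"
    using V X Y cl[OF X] cl[OF Y]
    by (simp add: connections_add[OF D V(1) V'] linear_sheaf_homs_add[OF b]
        E.M.add_diff_add del: Hom_sheaf_carrier)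
qed

text \<open>Additivity and the Leibniz rule are equations between sections of the sheaf
  \<open>EndL\<close>, hence local, and on a set inside one member \<open>U\<close> the glued map is
  the connection \<open>D U\<close>. Linearity over \<open>K\<close> is left to
  \<open>connectionsI\<close>.\<close>

lemma glue_connections:
  assumes op: "\<And>U. U \<in> \<U> \<Longrightarrow> openin M U"
    and D: "\<And>U. U \<in> \<U> \<Longrightarrow> D U \<in> connections M K C L U"
    and compat: "\<And>U V W X. \<lbrakk>U \<in> \<U>; V \<in> \<U>; openin M W; W \<subseteq> U; W \<subseteq> V; X \<in> carrier (sect L W)\<rbrakk>
      \<Longrightarrow> D U W X = D V W X"
  shows "\<exists>D. D \<in> connections M K C L (\<Union>\<U>)"
proof -
  obtain \<phi> where \<phi>: "\<phi> \<in> sheaf_homs M (\<Union>\<U>) L EndL"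
    and \<phi>_eq: "\<And>U W X. \<lbrakk>U \<in> \<U>; openin M W; W \<subseteq> U; X \<in> carrier (sect L W)\<rbrakk> \<Longrightarrow> \<phi> W X = D U W X"
  proof (rule glue_sheaf_homs[OF L_sheaf LE.G.set_sheaf_axioms op connections_sheaf_homs[OF D]])
    show "D U W X = D V W X" if "U \<in> \<U>" "V \<in> \<U>" "openin M W" "W \<subseteq> U" "W \<subseteq> V"
      "X \<in> carrier (sect L W)" for U V W X
      using compat[OF that] .
  qed (assumption, assumption, rule that, assumption, blast)
  have "\<phi> \<in> connections M K C L (\<Union>\<U>)"
  proof (rule connectionsI[OF \<phi>])
    fix V X Y assume V: "openin M V" "V \<subseteq> \<Union>\<U>" and X: "X \<in> carrier (sect L V)"
    interpret E: Module.module "sect C V" "sect EndL V" using V by (rule_tac LE.G.sect_module)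
    interpret L: Module.module "sect C V" "sect L V" using V by (rule_tac LL.F.sect_module)
    note cl = sheaf_homs_closed[OF \<phi> V]
    have L_cl: "res L V W X \<in> carrier (sect L W)"
      if "openin M W" "W \<subseteq> V" "X \<in> carrier (sect L V)" for W X
      using that V LL.F.res_closed[of V W X] by auto
    show "\<phi> V (f \<odot>\<^bsub>sect L V\<^esub> X) = f \<odot>\<^bsub>sect EndL V\<^esub> \<phi> V X \<oplus>\<^bsub>sect EndL V\<^esub> d_tensor M C L V f X"
      if f: "f \<in> carrier (sect C V)" for f
    proof (rule LE.G.eq_if_locally_eq[OF op V])
      have d: "d_tensor M C L V f X \<in> carrier (sect EndL V)"
        using d_tensor_closed[OF V(1) f X] by simp
      have fX: "f \<odot>\<^bsub>sect EndL V\<^esub> \<phi> V X \<in> carrier (sect EndL V)"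
        using E.smult_closed[OF f cl[OF X]] .
      show "\<phi> V (f \<odot>\<^bsub>sect L V\<^esub> X) \<in> carrier (sect EndL V)"
        using cl L.smult_closed[OF f X] by simp
      show "f \<odot>\<^bsub>sect EndL V\<^esub> \<phi> V X \<oplus>\<^bsub>sect EndL V\<^esub> d_tensor M C L V f X \<in> carrier (sect EndL V)"
        using E.M.a_closed[OF fX d] .
      fix U W assume W: "U \<in> \<U>" "openin M W" "W \<subseteq> U" "W \<subseteq> V"
      have fW: "res C V W f \<in> carrier (sect C W)"
        using W V f LL.F.C.res_closed[of V W f] by auto
      note XW = L_cl[OF W(2,4) X]
      have add: "additive_map (sect EndL V) (sect EndL W) (res EndL V W)"
        using V W LE.G.res_add by auto
      have "res EndL V W (\<phi> V (f \<odot>\<^bsub>sect L V\<^esub> X)) = D U W (res L V W (f \<odot>\<^bsub>sect L V\<^esub> X))"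
        using sheaf_homs_res[OF \<phi> V W(2,4) L.smult_closed[OF f X]]
          \<phi>_eq[OF W(1-3) L_cl[OF W(2,4) L.smult_closed[OF f X]]] by simp
      also have "\<dots> = D U W (res C V W f \<odot>\<^bsub>sect L W\<^esub> res L V W X)"
        using L_res_smult[OF V(1) _ f X, of W] W by simp
      also have "\<dots> = res C V W f \<odot>\<^bsub>sect EndL W\<^esub> D U W (res L V W X) \<oplus>\<^bsub>sect EndL W\<^esub>
          d_tensor M C L W (res C V W f) (res L V W X)"
        by (rule connections_leibniz[OF D[OF W(1)] W(2,3) fW XW])
      also have "D U W (res L V W X) = res EndL V W (\<phi> V X)"
        using sheaf_homs_res[OF \<phi> V W(2,4) X] \<phi>_eq[OF W(1-3) XW] by simp
      also have "d_tensor M C L W (res C V W f) (res L V W X) = res EndL V W (d_tensor M C L V f X)"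
        by (rule d_tensor_res[OF V(1) W(2,4) f X, symmetric])
      also have "res C V W f \<odot>\<^bsub>sect EndL W\<^esub> res EndL V W (\<phi> V X) = res EndL V W (f \<odot>\<^bsub>sect EndL V\<^esub> \<phi> V X)"
        using LE.G.res_smult[OF V(1) _ f cl[OF X], of W] W by simp
      finally show "res EndL V W (\<phi> V (f \<odot>\<^bsub>sect L V\<^esub> X))
        = res EndL V W (f \<odot>\<^bsub>sect EndL V\<^esub> \<phi> V X \<oplus>\<^bsub>sect EndL V\<^esub> d_tensor M C L V f X)"
        using add fX d unfolding additive_map_def by metis
    qed
    assume Y: "Y \<in> carrier (sect L V)"
    show "\<phi> V (X \<oplus>\<^bsub>sect L V\<^esub> Y) = \<phi> V X \<oplus>\<^bsub>sect EndL V\<^esub> \<phi> V Y"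
    proof (rule LE.G.eq_if_locally_eq[OF op V])
      fix U W assume W: "U \<in> \<U>" "openin M W" "W \<subseteq> U" "W \<subseteq> V"
      have add: "additive_map (sect EndL V) (sect EndL W) (res EndL V W)"
        "additive_map (sect L V) (sect L W) (res L V W)"
        using V W LE.G.res_add LL.F.res_add by auto
      have "res EndL V W (\<phi> V (X \<oplus>\<^bsub>sect L V\<^esub> Y)) = D U W (res L V W X \<oplus>\<^bsub>sect L W\<^esub> res L V W Y)"
        using sheaf_homs_res[OF \<phi> V W(2,4) L.M.a_closed[OF X Y]]
          \<phi>_eq[OF W(1-3) L_cl[OF W(2,4) L.M.a_closed[OF X Y]]] add(2) X Y
        by (simp add: additive_map_def)
      also have "\<dots> = D U W (res L V W X) \<oplus>\<^bsub>sect EndL W\<^esub> D U W (res L V W Y)"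
        by (rule connections_add[OF D[OF W(1)] W(2,3) L_cl[OF W(2,4) X] L_cl[OF W(2,4) Y]])
      also have "\<dots> = res EndL V W (\<phi> V X) \<oplus>\<^bsub>sect EndL W\<^esub> res EndL V W (\<phi> V Y)"
        using sheaf_homs_res[OF \<phi> V W(2,4) X] \<phi>_eq[OF W(1-3) L_cl[OF W(2,4) X]]
          sheaf_homs_res[OF \<phi> V W(2,4) Y] \<phi>_eq[OF W(1-3) L_cl[OF W(2,4) Y]] by simp
      finally show "res EndL V W (\<phi> V (X \<oplus>\<^bsub>sect L V\<^esub> Y)) = res EndL V W (\<phi> V X \<oplus>\<^bsub>sect EndL V\<^esub> \<phi> V Y)"
        using add(1) cl[OF X] cl[OF Y] unfolding additive_map_def by metis
    qed (use X Y cl E.M.a_closed L.M.a_closed in \<open>auto simp del: Hom_sheaf_carrier\<close>)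
  qed
  then show ?thesis by blast
qed

section \<open>The obstruction class\<close>

text \<open>In a local frame the connection annihilating the frame is \<open>\<nabla>\<^bsub>Y\<^esub> X = \<phi>\<^sup>-\<^sup>1 (Y (\<phi> X))\<close>,
  with \<open>Y\<close> acting on the components of \<open>\<phi> X\<close>.\<close>

lemma free_connection:
  assumes U: "openin M U" and \<phi>: "\<phi> \<in> linear_sheaf_homs M C U L (free_sheaf n C)"
    and bij: "\<And>V. V \<in> opens M U
      \<Longrightarrow> bij_betw (\<phi> V) (carrier (sect L V)) (carrier (sect (free_sheaf n C) V))"
  shows "\<exists>D. D \<in> connections M K C L U"
proof -
  define \<psi> where "\<psi> V = inv_into (carrier (sect L V)) (\<phi> V)" for V
  have free_carrier: "carrier (sect (free_sheaf n C) V) = {..<n} \<rightarrow>\<^sub>E carrier (sect C V)" for V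
    by (simp add: free_sheaf_def)
  have \<psi>_cl: "\<psi> V x \<in> carrier (sect L V)" and \<phi>\<psi>: "\<phi> V (\<psi> V x) = x"
    if "openin M V" "V \<subseteq> U" "x \<in> {..<n} \<rightarrow>\<^sub>E carrier (sect C V)" for V x
  proof -
    have "x \<in> \<phi> V ` carrier (sect L V)"
      using bij[of V] that by (simp add: bij_betw_def free_carrier)
    then show "\<psi> V x \<in> carrier (sect L V)" "\<phi> V (\<psi> V x) = x"
      unfolding \<psi>_def by (rule inv_into_into, rule f_inv_into_f)
  qed
  \<comment> \<open>Identities between sections of \<open>L\<close> are checked after applying
    \<open>\<phi>\<close>, component by component, where they become rules for derivations. From the
    inverse \<open>\<psi>\<close> only its being a right inverse enters.\<close>
  have inj: "X = Y" if "openin M V" "V \<subseteq> U" "X \<in> carrier (sect L V)" "Y \<in> carrier (sect L V)"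
    "\<And>i. i < n \<Longrightarrow> \<phi> V X i = \<phi> V Y i" for V X Y
  proof -
    have "\<phi> V X \<in> {..<n} \<rightarrow>\<^sub>E carrier (sect C V)" "\<phi> V Y \<in> {..<n} \<rightarrow>\<^sub>E carrier (sect C V)"
      using linear_sheaf_homs_closed[OF \<phi>] that by (auto simp: free_carrier[symmetric])
    then have "\<phi> V X = \<phi> V Y" using that(5) by (intro PiE_ext) auto
    then show ?thesis using bij[of V] that by (auto simp: bij_betw_def dest: inj_onD)
  qed
  have \<phi>_cl: "\<phi> V X i \<in> carrier (sect C V)"
    if "openin M V" "V \<subseteq> U" "X \<in> carrier (sect L V)" "i < n" for V X i
    using linear_sheaf_homs_closed[OF \<phi> that(1-3)] that(4) by (auto simp: free_carrier)
  have \<phi>_res: "\<phi> W (res L V W X) i = res C V W (\<phi> V X i)"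
    if "openin M V" "V \<subseteq> U" "openin M W" "W \<subseteq> V" "X \<in> carrier (sect L V)" "i < n" for V W X i
    using fun_cong[OF linear_sheaf_homs_res[OF \<phi> that(1-5)], of i] that(6)
    by (simp add: free_sheaf_def)
  have \<phi>_add: "\<phi> V (X \<oplus>\<^bsub>sect L V\<^esub> Y) i = \<phi> V X i \<oplus>\<^bsub>sect C V\<^esub> \<phi> V Y i"
    if "openin M V" "V \<subseteq> U" "X \<in> carrier (sect L V)" "Y \<in> carrier (sect L V)" "i < n" for V X Y i
    using linear_sheaf_homs_add[OF \<phi> that(1-4)] that(5) by (simp add: free_sheaf_def)
  have \<phi>_smult: "\<phi> V (f \<odot>\<^bsub>sect L V\<^esub> X) i = f \<otimes>\<^bsub>sect C V\<^esub> \<phi> V X i"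
    if "openin M V" "V \<subseteq> U" "f \<in> carrier (sect C V)" "X \<in> carrier (sect L V)" "i < n" for V X f i
    using linear_sheaf_homs_smult[OF \<phi> that(1-4)] that(5) by (simp add: free_sheaf_def)
  have L_res: "res L V W X \<in> carrier (sect L W)"
    if "openin M V" "openin M W" "W \<subseteq> V" "X \<in> carrier (sect L V)" for V W X
    using that LL.F.res_closed[of V W X] by simp
  \<comment> \<open>The covariant derivative of \<open>X\<close> along \<open>Y\<close>: the section
    whose components are the derivatives of the components of \<open>X\<close>.\<close>
  define c where "c V X Y = \<psi> V (\<lambda>i\<in>{..<n}. anchor (sect L V) Y (\<phi> V X i))" for V X Y
  have a_cl: "anchor (sect L V) Y (\<phi> V X i) \<in> carrier (sect C V)"
    if "openin M V" "V \<subseteq> U" "X \<in> carrier (sect L V)" "Y \<in> carrier (sect L V)" "i < n" for V X Y i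
    using hrl_algebra.anchor_closed[OF sections_hrl] \<phi>_cl that by simp
  have c_cl: "c V X Y \<in> carrier (sect L V)"
    and \<phi>_c: "i < n \<Longrightarrow> \<phi> V (c V X Y) i = anchor (sect L V) Y (\<phi> V X i)"
    if "openin M V" "V \<subseteq> U" "X \<in> carrier (sect L V)" "Y \<in> carrier (sect L V)" for V X Y i
  proof -
    have "(\<lambda>i\<in>{..<n}. anchor (sect L V) Y (\<phi> V X i)) \<in> {..<n} \<rightarrow>\<^sub>E carrier (sect C V)"
      using a_cl[OF that] by auto
    note * = \<psi>_cl[OF that(1,2) this] \<phi>\<psi>[OF that(1,2) this]
    show "c V X Y \<in> carrier (sect L V)" using * by (simp add: c_def)
    show "\<phi> V (c V X Y) i = anchor (sect L V) Y (\<phi> V X i)" if "i < n"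
      using * that by (simp add: c_def)
  qed
  have c_res: "res L V W (c V X Y) = c W (res L V W X) (res L V W Y)"
    if V: "openin M V" "V \<subseteq> U" and W: "openin M W" "W \<subseteq> V"
      and XY: "X \<in> carrier (sect L V)" "Y \<in> carrier (sect L V)" for V W X Y
  proof -
    have W': "W \<subseteq> U" using V W by auto
    note r = L_res[OF V(1) W]
    show ?thesis
    proof (rule inj[OF W(1) W' r[OF c_cl[OF V XY]] c_cl[OF W(1) W' r[OF XY(1)] r[OF XY(2)]]])
      fix i assume i: "i < n"
      show "\<phi> W (res L V W (c V X Y)) i = \<phi> W (c W (res L V W X) (res L V W Y)) i"
        using V W XY i \<phi>_res[OF V W c_cl[OF V XY] i] \<phi>_c[OF V XY i]
          \<phi>_c[OF W(1) W' r[OF XY(1)] r[OF XY(2)] i] \<phi>_res[OF V W XY(1) i] \<phi>_cl[OF V XY(1) i]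
        by (simp add: res_anchor)
    qed
  qed
  \<comment> \<open>As a section of \<open>EndL\<close> over \<open>V\<close>, this must act on
    fields \<open>Y\<close> over every smaller \<open>W\<close>; hence \<open>X\<close> is first
    restricted to the set where \<open>Y\<close> lives.\<close>
  define N where "N V X = (\<lambda>W\<in>opens M V. \<lambda>Y\<in>carrier (sect L W). c W (res L V W X) Y)" for V X
  have N_apply: "N V X W Y = c W (res L V W X) Y"
    if "openin M W" "W \<subseteq> V" "Y \<in> carrier (sect L W)" for V X W Y
    using that by (simp add: N_def)
  have N_cl: "N V X \<in> linear_sheaf_homs M C V L L"
    if V: "openin M V" "V \<subseteq> U" and X: "X \<in> carrier (sect L V)" for V X
  proof (rule linear_sheaf_homsI)
    show "N V X \<in> sheaf_homs M V L L"
      unfolding N_def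
    proof (rule sheaf_homsI[OF _ _ L_sheaf])
      fix W Y assume W: "openin M W" "W \<subseteq> V" and Y: "Y \<in> carrier (sect L W)"
      have W': "W \<subseteq> U" using V W by auto
      note XW = L_res[OF V(1) W X]
      show "c W (res L V W X) Y \<in> carrier (sect L W)" by (rule c_cl[OF W(1) W' XW Y])
      show "res L W W2 (c W (res L V W X) Y) = c W2 (res L V W2 X) (res L W W2 Y)"
        if "openin M W2" "W2 \<subseteq> W" for W2
        using c_res[OF W(1) W' that XW Y] LL.F.res_comp[of V W W2 X] V W X that by simp
    qed
    fix W Y Z assume W: "openin M W" "W \<subseteq> V" and Y: "Y \<in> carrier (sect L W)"
    have W': "W \<subseteq> U" using V W by auto
    interpret W: Module.module "sect C W" "sect L W" using W by (rule_tac LL.F.sect_module)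
    note XW = L_res[OF V(1) W X]
    note cY = c_cl[OF W(1) W' XW Y]
    show "N V X W (f \<odot>\<^bsub>sect L W\<^esub> Y) = f \<odot>\<^bsub>sect L W\<^esub> N V X W Y" if f: "f \<in> carrier (sect C W)" for f
    proof -
      note fY = W.smult_closed[OF f Y]
      have "c W (res L V W X) (f \<odot>\<^bsub>sect L W\<^esub> Y) = f \<odot>\<^bsub>sect L W\<^esub> c W (res L V W X) Y"
      proof (rule inj[OF W(1) W' c_cl[OF W(1) W' XW fY] W.smult_closed[OF f cY]])
        fix i assume i: "i < n"
        show "\<phi> W (c W (res L V W X) (f \<odot>\<^bsub>sect L W\<^esub> Y)) i
          = \<phi> W (f \<odot>\<^bsub>sect L W\<^esub> c W (res L V W X) Y) i"
          using \<phi>_c[OF W(1) W' XW fY i] \<phi>_c[OF W(1) W' XW Y i] \<phi>_smult[OF W(1) W' f cY i]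
            hrl_algebra.anchor_smult[OF sections_hrl[OF W(1)] f Y \<phi>_cl[OF W(1) W' XW i]] by simp
      qed
      then show ?thesis using W Y fY by (simp add: N_apply)
    qed
    assume Z: "Z \<in> carrier (sect L W)"
    note cZ = c_cl[OF W(1) W' XW Z] and YZ = W.M.a_closed[OF Y Z]
    have "c W (res L V W X) (Y \<oplus>\<^bsub>sect L W\<^esub> Z) = c W (res L V W X) Y \<oplus>\<^bsub>sect L W\<^esub> c W (res L V W X) Z"
    proof (rule inj[OF W(1) W' c_cl[OF W(1) W' XW YZ] W.M.a_closed[OF cY cZ]])
      fix i assume i: "i < n"
      show "\<phi> W (c W (res L V W X) (Y \<oplus>\<^bsub>sect L W\<^esub> Z)) i
        = \<phi> W (c W (res L V W X) Y \<oplus>\<^bsub>sect L W\<^esub> c W (res L V W X) Z) i"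
        using \<phi>_c[OF W(1) W' XW YZ i] \<phi>_c[OF W(1) W' XW Y i] \<phi>_c[OF W(1) W' XW Z i]
          \<phi>_add[OF W(1) W' cY cZ i]
          hrl_algebra.anchor_add[OF sections_hrl[OF W(1)] Y Z \<phi>_cl[OF W(1) W' XW i]] by simp
    qed
    then show "N V X W (Y \<oplus>\<^bsub>sect L W\<^esub> Z) = N V X W Y \<oplus>\<^bsub>sect L W\<^esub> N V X W Z"
      using W Y Z by (simp add: N_apply)
  qed
  define D where "D = (\<lambda>V\<in>opens M U. \<lambda>X\<in>carrier (sect L V). N V X)"
  have D_apply: "D V X = N V X" if "openin M V" "V \<subseteq> U" "X \<in> carrier (sect L V)" for V X
    using that by (simp add: D_def)
  have "D \<in> connections M K C L U"
  proof (rule connectionsI)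
    show "D \<in> sheaf_homs M U L EndL"
      unfolding D_def
    proof (rule sheaf_homsI[OF _ _ L_sheaf])
      fix V X assume V: "openin M V" "V \<subseteq> U" and X: "X \<in> carrier (sect L V)"
      show "N V X \<in> carrier (sect EndL V)" using N_cl[OF V X] by simp
      fix W assume W: "openin M W" "W \<subseteq> V"
      have W': "W \<subseteq> U" using V W by auto
      show "res EndL V W (N V X) = N W (res L V W X)"
        unfolding Hom_sheaf_res
      proof (rule linear_sheaf_homs_eqI[OF linear_sheaf_homs_restrict[OF N_cl[OF V X] W(2)]
            N_cl[OF W(1) W' L_res[OF V(1) W X]]])
        fix W2 Y assume W2: "openin M W2" "W2 \<subseteq> W" and Y: "Y \<in> carrier (sect L W2)"
        have "W2 \<subseteq> V" using W W2 by auto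
        then show "restrict (N V X) (opens M W) W2 Y = N W (res L V W X) W2 Y"
          using W2 Y V W X LL.F.res_comp[of V W W2 X] by (simp add: N_apply)
      qed
    qed
  next
    fix V X assume V: "openin M V" "V \<subseteq> U" and X: "X \<in> carrier (sect L V)"
    interpret V: Module.module "sect C V" "sect L V" using V by (rule_tac LL.F.sect_module)
    show "D V (X \<oplus>\<^bsub>sect L V\<^esub> Y) = D V X \<oplus>\<^bsub>sect EndL V\<^esub> D V Y" if Y: "Y \<in> carrier (sect L V)" for Y
    proof -
      note XY = V.M.a_closed[OF X Y]
      have "N V (X \<oplus>\<^bsub>sect L V\<^esub> Y) = N V X \<oplus>\<^bsub>sect EndL V\<^esub> N V Y"
      proof (rule linear_sheaf_homs_eqI[OF N_cl[OF V XY] LL.Hom_sheaf_add_closed[OF N_cl[OF V X] N_cl[OF V Y]]])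
        fix W Z assume W: "openin M W" "W \<subseteq> V" and Z: "Z \<in> carrier (sect L W)"
        have W': "W \<subseteq> U" using V W by auto
        interpret W: Module.module "sect C W" "sect L W" using W by (rule_tac LL.F.sect_module)
        note XW = L_res[OF V(1) W X] and YW = L_res[OF V(1) W Y]
        note cX = c_cl[OF W(1) W' XW Z] and cY = c_cl[OF W(1) W' YW Z]
        have rXY: "res L V W (X \<oplus>\<^bsub>sect L V\<^esub> Y) = res L V W X \<oplus>\<^bsub>sect L W\<^esub> res L V W Y"
          using LL.F.res_add[of V W] V W X Y by (simp add: additive_map_def)
        have "c W (res L V W X \<oplus>\<^bsub>sect L W\<^esub> res L V W Y) Z
          = c W (res L V W X) Z \<oplus>\<^bsub>sect L W\<^esub> c W (res L V W Y) Z"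
        proof (rule inj[OF W(1) W' c_cl[OF W(1) W' W.M.a_closed[OF XW YW] Z] W.M.a_closed[OF cX cY]])
          fix i assume i: "i < n"
          show "\<phi> W (c W (res L V W X \<oplus>\<^bsub>sect L W\<^esub> res L V W Y) Z) i
            = \<phi> W (c W (res L V W X) Z \<oplus>\<^bsub>sect L W\<^esub> c W (res L V W Y) Z) i"
            using \<phi>_c[OF W(1) W' W.M.a_closed[OF XW YW] Z i] \<phi>_c[OF W(1) W' XW Z i]
              \<phi>_c[OF W(1) W' YW Z i] \<phi>_add[OF W(1) W' cX cY i] \<phi>_add[OF W(1) W' XW YW i]
              hrl_algebra.anchor_add_right[OF sections_hrl[OF W(1)] Z \<phi>_cl[OF W(1) W' XW i]
                \<phi>_cl[OF W(1) W' YW i]] by simp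
        qed
        then show "N V (X \<oplus>\<^bsub>sect L V\<^esub> Y) W Z = (N V X \<oplus>\<^bsub>sect EndL V\<^esub> N V Y) W Z"
          using W Z by (simp add: N_apply rXY)
      qed
      then show ?thesis using V X Y XY by (simp add: D_apply)
    qed
    show "D V (f \<odot>\<^bsub>sect L V\<^esub> X) = f \<odot>\<^bsub>sect EndL V\<^esub> D V X \<oplus>\<^bsub>sect EndL V\<^esub> d_tensor M C L V f X"
      if f: "f \<in> carrier (sect C V)" for f
    proof -
      note fX = V.smult_closed[OF f X]
      have "N V (f \<odot>\<^bsub>sect L V\<^esub> X) = f \<odot>\<^bsub>sect EndL V\<^esub> N V X \<oplus>\<^bsub>sect EndL V\<^esub> d_tensor M C L V f X"
      proof (rule linear_sheaf_homs_eqI[OF N_cl[OF V fX] LL.Hom_sheaf_add_closed[OF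
              LL.Hom_sheaf_smult_closed[OF V(1) f N_cl[OF V X]] d_tensor_closed[OF V(1) f X]]])
        fix W Z assume W: "openin M W" "W \<subseteq> V" and Z: "Z \<in> carrier (sect L W)"
        have W': "W \<subseteq> U" using V W by auto
        interpret W: Module.module "sect C W" "sect L W" using W by (rule_tac LL.F.sect_module)
        let ?f = "res C V W f" and ?X = "res L V W X"
        have fW: "?f \<in> carrier (sect C W)"
          using V W f LL.F.C.res_closed[of V W f] by simp
        note XW = L_res[OF V(1) W X]
        note cX = c_cl[OF W(1) W' XW Z]
        have rfX: "res L V W (f \<odot>\<^bsub>sect L V\<^esub> X) = ?f \<odot>\<^bsub>sect L W\<^esub> ?X"
          using L_res_smult[OF V(1) _ f X, of W] W by simp
        have aZ: "anchor (sect L W) Z ?f \<in> carrier (sect C W)"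
          using hrl_algebra.anchor_closed[OF sections_hrl[OF W(1)] Z fW] .
        note sm = W.smult_closed[OF fW cX] W.smult_closed[OF aZ XW]
        have "c W (?f \<odot>\<^bsub>sect L W\<^esub> ?X) Z
          = ?f \<odot>\<^bsub>sect L W\<^esub> c W ?X Z \<oplus>\<^bsub>sect L W\<^esub> anchor (sect L W) Z ?f \<odot>\<^bsub>sect L W\<^esub> ?X"
        proof (rule inj[OF W(1) W' c_cl[OF W(1) W' W.smult_closed[OF fW XW] Z] W.M.a_closed[OF sm]])
          fix i assume i: "i < n"
          \<comment> \<open>The product rule for the derivation \<open>Z\<close>, applied to the
            product of \<open>?f\<close> with the \<open>i\<close>-th component of
            \<open>?X\<close>. The summand that differentiates \<open>?f\<close> is the component of
            the \<open>d_tensor\<close> term.\<close>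
          have "\<phi> W (c W (?f \<odot>\<^bsub>sect L W\<^esub> ?X) Z) i
            = anchor (sect L W) Z ?f \<otimes>\<^bsub>sect C W\<^esub> \<phi> W ?X i \<oplus>\<^bsub>sect C W\<^esub>
              ?f \<otimes>\<^bsub>sect C W\<^esub> anchor (sect L W) Z (\<phi> W ?X i)"
            using \<phi>_c[OF W(1) W' W.smult_closed[OF fW XW] Z i] \<phi>_smult[OF W(1) W' fW XW i]
              hrl_algebra.anchor_mult[OF sections_hrl[OF W(1)] Z fW \<phi>_cl[OF W(1) W' XW i]] by simp
          also have "\<dots> = ?f \<otimes>\<^bsub>sect C W\<^esub> anchor (sect L W) Z (\<phi> W ?X i) \<oplus>\<^bsub>sect C W\<^esub>
              anchor (sect L W) Z ?f \<otimes>\<^bsub>sect C W\<^esub> \<phi> W ?X i"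
            by (rule W.R.a_comm) (use aZ fW \<phi>_cl[OF W(1) W' XW i] a_cl[OF W(1) W' XW Z i] in auto)
          also have "\<dots> = \<phi> W (?f \<odot>\<^bsub>sect L W\<^esub> c W ?X Z \<oplus>\<^bsub>sect L W\<^esub>
              anchor (sect L W) Z ?f \<odot>\<^bsub>sect L W\<^esub> ?X) i"
            using \<phi>_add[OF W(1) W' sm i] \<phi>_smult[OF W(1) W' fW cX i] \<phi>_smult[OF W(1) W' aZ XW i]
              \<phi>_c[OF W(1) W' XW Z i] by simp
          finally show "\<phi> W (c W (?f \<odot>\<^bsub>sect L W\<^esub> ?X) Z) i = \<dots>" .
        qed
        then show "N V (f \<odot>\<^bsub>sect L V\<^esub> X) W Z
          = (f \<odot>\<^bsub>sect EndL V\<^esub> N V X \<oplus>\<^bsub>sect EndL V\<^esub> d_tensor M C L V f X) W Z"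
          using W Z by (simp add: N_apply rfX d_tensor_def)
      qed
      then show ?thesis using V X fX by (simp add: D_apply)
    qed
  qed
  then show ?thesis by blast
qed

section \<open>The cocycle of differences and its cohomology class\<close>

lemma connection_differences_hom_diff:
  "connection_differences M C L D U V = hom_diff (U \<inter> V) (D V) (D U)"
  by (simp add: connection_differences_def hom_diff_def)

lemma connection_differences_closed:
  assumes "D \<in> local_connections M K C L \<U>" "U \<in> \<U>" "V \<in> \<U>"
  shows "connection_differences M C L D U V \<in> linear_sheaf_homs M C (U \<inter> V) L EndL"
  unfolding connection_differences_hom_diff
  using assms by (intro hom_diff_connections[of "D V" V "D U" U]) (auto simp: local_connections_def)

text \<open>The cochain looks like the coboundary of \<open>D\<close>, but \<open>D U\<close> is not
  a section of \<open>HomLE\<close>, so this does not make it trivial. The telescoping is carried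
  out after evaluation, in the group \<open>sect EndL N\<close>.\<close>

lemma connection_differences_cocycle:
  assumes \<U>: "\<U> \<in> open_covers M" and D: "D \<in> local_connections M K C L \<U>"
  shows "connection_differences M C L D \<in> cech_cocycles HomLE \<U>"
  unfolding cech_cocycles_def
proof (intro CollectI conjI ballI)
  let ?c = "connection_differences M C L D"
  fix U V assume UV: "U \<in> \<U>" "V \<in> \<U>"
  show "?c U V \<in> carrier (sect HomLE (U \<inter> V))"
    using connection_differences_closed[OF D UV] by simp
  fix W assume W: "W \<in> \<U>"
  let ?I = "U \<inter> V \<inter> W"
  have I: "openin M ?I" using UV W \<U> by (auto simp: open_covers_def)
  interpret I: abelian_group "sect HomLE ?I" using I by (rule H.sect_abelian_group)
  have cl: "res HomLE (V \<inter> W) ?I (?c V W) \<in> linear_sheaf_homs M C ?I L EndL"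
    "res HomLE (U \<inter> W) ?I (?c U W) \<in> linear_sheaf_homs M C ?I L EndL"
    "res HomLE (U \<inter> V) ?I (?c U V) \<in> linear_sheaf_homs M C ?I L EndL"
    using connection_differences_closed[OF D] UV W
    by (auto simp: Hom_sheaf_res intro!: linear_sheaf_homs_restrict)
  have m: "res HomLE (V \<inter> W) ?I (?c V W) \<ominus>\<^bsub>sect HomLE ?I\<^esub> res HomLE (U \<inter> W) ?I (?c U W)
    \<in> linear_sheaf_homs M C ?I L EndL"
    using I.minus_closed cl by simp
  show "(res HomLE (V \<inter> W) ?I (?c V W) \<ominus>\<^bsub>sect HomLE ?I\<^esub> res HomLE (U \<inter> W) ?I (?c U W))
      \<oplus>\<^bsub>sect HomLE ?I\<^esub> res HomLE (U \<inter> V) ?I (?c U V) = \<zero>\<^bsub>sect HomLE ?I\<^esub>"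
  proof (rule linear_sheaf_homs_eqI[OF LE.Hom_sheaf_add_closed[OF m cl(3)] LE.Hom_sheaf_zero_closed[OF I]])
    fix N X assume N: "openin M N" "N \<subseteq> ?I" and X: "X \<in> carrier (sect L N)"
    interpret E: abelian_group "sect EndL N" using N by (rule_tac LE.G.sect_abelian_group)
    have d: "D A N X \<in> carrier (sect EndL N)" if "A \<in> \<U>" "N \<subseteq> A" for A
      using connections_closed[of "D A" A N X] D N X that by (simp add: local_connections_def)
    show "((res HomLE (V \<inter> W) ?I (?c V W) \<ominus>\<^bsub>sect HomLE ?I\<^esub> res HomLE (U \<inter> W) ?I (?c U W))
      \<oplus>\<^bsub>sect HomLE ?I\<^esub> res HomLE (U \<inter> V) ?I (?c U V)) N X = \<zero>\<^bsub>sect HomLE ?I\<^esub> N X"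
      unfolding Hom_sheaf_add_apply[OF N X] LE.Hom_sheaf_minus_apply[OF I N X cl(1,2)]
      using N X d UV W
      by (simp add: connection_differences_hom_diff E.diff_cocycle del: Hom_sheaf_carrier)
  qed
qed

lemma connection_differences_pair:
  "\<lbrakk>\<U> \<in> open_covers M; D \<in> local_connections M K C L \<U>\<rbrakk>
    \<Longrightarrow> (\<U>, connection_differences M C L D) \<in> cech_pairs M HomLE"
  by (simp add: cech_pairs_def connection_differences_cocycle)

lemma pull_back_connection_differences_apply:
  assumes "openin M N" "N \<subseteq> V \<inter> W" "V \<subseteq> \<tau> V" "W \<subseteq> \<tau> W" "X \<in> carrier (sect L N)"
  shows "pull_back HomLE \<tau> (connection_differences M C L D) V W N X
    = D (\<tau> W) N X \<ominus>\<^bsub>sect EndL N\<^esub> D (\<tau> V) N X"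
proof -
  have "N \<subseteq> \<tau> V" "N \<subseteq> \<tau> W" using assms by auto
  then show ?thesis using assms
    by (simp add: pull_back_def connection_differences_hom_diff)
qed

text \<open>On a common refinement both systems give connections over neighbourhoods of the same
  sets, so one cochain accounts for the change of cover and of connections at once.\<close>

lemma obstruction_independent:
  assumes \<U>: "\<U> \<in> open_covers M" and D: "D \<in> local_connections M K C L \<U>"
    and \<V>: "\<V> \<in> open_covers M" and D': "D' \<in> local_connections M K C L \<V>"
  shows "cohomology_class M HomLE \<U> (connection_differences M C L D)
    = cohomology_class M HomLE \<V> (connection_differences M C L D')"
proof -
  let ?c = "connection_differences M C L D" and ?d = "connection_differences M C L D'"
  obtain \<W> \<sigma> \<tau> where \<W>: "\<W> \<in> open_covers M" and \<sigma>: "\<sigma> \<in> refinement_maps \<W> \<U>"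
    and \<tau>: "\<tau> \<in> refinement_maps \<W> \<V>"
    using common_refinement[OF \<U> \<V>] by blast
  have ref: "\<sigma> W \<in> \<U>" "W \<subseteq> \<sigma> W" "\<tau> W \<in> \<V>" "W \<subseteq> \<tau> W" "openin M W" if "W \<in> \<W>" for W
    using that \<sigma> \<tau> \<W> by (auto simp: refinement_maps_def open_covers_def)
  have con: "D (\<sigma> W) \<in> connections M K C L (\<sigma> W)" "D' (\<tau> W) \<in> connections M K C L (\<tau> W)"
    if "W \<in> \<W>" for W
    using ref[OF that] D D' by (auto simp: local_connections_def)
  \<comment> \<open>Neither term is linear over \<open>C\<close>, but their difference is, so
    \<open>b\<close> is a cochain with values in \<open>HomLE\<close>.\<close>
  define b where "b W = hom_diff W (D (\<sigma> W)) (D' (\<tau> W))" for W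
  have b: "b W \<in> linear_sheaf_homs M C W L EndL" if "W \<in> \<W>" for W
    unfolding b_def by (rule hom_diff_connections[OF con[OF that]]) (use ref[OF that] in auto)
  have "cohomologous HomLE \<W> (pull_back HomLE \<sigma> ?c) (pull_back HomLE \<tau> ?d)"
    unfolding cohomologous_def
  proof (intro exI[of _ b] conjI ballI)
    show "b W \<in> carrier (sect HomLE W)" if "W \<in> \<W>" for W using b[OF that] by simp
    fix V W assume VW: "V \<in> \<W>" "W \<in> \<W>"
    let ?I = "V \<inter> W"
    have I: "openin M ?I" using ref VW by auto
    interpret I: abelian_group "sect HomLE ?I" using I by (rule H.sect_abelian_group)
    have cl: "pull_back HomLE \<sigma> ?c V W \<in> linear_sheaf_homs M C ?I L EndL"
      "pull_back HomLE \<tau> ?d V W \<in> linear_sheaf_homs M C ?I L EndL"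
      using H.pull_back_closed[OF \<U> \<W> \<sigma> H.cocycle_closed[OF connection_differences_cocycle[OF \<U> D]] VW]
        H.pull_back_closed[OF \<V> \<W> \<tau> H.cocycle_closed[OF connection_differences_cocycle[OF \<V> D']] VW]
      by simp_all
    have bcl: "res HomLE W ?I (b W) \<in> linear_sheaf_homs M C ?I L EndL"
      "res HomLE V ?I (b V) \<in> linear_sheaf_homs M C ?I L EndL"
      using b VW by (auto simp: Hom_sheaf_res intro!: linear_sheaf_homs_restrict)
    have m: "pull_back HomLE \<sigma> ?c V W \<ominus>\<^bsub>sect HomLE ?I\<^esub> pull_back HomLE \<tau> ?d V W
        \<in> linear_sheaf_homs M C ?I L EndL"
      "res HomLE W ?I (b W) \<ominus>\<^bsub>sect HomLE ?I\<^esub> res HomLE V ?I (b V) \<in> linear_sheaf_homs M C ?I L EndL"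
      using I.minus_closed cl bcl by simp_all
    show "pull_back HomLE \<sigma> ?c V W \<ominus>\<^bsub>sect HomLE ?I\<^esub> pull_back HomLE \<tau> ?d V W
      = res HomLE W ?I (b W) \<ominus>\<^bsub>sect HomLE ?I\<^esub> res HomLE V ?I (b V)"
    proof (rule linear_sheaf_homs_eqI[OF m])
      fix N X assume N: "openin M N" "N \<subseteq> ?I" and X: "X \<in> carrier (sect L N)"
      interpret E: abelian_group "sect EndL N" using N by (rule_tac LE.G.sect_abelian_group)
      have d: "D (\<sigma> A) N X \<in> carrier (sect EndL N)" "D' (\<tau> A) N X \<in> carrier (sect EndL N)"
        if "A \<in> {V, W}" for A
      proof -
        have "A \<in> \<W>" "N \<subseteq> \<sigma> A" "N \<subseteq> \<tau> A"
          using that VW N ref(2,4)[OF VW(1)] ref(2,4)[OF VW(2)] by auto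
        then show "D (\<sigma> A) N X \<in> carrier (sect EndL N)" "D' (\<tau> A) N X \<in> carrier (sect EndL N)"
          using connections_closed[OF con(1) N(1) _ X] connections_closed[OF con(2) N(1) _ X]
          by simp_all
      qed
      \<comment> \<open>Regrouping by cover member instead of by system turns the difference of the
        two cocycles into the coboundary of \<open>b\<close>.\<close>
      have "(D (\<sigma> W) N X \<ominus>\<^bsub>sect EndL N\<^esub> D (\<sigma> V) N X) \<ominus>\<^bsub>sect EndL N\<^esub>
          (D' (\<tau> W) N X \<ominus>\<^bsub>sect EndL N\<^esub> D' (\<tau> V) N X)
        = (D (\<sigma> W) N X \<ominus>\<^bsub>sect EndL N\<^esub> D' (\<tau> W) N X) \<ominus>\<^bsub>sect EndL N\<^esub>
          (D (\<sigma> V) N X \<ominus>\<^bsub>sect EndL N\<^esub> D' (\<tau> V) N X)"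
        by (rule E.diff_diff_swap) (use d in blast)+
      then show "(pull_back HomLE \<sigma> ?c V W \<ominus>\<^bsub>sect HomLE ?I\<^esub> pull_back HomLE \<tau> ?d V W) N X
        = (res HomLE W ?I (b W) \<ominus>\<^bsub>sect HomLE ?I\<^esub> res HomLE V ?I (b V)) N X"
        unfolding LE.Hom_sheaf_minus_apply[OF I N X cl] LE.Hom_sheaf_minus_apply[OF I N X bcl]
        using N X ref(2,4)[OF VW(1)] ref(2,4)[OF VW(2)]
        by (simp add: pull_back_connection_differences_apply b_def)
    qed
  qed
  then show ?thesis
    unfolding H.cohomology_class_eq_iff[OF connection_differences_pair[OF \<U> D]
      connection_differences_pair[OF \<V> D']] cech_rel_def
    using connection_differences_pair[OF \<U> D] connection_differences_pair[OF \<V> D'] \<W> \<sigma> \<tau> by blast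
qed

text \<open>On the cover by the whole space, the global connection serves as system of local
  connections, and its cocycle is \<open>D - D\<close>.\<close>

lemma obstruction_zero_if_connection:
  assumes D: "D \<in> connections M K C L (topspace M)"
  shows "\<exists>D'\<in>local_connections M K C L {topspace M}.
    cohomology_class M HomLE {topspace M} (connection_differences M C L D')
      = \<zero>\<^bsub>H1 M HomLE\<^esub>"
proof
  let ?T = "topspace M" and ?D = "\<lambda>_::'a set. D"
  let ?c = "connection_differences M C L ?D" and ?z = "\<lambda>U V. \<zero>\<^bsub>sect HomLE (U \<inter> V)\<^esub>"
  show DL: "?D \<in> local_connections M K C L {?T}" using D by (simp add: local_connections_def)
  have cov: "{?T} \<in> open_covers M" by (simp add: open_covers_def)
  have c: "?c ?T ?T = \<zero>\<^bsub>sect HomLE ?T\<^esub>"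
  proof (rule linear_sheaf_homs_eqI)
    show "?c ?T ?T \<in> linear_sheaf_homs M C ?T L EndL"
      using connection_differences_closed[OF DL, of ?T ?T] by simp
    show "\<zero>\<^bsub>sect HomLE ?T\<^esub> \<in> linear_sheaf_homs M C ?T L EndL"
      by (rule LE.Hom_sheaf_zero_closed) simp
    fix V X assume V: "openin M V" "V \<subseteq> ?T" and X: "X \<in> carrier (sect L V)"
    interpret E: abelian_group "sect EndL V" using V by (rule_tac LE.G.sect_abelian_group)
    show "?c ?T ?T V X = \<zero>\<^bsub>sect HomLE ?T\<^esub> V X"
      using V X connections_closed[OF D V X]
      by (simp add: connection_differences_hom_diff E.minus_eq E.r_neg)
  qed
  have z: "?z \<in> cech_cocycles HomLE {?T}"
    using H.zero_cochain by (simp add: cech_pairs_def)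
  have id: "id \<in> refinement_maps {?T} {?T}" by (auto simp: refinement_maps_def)
  have "cohomologous HomLE {?T} (pull_back HomLE id ?z) (pull_back HomLE id ?z)"
    by (rule H.cohomologous_refl[OF cov H.pull_back_closed[OF cov cov id H.cocycle_closed[OF z]]])
  \<comment> \<open>The two cochains are known to agree at the single member of the cover, which is
    why \<open>cohomologous_cong\<close> is used rather than a rewrite of functions.\<close>
  then have "cohomologous HomLE {?T} (pull_back HomLE id ?c) (pull_back HomLE id ?z)"
    by (rule H.cohomologous_cong) (auto simp: pull_back_def c)
  then have "(({?T}, ?c), ({?T}, ?z)) \<in> cech_rel M HomLE"
    unfolding cech_rel_def
    using connection_differences_pair[OF cov DL] H.zero_cochain cov id by blast
  then show "cohomology_class M HomLE {?T} ?c = \<zero>\<^bsub>H1 M HomLE\<^esub>"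
    using H.cohomology_class_eq_iff[OF connection_differences_pair[OF cov DL] H.zero_cochain]
    by (simp add: H1_def)
qed

lemma connection_if_obstruction_zero:
  assumes \<U>: "\<U> \<in> open_covers M" and D: "D \<in> local_connections M K C L \<U>"
    and zero: "cohomology_class M HomLE \<U> (connection_differences M C L D) = \<zero>\<^bsub>H1 M HomLE\<^esub>"
  shows "\<exists>D. D \<in> connections M K C L (topspace M)"
proof -
  let ?T = "topspace M" and ?c = "connection_differences M C L D"
  let ?z = "\<lambda>U V. \<zero>\<^bsub>sect HomLE (U \<inter> V)\<^esub>"
  have "((\<U>, ?c), ({?T}, ?z)) \<in> cech_rel M HomLE"
    using zero H.cohomology_class_eq_iff[OF connection_differences_pair[OF \<U> D] H.zero_cochain]
    by (simp add: H1_def)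
  then obtain \<W> \<sigma> \<tau> where \<W>: "\<W> \<in> open_covers M" and \<sigma>: "\<sigma> \<in> refinement_maps \<W> \<U>"
    and \<tau>: "\<tau> \<in> refinement_maps \<W> {?T}"
    and coh: "cohomologous HomLE \<W> (pull_back HomLE \<sigma> ?c) (pull_back HomLE \<tau> ?z)"
    by (auto simp: cech_rel_def)
  obtain b where b: "\<And>W. W \<in> \<W> \<Longrightarrow> b W \<in> linear_sheaf_homs M C W L EndL"
    and eq: "\<And>V W. \<lbrakk>V \<in> \<W>; W \<in> \<W>\<rbrakk> \<Longrightarrow>
      pull_back HomLE \<sigma> ?c V W \<ominus>\<^bsub>sect HomLE (V \<inter> W)\<^esub> pull_back HomLE \<tau> ?z V W
      = res HomLE W (V \<inter> W) (b W) \<ominus>\<^bsub>sect HomLE (V \<inter> W)\<^esub> res HomLE V (V \<inter> W) (b V)"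
    using coh unfolding cohomologous_def Hom_sheaf_carrier by blast
  have ref: "\<sigma> W \<in> \<U>" "W \<subseteq> \<sigma> W" "\<tau> W = ?T" "W \<subseteq> ?T" "openin M W" if "W \<in> \<W>" for W
    using that \<sigma> \<tau> \<W> by (auto simp: refinement_maps_def open_covers_def dest: openin_subset)
  have con: "D (\<sigma> W) \<in> connections M K C L (\<sigma> W)" if "W \<in> \<W>" for W
    using ref[OF that] D by (auto simp: local_connections_def)
  \<comment> \<open>The cochain \<open>b\<close> exists only on the refinement \<open>\<W>\<close>,
    so the corrected connections are indexed by its members, with \<open>D\<close> borrowed from the
    larger set \<open>\<sigma> W\<close>.\<close>
  define E where "E W = hom_diff W (D (\<sigma> W)) (b W)" for W
  have "\<exists>D. D \<in> connections M K C L (\<Union>\<W>)"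
  proof (rule glue_connections)
    show "openin M W" if "W \<in> \<W>" for W using ref(5)[OF that] .
    show "E W \<in> connections M K C L W" if "W \<in> \<W>" for W
      unfolding E_def by (rule connection_minus_linear[OF con[OF that] b[OF that] ref(2)[OF that]])
    fix V W N X assume VW: "V \<in> \<W>" "W \<in> \<W>" and N: "openin M N" "N \<subseteq> V" "N \<subseteq> W"
      and X: "X \<in> carrier (sect L N)"
    let ?I = "V \<inter> W"
    have I: "openin M ?I" and NI: "N \<subseteq> ?I" using ref VW N by auto
    interpret E: abelian_group "sect EndL N" using N by (rule_tac LE.G.sect_abelian_group)
    have cl: "pull_back HomLE \<sigma> ?c V W \<in> linear_sheaf_homs M C ?I L EndL"
      using H.pull_back_closed[OF \<U> \<W> \<sigma> H.cocycle_closed[OF connection_differences_cocycle[OF \<U> D]] VW]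
      by simp
    \<comment> \<open>The second representative is the zero cochain on the cover by the whole space,
      and zero restricts to zero.\<close>
    have z: "pull_back HomLE \<tau> ?z V W = \<zero>\<^bsub>sect HomLE ?I\<^esub>"
      using H.res_zero[of ?T ?I] I ref(3,4) VW by (auto simp: pull_back_def)
    have bcl: "res HomLE W ?I (b W) \<in> linear_sheaf_homs M C ?I L EndL"
      "res HomLE V ?I (b V) \<in> linear_sheaf_homs M C ?I L EndL"
      using b VW by (auto simp: Hom_sheaf_res intro!: linear_sheaf_homs_restrict)
    have d: "D (\<sigma> A) N X \<in> carrier (sect EndL N)" "b A N X \<in> carrier (sect EndL N)"
      if "A = V \<or> A = W" for A
    proof -
      have "A \<in> \<W>" "N \<subseteq> \<sigma> A" "N \<subseteq> A"
        using that VW N ref(2)[OF VW(1)] ref(2)[OF VW(2)] by auto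
      then show "D (\<sigma> A) N X \<in> carrier (sect EndL N)" "b A N X \<in> carrier (sect EndL N)"
        using connections_closed[OF con N(1) _ X] linear_sheaf_homs_closed[OF b N(1) _ X]
        by simp_all
    qed
    have "(pull_back HomLE \<sigma> ?c V W \<ominus>\<^bsub>sect HomLE ?I\<^esub> \<zero>\<^bsub>sect HomLE ?I\<^esub>) N X
      = (res HomLE W ?I (b W) \<ominus>\<^bsub>sect HomLE ?I\<^esub> res HomLE V ?I (b V)) N X"
      using eq[OF VW] z by simp
    then have "(D (\<sigma> W) N X \<ominus>\<^bsub>sect EndL N\<^esub> D (\<sigma> V) N X) \<ominus>\<^bsub>sect EndL N\<^esub> \<zero>\<^bsub>sect EndL N\<^esub>
      = b W N X \<ominus>\<^bsub>sect EndL N\<^esub> b V N X"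
      using N NI X ref(2)[OF VW(1)] ref(2)[OF VW(2)]
      by (simp add: LE.Hom_sheaf_minus_apply[OF I N(1) NI X cl LE.Hom_sheaf_zero_closed[OF I]]
          LE.Hom_sheaf_minus_apply[OF I N(1) NI X bcl] pull_back_connection_differences_apply)
    then have "D (\<sigma> W) N X \<ominus>\<^bsub>sect EndL N\<^esub> D (\<sigma> V) N X = b W N X \<ominus>\<^bsub>sect EndL N\<^esub> b V N X"
      using d by (simp add: E.diff_zero del: Hom_sheaf_carrier)
    \<comment> \<open>Cocycle and coboundary use the same order, value at \<open>W\<close> minus
      value at \<open>V\<close>; so it is \<open>D - b\<close>, and not \<open>D + b\<close>, that
      agrees on overlaps.\<close>
    then have "D (\<sigma> W) N X \<ominus>\<^bsub>sect EndL N\<^esub> b W N X = D (\<sigma> V) N X \<ominus>\<^bsub>sect EndL N\<^esub> b V N X"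
      using d by (rule_tac E.diff_eq_diff_swap) simp_all
    then show "E V N X = E W N X"
      using N X by (simp add: E_def)
  qed
  then show ?thesis using \<W> by (simp add: open_covers_def)
qed

end

section \<open>Existence of local connections, and the theorem\<close>

lemma (in hrl_ringed_space_of_finite_rank) local_connections_exist:
  "\<exists>\<U>\<in>open_covers M. \<exists>D. D \<in> local_connections M K C L \<U>"
proof -
  obtain n where n: "locally_free M C n L" using finite_rank by blast
  \<comment> \<open>Taking all open sets that admit a connection yields a cover indexed by itself: a
    connection is chosen per member, with no choice of neighbourhoods of points.\<close>
  define \<U> where "\<U> = {U. openin M U \<and> (\<exists>D. D \<in> connections M K C L U)}"
  have "\<exists>U\<in>\<U>. x \<in> U" if x: "x \<in> topspace M" for x
  proof -
    obtain U \<phi> where U: "openin M U" "x \<in> U" and \<phi>: "\<phi> \<in> linear_sheaf_homs M C U L (free_sheaf n C)"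
      and bij: "\<forall>V\<in>opens M U. bij_betw (\<phi> V) (carrier (sect L V)) (carrier (sect (free_sheaf n C) V))"
      using bspec[OF n[unfolded locally_free_def] x] by (elim exE conjE bexE) (rule that)
    then show ?thesis
      using free_connection[OF U(1) \<phi> bspec[OF bij]] unfolding \<U>_def by blast
  qed
  then have "\<U> \<in> open_covers M"
    by (auto simp: open_covers_def \<U>_def dest: openin_subset)
  moreover have "\<forall>U\<in>\<U>. \<exists>D. D \<in> connections M K C L U" by (simp add: \<U>_def)
  then have "\<exists>D. D \<in> local_connections M K C L \<U>"
    unfolding local_connections_def mem_Collect_eq by (rule bchoice)
  ultimately show ?thesis by blast
qed

text \<open>The clause about \<open>b\<close> expresses well-definedness: some system of local
  connections exists, and every such system, on any cover, yields the class
  \<open>a\<close>.\<close>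

theorem theorem1p1:
  fixes M :: "'a topology"
    and K :: "'k ring"
    and C :: "('a, 'c, ('k, 'c) module) sheaf_data"
    and L :: "('a, 'l, ('k, 'c, 'l) hrl) sheaf_data"
  assumes "hrl_ringed_space_of_finite_rank M K C L"
  shows "\<exists>a \<in> carrier (H1 M (Hom_sheaf M C L (Hom_sheaf M C L L))).
    (\<forall>b. is_obstruction_class M K C L b \<longleftrightarrow> b = a) \<and>
    ((\<exists>D. D \<in> connections M K C L (topspace M))
      \<longleftrightarrow> a = \<zero>\<^bsub>H1 M (Hom_sheaf M C L (Hom_sheaf M C L L))\<^esub>)"
proof -
  interpret hrl_ringed_space_of_finite_rank M K C L by fact
  obtain \<U> D where \<U>: "\<U> \<in> open_covers M" and D: "D \<in> local_connections M K C L \<U>"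
    using local_connections_exist by blast
  let ?a = "cohomology_class M HomLE \<U> (connection_differences M C L D)"
  have "?a \<in> carrier (H1 M HomLE)"
    using quotientI[OF connection_differences_pair[OF \<U> D], of "cech_rel M HomLE"]
    by (simp add: H1_def cohomology_class_def)
  moreover have "is_obstruction_class M K C L b \<longleftrightarrow> b = ?a" for b
    unfolding is_obstruction_class_def using \<U> D obstruction_independent by blast
  moreover have "(\<exists>D. D \<in> connections M K C L (topspace M)) \<longleftrightarrow> ?a = \<zero>\<^bsub>H1 M HomLE\<^esub>"
  proof
    assume "\<exists>D. D \<in> connections M K C L (topspace M)"
    \<comment> \<open>The vanishing class is computed on the cover by the whole space and carried
      over to \<open>\<U>\<close> and \<open>D\<close> by independence of the choices.\<close>
    then obtain D' where "D' \<in> local_connections M K C L {topspace M}"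
      "cohomology_class M HomLE {topspace M} (connection_differences M C L D') = \<zero>\<^bsub>H1 M HomLE\<^esub>"
      using obstruction_zero_if_connection by blast
    moreover have "{topspace M} \<in> open_covers M" by (simp add: open_covers_def)
    ultimately show "?a = \<zero>\<^bsub>H1 M HomLE\<^esub>"
      using obstruction_independent[OF \<U> D] by metis
  next
    assume "?a = \<zero>\<^bsub>H1 M HomLE\<^esub>"
    then show "\<exists>D. D \<in> connections M K C L (topspace M)"
      by (rule connection_if_obstruction_zero[OF \<U> D])
  qed
  ultimately show ?thesis by blast
qed

end
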